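(* Assume the Generalized Riemann Hypothesis (for Dirichlet $L$-functions). Then for non-principal characters $\chi$ modulo a prime $q$, $$|\arg L(1,\chi)|\le \log_3 q+C_2+\log 2+o(1),$$ where $o(1)$ denotes a quantity tending to $0$ as $q\to\infty$, uniformly in $\chi$.
   Context: $\log_3 q=\log\log\log q$. $\arg L(1,\chi)$ is defined by continuous variation of $\arg L(\sigma,\chi)$ along the real axis from $\sigma=+\infty$ down to $\sigma=1$, the argument at infinity being $0$. The constant $C_2$ is $$C_2:=\lim_{x\to\infty}\left(\sum_{p\le x}\arctan\left(\frac{1}{\sqrt{p^2-1}}\right)-\log\log x\right),$$ where $p$ runs over primes. *)

theory Defs
  imports
    "HOL-Complex_Analysis.Complex_Analysis"
    "HOL-Computational_Algebra.Primes"
begin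

definition dirichlet_character :: "nat \<Rightarrow> (nat \<Rightarrow> complex) \<Rightarrow> bool" where
  "dirichlet_character q chi \<longleftrightarrow>
     q > 0 \<and>
     (\<forall>m n. chi (m * n) = chi m * chi n) \<and>
     (\<forall>n. chi (n + q) = chi n) \<and>
     (\<forall>n. chi n = 0 \<longleftrightarrow> \<not> coprime n q)"

definition principal_character :: "nat \<Rightarrow> nat \<Rightarrow> complex" where
  "principal_character q n = (if coprime n q then 1 else 0)"

definition L_domain :: "nat \<Rightarrow> (nat \<Rightarrow> complex) \<Rightarrow> complex set" where
  "L_domain q chi =
     (if chi = principal_character q then {s. Re s > 0} - {1} else {s. Re s > 0})"

text \<open>
  The L-function is the analytic continuation of its Dirichlet series from \<open>Re s > 1\<close>. Only the
  half-plane \<open>Re s > 0\<close> is relevant here. There the continuation exists, with the sole exception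
  of the pole at 1 for principal characters, and the identity theorem makes its values unique, so
  that the choice operator determines the function on \<open>L_domain q chi\<close>; nothing is claimed about
  its values elsewhere.
\<close>
definition Dirichlet_L :: "nat \<Rightarrow> (nat \<Rightarrow> complex) \<Rightarrow> complex \<Rightarrow> complex" where
  "Dirichlet_L q chi =
     (SOME f. f holomorphic_on L_domain q chi \<and>
        (\<forall>s. Re s > 1 \<longrightarrow> f s = (\<Sum>n. chi (Suc n) / of_nat (Suc n) powr s)))"

definition GRH :: bool where
  "GRH \<longleftrightarrow>
     (\<forall>q chi s. dirichlet_character q chi \<longrightarrow> 0 < Re s \<longrightarrow> Re s < 1 \<longrightarrow>
        Dirichlet_L q chi s = 0 \<longrightarrow> Re s = 1 / 2)"

text \<open>
  The argument at \<open>a\<close> obtained by continuous variation along the real axis from \<open>+\<infinity>\<close>,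
  where the argument is 0, down to \<open>a\<close>. It is not reduced modulo \<open>2 * pi\<close>.
\<close>
definition arg_from_infinity :: "(complex \<Rightarrow> complex) \<Rightarrow> real \<Rightarrow> real" where
  "arg_from_infinity f a =
     (THE t. \<exists>\<phi>. continuous_on {a..} \<phi> \<and>
        (\<forall>\<sigma>\<ge>a. f (of_real \<sigma>) = of_real (cmod (f (of_real \<sigma>))) * cis (\<phi> \<sigma>)) \<and>
        (\<phi> \<longlongrightarrow> 0) at_top \<and> t = \<phi> a)"

definition C2 :: real where
  "C2 = Lim at_top (\<lambda>x::real.
     (\<Sum>p | prime (p::nat) \<and> real p \<le> x. arctan (1 / sqrt (real p ^ 2 - 1))) - ln (ln x))"

end

theory Submission
  imports Defs "HOL-Number_Theory.Number_Theory" "HOL-Real_Asymp.Real_Asymp"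
begin

text \<open>
  Put \<open>x = (log q)^(2+\<epsilon>)\<close>. Under GRH, \<open>log L(s,chi)\<close> is holomorphic on \<open>Re s > 1/2\<close>, and by
  Borel-Caratheodory it is \<open>O(log q)\<close> on \<open>Re s \<ge> 1/2 + \<delta>\<close>, \<open>|Im s| \<le> (log q)^2\<close>. The prime powers
  contribute a series converging absolutely for \<open>Re s > 1/2\<close>, so \<open>F(s) = \<Sum>p. chi(p) p^(-1-s)\<close>
  continues to \<open>Re s > -1/2\<close> with the same bound. Integrating \<open>F(s) x^s (1/s + s/R^2)\<close> with
  \<open>R = (log q)^2\<close> over the right half of the circle \<open>|s| = R\<close>, closed by a rectangle reaching to
  \<open>Re s = -1/2 + \<delta>\<close>, and comparing with the partial sum over the full circle, gives
  \<open>F(0) = (\<Sum>p\<le>x. chi(p)/p) + o(1)\<close>: the kernel makes the circular parts \<open>O(1/R)\<close>, and the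
  rectangle contributes \<open>O(log q / R)\<close> and a negative power of \<open>log q\<close>. Hence \<open>arg L(1,chi)\<close>
  is \<open>o(1)\<close> plus \<open>\<Sum>p\<le>x. arg (1/(1 - chi(p)/p))\<close>, whose terms are at most \<open>arcsin (1/p)\<close>, and
  Mertens' theorem evaluates the resulting sum as \<open>log log x + C2 + o(1)\<close>, where
  \<open>log log x = log_3 q + log (2+\<epsilon>)\<close>.
\<close>

subsection \<open>Mertens' theorems and the constant C2\<close>

text \<open>The summand log 2 is the price of the critical line. Reaching
  \<open>Re s = -1/2 + \<delta>\<close> gains only x^(1/2 - \<delta>), which must beat the size log
  q of log L on the rectangle; so x has to exceed (log q)^2 slightly, and log log x carries that
  exponent. The radius R must outgrow log q, must not exceed x (this controls the partial sum on the
  left half-circle), and enters the bound for log L only through log(R + 4). The angle arcsin(1/p)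
  is that between the real axis and a tangent from 0 to the circle of radius 1/p about 1; the
  tangent has length sqrt(1 - 1/p^2), whence the arctangent in \<open>C2\<close>.
  \<open>Dirichlet_L\<close>, \<open>C2\<close> and \<open>arg_from_infinity\<close> are given by a
  choice, a \<open>Lim\<close> and a \<open>THE\<close>, so each needs an existence proof, and a
  uniqueness argument, before it can be evaluated.\<close>

lemma prod_primes_dvd:
  fixes N :: nat
  assumes "finite A" "\<And>p. p \<in> A \<Longrightarrow> prime p" "\<And>p. p \<in> A \<Longrightarrow> p dvd N"
  shows "\<Prod>A dvd N"
  using assms
proof (induction A rule: finite_induct)
  case (insert p A)
  have "coprime p (\<Prod>A)"
  proof (rule prod_coprime_right)
    fix r assume "r \<in> A"
    then show "coprime p r" using insert by (metis insertI1 insertI2 primes_coprime)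
  qed
  then show ?case using insert by (simp add: divides_mult)
qed auto

text \<open>Row 2m+1 of Pascal's triangle contains this entry twice, at \<open>m\<close> and
  \<open>m + 1\<close>, so it is at most half of the row sum 2^(2m+1).\<close>

lemma binomial_odd_le_4_pow: "(2 * m + 1) choose m \<le> (4::nat) ^ m"
proof -
  have "2 * ((2*m+1) choose m) = ((2*m+1) choose m) + ((2*m+1) choose (m+1))"
    using binomial_symmetric[of m "2*m+1"] by simp
  also have "\<dots> = (\<Sum>k\<in>{m, m+1}. (2*m+1) choose k)" by simp
  also have "\<dots> \<le> (\<Sum>k\<le>2*m+1. (2*m+1) choose k)"
    by (rule sum_mono2) auto
  also have "\<dots> = 2 ^ (2*m+1)" by (rule choose_row_sum)
  also have "\<dots> = 2 * 4 ^ m" by (simp add: power_mult)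
  finally show ?thesis by simp
qed

text \<open>Erdos's induction: an even n > 2 adds no prime, and for n = 2m+1 the primes in (m+1, n]
  all divide \<open>n choose m\<close>, which is at most 4^m, while the remaining primes are covered
  by the induction hypothesis at m+1.\<close>

lemma primorial_le: "\<Prod>{p. prime p \<and> p \<le> n} \<le> (4::nat) ^ n"
proof (induction n rule: less_induct)
  case (less n)
  have fin: "finite {p::nat. prime p \<and> p \<le> n}" for n by simp
  consider "n = 0" | "n = 1" | "n = 2" | m where "n = 2 * m" "m > 1" | m where "n = 2 * m + 1" "m \<ge> 1"
    by (metis One_nat_def Suc_eq_plus1 Suc_leI evenE gr0I mult.right_neutral mult_0_right nat_neq_iff numeral_2_eq_2 oddE less_Suc0)
  then show ?case
  proof cases
    case 1
    then have "{p::nat. prime p \<and> p \<le> n} = {}" by (auto dest: prime_ge_2_nat)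
    then show ?thesis by (simp only: prod.empty) simp
  next
    case 2
    then have "{p::nat. prime p \<and> p \<le> n} = {}" by (auto dest: prime_ge_2_nat)
    then show ?thesis by (simp only: prod.empty) simp
  next
    case 3
    then have "{p::nat. prime p \<and> p \<le> n} = {2}" by (auto dest: prime_ge_2_nat)
    then show ?thesis using 3 by simp
  next
    case (4 m)
    have "\<not> prime n" using 4 prime_odd_nat[of n] by auto
    then have "p \<le> n - 1" if "prime p" "p \<le> n" for p using that by (cases "p = n") auto
    then have "{p::nat. prime p \<and> p \<le> n} = {p. prime p \<and> p \<le> n - 1}"
      by fastforce
    then have "\<Prod>{p. prime p \<and> p \<le> n} \<le> (4::nat) ^ (n - 1)" using less.IH[of "n-1"] 4 by simp
    also have "\<dots> \<le> 4 ^ n" by (rule power_increasing) auto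
    finally show ?thesis .
  next
    case (5 m)
    let ?A = "{p::nat. prime p \<and> p \<le> m+1}" and ?B = "{p::nat. prime p \<and> m + 1 < p \<and> p \<le> n}"
    have eq: "{p::nat. prime p \<and> p \<le> n} = ?A \<union> ?B" using 5 by auto
    have "\<Prod>?B dvd (n choose m)"
    proof (rule prod_primes_dvd)
      fix p assume p: "p \<in> ?B"
      have "fact m * fact (n - m) * (n choose m) = (fact n :: nat)"
        by (rule binomial_fact_lemma) (use 5 in simp)
      moreover have "p dvd fact n" using p prime_dvd_fact_iff by auto
      moreover have "\<not> p dvd fact m" "\<not> p dvd fact (n - m)" using p 5 by (auto simp only: prime_dvd_fact_iff)
      ultimately show "p dvd (n choose m)" using p by (metis (no_types, lifting) mem_Collect_eq prime_dvd_mult_iff)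
    qed auto
    then have B: "\<Prod>?B \<le> 4 ^ m"
      using binomial_odd_le_4_pow[of m] 5 by (metis dvd_imp_le le_trans zero_less_binomial_iff le_add1 mult_2 trans_le_add1)
    have A: "\<Prod>?A \<le> 4 ^ (m+1)" using less.IH[of "m+1"] 5 by simp
    have "\<Prod>{p::nat. prime p \<and> p \<le> n} = \<Prod>?A * \<Prod>?B" unfolding eq
      by (rule prod.union_disjoint) auto
    also have "\<dots> \<le> 4 ^ (m+1) * 4 ^ m" by (rule mult_mono[OF A B]) auto
    also have "\<dots> = 4 ^ n" using 5 by (simp add: power_add[symmetric])
    finally show ?thesis .
  qed
qed

lemma sum_ln_primes_le: "(\<Sum>p | prime p \<and> p \<le> n. ln (real p)) \<le> real n * ln 4"
proof -
  have pos: "0 < \<Prod>{p::nat. prime p \<and> p \<le> n}" by (rule prod_pos) (auto dest: prime_gt_0_nat)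
  have "(\<Sum>p | prime p \<and> p \<le> n. ln (real p)) = ln (\<Prod>p | prime p \<and> p \<le> n. real p)"
    by (rule ln_prod[symmetric]) (auto dest: prime_gt_0_nat)
  also have "\<dots> = ln (real (\<Prod>{p. prime p \<and> p \<le> n}))" by simp
  also have "\<dots> \<le> ln (real (4 ^ n))"
    using primorial_le[of n] pos by (subst ln_le_cancel_iff) (auto simp: of_nat_le_iff simp del: of_nat_prod of_nat_power)
  also have "\<dots> = real n * ln 4" by (simp add: ln_realpow)
  finally show ?thesis .
qed

section \<open>Legendre's formula and Mertens' first and second theorems\<close>

lemma card_multiples: 
  assumes "d > 0" shows "card {m \<in> {1..n}. d dvd m} = n div (d::nat)"
proof -
  have "{m \<in> {1..n}. d dvd m} = (\<lambda>k. d * k) ` {1..n div d}"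
  proof safe
    fix m assume "m \<in> {1..n}" "d dvd m"
    then obtain k where k: "m = d * k" by auto
    with \<open>m \<in> {1..n}\<close> have "k \<ge> 1" "k \<le> n div d" using assms
      by (auto simp: less_eq_div_iff_mult_less_eq mult.commute Suc_le_eq)
    with k show "m \<in> (\<lambda>k. d * k) ` {1..n div d}" by auto
  next
    fix k assume "k \<in> {1..n div d}"
    then show "d * k \<in> {1..n}" using assms
      by (auto simp: less_eq_div_iff_mult_less_eq mult.commute Suc_le_eq)
  qed auto
  then show ?thesis using assms by (simp add: card_image inj_on_def)
qed

text \<open>The ranges of p and k depend on n only, so that the order of summation can be exchanged
  when m runs up to n. The inner sum counts the k up to the multiplicity of p in m, which stays
  below n.\<close>

lemma ln_eq_sum_prime_powers:
  assumes "0 < m" "m \<le> n"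
  shows "ln (real m) = (\<Sum>p | prime p \<and> p \<le> n. \<Sum>k=1..n. if p ^ k dvd m then ln (real p) else 0)"
proof -
  have sub: "prime_factors m \<subseteq> {p. prime p \<and> p \<le> n}"
    using assms by (auto dest: prime_factors_dvd intro: order_trans[OF dvd_imp_le])
  have "real m = (\<Prod>p\<in>prime_factors m. real p ^ multiplicity p m)"
    using assms prime_factorization_nat[of m] by (metis (mono_tags, lifting) of_nat_power of_nat_prod prod.cong)
  then have "ln (real m) = (\<Sum>p\<in>prime_factors m. ln (real p ^ multiplicity p m))"
    by (simp add: ln_prod prime_factors_gt_0_nat)
  also have "\<dots> = (\<Sum>p\<in>prime_factors m. real (multiplicity p m) * ln (real p))"
    by (intro sum.cong refl) (simp add: ln_realpow prime_factors_gt_0_nat)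
  also have "\<dots> = (\<Sum>p | prime p \<and> p \<le> n. real (multiplicity p m) * ln (real p))"
    by (rule sum.mono_neutral_left[OF _ sub]) (use assms in \<open>auto simp: prime_factors_multiplicity\<close>)
  also have "\<dots> = (\<Sum>p | prime p \<and> p \<le> n. \<Sum>k=1..n. if p ^ k dvd m then ln (real p) else 0)"
  proof (rule sum.cong[OF refl])
    fix p assume "p \<in> {p. prime p \<and> p \<le> n}"
    then have p: "prime p" by simp
    have iff: "p ^ k dvd m \<longleftrightarrow> k \<le> multiplicity p m" for k
      using assms p by (intro power_dvd_iff_le_multiplicity) (auto dest: prime_gt_1_nat)
    have "multiplicity p m \<le> n"
    proof -
      have "p ^ multiplicity p m \<le> m" by (rule dvd_imp_le[OF multiplicity_dvd]) (use assms in auto)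
      moreover have "multiplicity p m < p ^ multiplicity p m"
        using p by (intro power_gt_expt) (auto dest: prime_gt_1_nat)
      ultimately show ?thesis using assms by linarith
    qed
    then have "{k \<in> {1..n}. p ^ k dvd m} = {1..multiplicity p m}" unfolding iff by auto
    then have "card {k \<in> {1..n}. p ^ k dvd m} = multiplicity p m" by simp
    moreover have "(\<Sum>k=1..n. if p ^ k dvd m then ln (real p) else 0) = (\<Sum>k\<in>{k \<in> {1..n}. p ^ k dvd m}. ln (real p))"
      by (rule sum.inter_filter[symmetric]) simp
    ultimately show "real (multiplicity p m) * ln (real p) = (\<Sum>k=1..n. if p ^ k dvd m then ln (real p) else 0)"
      by simp
  qed
  finally show ?thesis .
qed

text \<open>Legendre's formula for the exponent of p in n!, in logarithmic form: after exchanging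
  sums, the inner one counts the multiples of p^k up to n.\<close>

lemma ln_fact_eq:
  "ln (fact n :: real) = (\<Sum>p | prime p \<and> p \<le> n. ln (real p) * (\<Sum>k=1..n. real (n div p ^ k)))"
proof -
  have "ln (fact n :: real) = (\<Sum>m=1..n. ln (real m))"
    by (subst ln_prod[symmetric]) (auto simp: fact_prod)
  also have "\<dots> = (\<Sum>m=1..n. \<Sum>p | prime p \<and> p \<le> n. \<Sum>k=1..n. if p ^ k dvd m then ln (real p) else 0)"
    by (intro sum.cong refl ln_eq_sum_prime_powers) auto
  also have "\<dots> = (\<Sum>p | prime p \<and> p \<le> n. \<Sum>m=1..n. \<Sum>k=1..n. if p ^ k dvd m then ln (real p) else 0)"
    by (rule sum.swap)
  also have "\<dots> = (\<Sum>p | prime p \<and> p \<le> n. \<Sum>k=1..n. \<Sum>m=1..n. if p ^ k dvd m then ln (real p) else 0)"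
    by (intro sum.cong refl sum.swap)
  also have "\<dots> = (\<Sum>p | prime p \<and> p \<le> n. ln (real p) * (\<Sum>k=1..n. real (n div p ^ k)))"
    unfolding sum_distrib_left
  proof (intro sum.cong refl, goal_cases)
    case (1 p k)
    have "(\<Sum>m=1..n. if p ^ k dvd m then ln (real p) else 0) = (\<Sum>m\<in>{m \<in> {1..n}. p ^ k dvd m}. ln (real p))"
      by (rule sum.inter_filter[symmetric]) simp
    then show ?case using 1 card_multiples[of "p ^ k" n] by (simp add: prime_gt_0_nat)
  qed
  finally show ?thesis .
qed

lemma ln_fact_lower: "n > 0 \<Longrightarrow> real n * ln (real n) - real n \<le> ln (fact n)"
proof -
  assume n: "n > 0"
  \<comment> \<open>The left side is a single term of the exponential series at n.\<close>
  have "real n ^ n / fact n \<le> exp (real n)"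
  proof -
    have "inverse (fact n) * real n ^ n \<le> (\<Sum>k. inverse (fact k) * real n ^ k)"
      using sum_le_suminf[OF summable_exp[of "real n"], of "{n}"] by simp
    then show ?thesis by (simp add: exp_def field_simps)
  qed
  then have "ln (real n ^ n / fact n) \<le> real n"
    using n by (metis ln_exp ln_mono divide_pos_pos fact_gt_zero of_nat_0_less_iff zero_less_power)
  then show ?thesis using n by (simp add: ln_div ln_realpow)
qed

lemma ln_fact_upper: "ln (fact n :: real) \<le> real n * ln (real n)"
proof -
  have "(fact n :: real) \<le> real (n ^ n)" by (metis fact_le_power of_nat_fact of_nat_le_iff order_refl of_nat_id)
  then have "ln (fact n :: real) \<le> ln (real (n ^ n))" by (cases "n = 0") (auto simp: ln_mono)
  then show ?thesis by (cases "n = 0") (auto simp: ln_realpow)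
qed


text \<open>This controls the powers p^k with k >= 2 in Legendre's formula, because 1/(p-1) - 1/p =
  1/(p(p-1)). The bound ln n <= 2 sqrt n leaves the exponent 3/2.\<close>

lemma summable_ln_over_square: "summable (\<lambda>n. ln (real n) / (real n * (real n - 1)))"
proof (rule summable_comparison_test')
  show "summable (\<lambda>n. 4 * real n powr (-3/2))"
    by (intro summable_mult) (simp add: summable_real_powr_iff)
  fix n :: nat assume n: "n \<ge> 2"
  have "ln (real n) = 2 * ln (sqrt (real n))" using n by (simp add: ln_sqrt)
  also have "\<dots> \<le> 2 * sqrt (real n)" using n ln_le_minus_one[of "sqrt (real n)"] by simp
  finally have l: "ln (real n) \<le> 2 * real n powr (1/2)" using n by (simp add: powr_half_sqrt)
  have "real n ^ 2 / 2 \<le> real n * (real n - 1)"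
    using n by (simp add: power2_eq_square field_simps)
  then have "ln (real n) / (real n * (real n - 1)) \<le> (2 * real n powr (1/2)) / (real n ^ 2 / 2)"
    using l n by (intro frac_le) auto
  also have "\<dots> = 4 * (real n powr (1/2) / real n powr 2)"
    using n by simp
  also have "real n powr (1/2) / real n powr 2 = real n powr (-3/2)"
    using powr_diff[of "real n" "1/2" 2] by simp
  finally show "norm (ln (real n) / (real n * (real n - 1))) \<le> 4 * real n powr (-3/2)" using n by simp
qed

text \<open>Both directions compare ln(n!) with n ln n through Legendre's formula. Keeping only k =
  1 bounds the sum from above, rounding costing at most Chebyshev's n ln 4; replacing the floors by
  a full geometric series bounds it from below, up to a convergent sum over 1/(p(p-1)).\<close>

lemma mertens_first:
  obtains K where "\<And>n. n > 0 \<Longrightarrow> \<bar>(\<Sum>p | prime p \<and> p \<le> n. ln (real p) / real p) - ln (real n)\<bar> \<le> K"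
proof -
  define B where "B = (\<Sum>n. ln (real n) / (real n * (real n - 1)))"
  have nn: "0 \<le> ln (real m) / (real m * (real m - 1))" for m
    by (cases "m = 0") auto
  have B: "(\<Sum>p | prime p \<and> p \<le> n. ln (real p) / (real p * (real p - 1))) \<le> B" for n
    unfolding B_def by (rule sum_le_suminf[OF summable_ln_over_square]) (use nn in auto)
  show ?thesis
  proof (rule that[of "1 + ln 4 + B"])
    fix n :: nat assume n: "n > 0"
    let ?T = "\<Sum>p | prime p \<and> p \<le> n. ln (real p) * (\<Sum>k=1..n. real (n div p ^ k))"
    let ?S = "\<Sum>p | prime p \<and> p \<le> n. ln (real p) / real p"
    have "real n * ?S - real n * ln 4 \<le> real n * ?S - (\<Sum>p | prime p \<and> p \<le> n. ln (real p))"
      using sum_ln_primes_le[of n] by simp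
    also have "\<dots> = (\<Sum>p | prime p \<and> p \<le> n. ln (real p) * (real n / real p - 1))"
      by (simp add: sum_distrib_left sum_subtractf[symmetric] algebra_simps)
    also have "\<dots> \<le> ?T"
    proof (intro sum_mono mult_left_mono)
      fix p assume p: "p \<in> {p. prime p \<and> p \<le> n}"
      have "real n / real p - 1 \<le> real (n div p ^ 1)"
      proof -
        have "real (n mod p) \<le> real p" using p by (intro of_nat_mono less_imp_le mod_less_divisor) (auto dest: prime_gt_0_nat)
        moreover have "real n = real p * real (n div p) + real (n mod p)"
          by (metis mult_div_mod_eq of_nat_add of_nat_mult)
        ultimately show ?thesis using p by (auto simp: field_simps dest: prime_gt_0_nat)
      qed
      also have "\<dots> \<le> (\<Sum>k=1..n. real (n div p ^ k))"
        by (rule member_le_sum) (use n in auto)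
      finally show "real n / real p - 1 \<le> (\<Sum>k=1..n. real (n div p ^ k))" .
    qed (auto dest: prime_gt_0_nat)
    also have "\<dots> \<le> real n * ln (real n)"
      using ln_fact_upper[of n] unfolding ln_fact_eq .
    finally have "real n * ?S \<le> real n * (ln (real n) + ln 4)" by (simp add: algebra_simps)
    then have up: "?S \<le> ln (real n) + ln 4" using n by simp
    have "real n * ln (real n) - real n \<le> ?T"
      using ln_fact_lower[OF n] unfolding ln_fact_eq .
    also have "\<dots> \<le> (\<Sum>p | prime p \<and> p \<le> n. ln (real p) * (real n / (real p - 1)))"
    proof (intro sum_mono mult_left_mono)
      fix p assume "p \<in> {p. prime p \<and> p \<le> n}"
      then have p: "p \<ge> 2" by (auto dest: prime_ge_2_nat)
      have "(\<Sum>k=1..n. real (n div p ^ k)) \<le> (\<Sum>k=1..n. real n * (1 / real p) ^ k)"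
        by (intro sum_mono order_trans[OF of_nat_div_le_of_nat]) (simp add: power_divide)
      also have "\<dots> = real n * (\<Sum>k=1..n. (1 / real p) ^ k)" by (simp add: sum_distrib_left)
      also have "(\<Sum>k=1..n. (1 / real p) ^ k) = (1 - (1 / real p) ^ n) / (real p - 1)"
      proof -
        define r where "r = 1 / real p"
        have rp: "r * real p = 1" using p by (simp add: r_def)
        have "(\<Sum>k=1..n. r ^ k) * (real p - 1) = 1 - r ^ n"
        proof (induction n)
          case (Suc n)
          have "(\<Sum>k=1..Suc n. r ^ k) * (real p - 1)
              = (\<Sum>k=1..n. r ^ k) * (real p - 1) + r ^ n * (r * real p) - r ^ Suc n"
            by (simp add: algebra_simps)
          then show ?case unfolding Suc rp by simp
        qed auto
        then have "(\<Sum>k=1..n. r ^ k) = (1 - r ^ n) / (real p - 1)" using p by (simp add: field_simps)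
        then show ?thesis unfolding r_def .
      qed
      also have "real n * \<dots> \<le> real n * (1 / (real p - 1))"
        using p by (intro mult_left_mono divide_right_mono) auto
      finally show "(\<Sum>k=1..n. real (n div p ^ k)) \<le> real n / (real p - 1)" by simp
    qed (auto dest: prime_gt_0_nat)
    also have "\<dots> = real n * ?S + real n * (\<Sum>p | prime p \<and> p \<le> n. ln (real p) / (real p * (real p - 1)))"
      unfolding sum_distrib_left sum.distrib[symmetric]
    proof (intro sum.cong refl)
      fix p assume "p \<in> {p. prime p \<and> p \<le> n}"
      then have p: "real p \<ge> 2" by (auto dest: prime_ge_2_nat)
      then have "1 / (real p - 1) = 1 / real p + 1 / (real p * (real p - 1))" by (simp add: field_simps)
      then show "ln (real p) * (real n / (real p - 1)) =
         real n * (ln (real p) / real p) + real n * (ln (real p) / (real p * (real p - 1)))"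
        by (simp add: divide_inverse algebra_simps)
    qed
    also have "\<dots> \<le> real n * ?S + real n * B"
      using B[of n] by (simp add: mult_left_mono)
    finally have "real n * ln (real n) \<le> real n * (?S + 1 + B)" by (simp add: algebra_simps)
    then have "ln (real n) \<le> ?S + 1 + B" using n by simp
    moreover have "B \<ge> 0" using B[of 0] by (simp add: suminf_nonneg[OF summable_ln_over_square nn] B_def)
    ultimately show "\<bar>?S - ln (real n)\<bar> \<le> 1 + ln 4 + B" using up ln_ge_zero[of 4] by linarith
  qed
qed

text \<open>Partial summation, written with increments: subtracting the boundary term
  \<open>r n / ln n\<close> from \<open>D\<close> gives \<open>E\<close>, whose increments involve
  only the bounded \<open>r\<close> and are dominated by differences of 1/ln n, which
  telescope.\<close>

lemma mertens_second: "convergent (\<lambda>n. (\<Sum>p | prime p \<and> p \<le> n. 1 / real p) - ln (ln (real n)))"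
proof -
  obtain K where K: "\<And>n. n > 0 \<Longrightarrow> \<bar>(\<Sum>p | prime p \<and> p \<le> n. ln (real p) / real p) - ln (real n)\<bar> \<le> K"
    using mertens_first by blast
  define r where "r = (\<lambda>n. (\<Sum>p | prime p \<and> p \<le> n. ln (real p) / real p) - ln (real n))"
  define D where "D = (\<lambda>n. (\<Sum>p | prime p \<and> p \<le> n. 1 / real p) - ln (ln (real n)))"
  define E where "E = (\<lambda>n. D n - r n / ln (real n))"
  define d where "d = (\<lambda>n. 1 / ln (real n))"
  have dlim: "d \<longlonglongrightarrow> 0" unfolding d_def by real_asymp
  have dec: "d (Suc n) \<le> d n" if "n \<ge> 2" for n
    unfolding d_def using that by (intro divide_left_mono) auto
  have step: "\<bar>E (Suc n) - E n\<bar> \<le> (K + 1) * (d n - d (Suc n))" if n: "n \<ge> 2" for n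
  proof -
    have ins: "(\<Sum>p | prime p \<and> p \<le> Suc n. f p) =
        (\<Sum>p | prime p \<and> p \<le> n. f p) + (if prime (Suc n) then f (Suc n) else 0)" for f :: "nat \<Rightarrow> real"
    proof -
      have "{p. prime p \<and> p \<le> Suc n} = (if prime (Suc n) then insert (Suc n) {p. prime p \<and> p \<le> n} else {p. prime p \<and> p \<le> n})"
        by (auto simp: le_Suc_eq)
      then show ?thesis by simp
    qed
    define a b where "a = ln (real n)" and "b = ln (real (Suc n))"
    have ab: "0 < a" "a \<le> b" using n by (auto simp: a_def b_def)
    have u: "b - a \<le> 1"
    proof -
      have "b - a = ln (real (Suc n) / real n)" using n by (simp add: a_def b_def ln_div)
      also have "\<dots> \<le> real (Suc n) / real n - 1" using n by (intro ln_le_minus_one) auto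
      also have "\<dots> \<le> 1" using n by (simp add: field_simps)
      finally show ?thesis .
    qed
    have l1: "ln b - ln a \<le> (b - a) / a"
      using ln_le_minus_one[of "b / a"] ab by (simp add: ln_div field_simps)
    have l2: "(b - a) / b \<le> ln b - ln a"
      using ln_le_minus_one[of "a / b"] ab by (simp add: ln_div field_simps)
    have "D (Suc n) - D n = (if prime (Suc n) then 1 / real (Suc n) else 0) - (ln b - ln a)"
      unfolding D_def ins a_def b_def by simp
    \<comment> \<open>The numerator on the right is the jump ln(n+1)/(n+1) of the weighted sum at a
      prime n+1, and \<open>b\<close> = ln(n+1) cancels the weight.\<close>
    also have "(if prime (Suc n) then 1 / real (Suc n) else 0) = (r (Suc n) - r n + b - a) / b"
      unfolding r_def ins using ab n by (simp add: a_def b_def)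
    finally have "E (Suc n) - E n = r n * (1/a - 1/b) + ((b - a) / b - (ln b - ln a))"
      using ab unfolding E_def a_def[symmetric] b_def[symmetric]
      by (simp add: add_divide_distrib diff_divide_distrib right_diff_distrib)
    also have "\<bar>\<dots>\<bar> \<le> \<bar>r n * (1/a - 1/b)\<bar> + \<bar>(b - a) / b - (ln b - ln a)\<bar>" by (rule abs_triangle_ineq)
    also have "\<bar>r n * (1/a - 1/b)\<bar> \<le> K * (1/a - 1/b)"
      using K[of n] n ab by (simp add: abs_mult r_def mult_right_mono frac_le)
    also have "\<bar>(b - a) / b - (ln b - ln a)\<bar> \<le> (b - a) / a - (b - a) / b"
      using l1 l2 by linarith
    also have "(b - a) / a - (b - a) / b = (b - a) * (1/a - 1/b)" by (simp add: algebra_simps)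
    also have "\<dots> \<le> 1 * (1/a - 1/b)"
      using u ab by (intro mult_right_mono) (auto simp: frac_le)
    finally show ?thesis by (simp add: d_def a_def b_def algebra_simps add_divide_distrib)
  qed
  have "summable (\<lambda>n. E (Suc n) - E n)"
  proof (rule summable_comparison_test')
    show "summable (\<lambda>n. (K + 1) * (d n - d (Suc n)))"
      by (intro summable_mult telescope_summable'[OF dlim])
    show "norm (E (Suc n) - E n) \<le> (K + 1) * (d n - d (Suc n))" if "n \<ge> 2" for n
      using step[OF that] by simp
  qed
  then have "convergent (\<lambda>n. \<Sum>i<n. E (Suc i) - E i)" by (simp add: summable_iff_convergent)
  then have "convergent (\<lambda>n. E n - E 0)" by (simp add: sum_lessThan_telescope)
  then have "convergent E" using convergent_diff_const_right_iff by blast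
  moreover have "(\<lambda>n. r n / ln (real n)) \<longlonglongrightarrow> 0"
  proof (rule Lim_null_comparison)
    show "eventually (\<lambda>n. norm (r n / ln (real n)) \<le> K * d n) sequentially"
      using eventually_gt_at_top[of 1]
    proof eventually_elim
      case (elim n)
      then show ?case using K[of n] by (simp add: r_def d_def divide_right_mono)
    qed
    show "(\<lambda>n. K * d n) \<longlonglongrightarrow> 0" using tendsto_mult_right_zero[OF dlim] by simp
  qed
  ultimately have "convergent (\<lambda>n. E n + r n / ln (real n))"
    by (intro convergent_add) (auto simp: convergent_def)
  then show ?thesis by (simp add: E_def D_def)
qed

text \<open>The arctangent equals arcsin(1/x), so sin y <= y gives the lower bound. The upper bound
  is not sharp, but it exceeds 1/x by a summable amount, which is enough to transfer Mertens'
  theorem.\<close>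

lemma arctan_prime_bounds:
  fixes x :: real
  assumes "x \<ge> 2"
  shows "1 / x \<le> arctan (1 / sqrt (x ^ 2 - 1))" "arctan (1 / sqrt (x ^ 2 - 1)) \<le> 1 / x + 1 / x ^ 2"
proof -
  define t where "t = 1 / sqrt (x ^ 2 - 1)"
  have x2: "x ^ 2 \<ge> 2 ^ 2" using assms by (intro power_mono) auto
  then have t: "t > 0" "t ^ 2 = 1 / (x ^ 2 - 1)" by (auto simp: t_def power_divide)
  have "1 + t ^ 2 = (x / sqrt (x ^ 2 - 1)) ^ 2" using x2 unfolding t(2) by (simp add: power_divide field_simps)
  then have "sqrt (1 + t ^ 2) = x / sqrt (x ^ 2 - 1)" using assms x2 by (simp add: real_sqrt_unique)
  then have "sin (arctan t) = 1 / x" using x2 assms by (simp add: sin_arctan t_def)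
  moreover have "sin (arctan t) \<le> arctan t" using t by (intro sin_x_le_x) auto
  ultimately show "1 / x \<le> arctan (1 / sqrt (x ^ 2 - 1))" by (simp add: t_def)
  have "arctan t \<le> t" using t by (intro arctan_le_self) auto
  also have "t \<le> 1 / x + 1 / x ^ 2"
  proof (rule power2_le_imp_le)
    have "(x ^ 2 - 1) * (x + 1) ^ 2 - x ^ 4 = 2 * x * (x ^ 2 - 1) - 1"
      by (simp add: power2_eq_square power4_eq_xxxx algebra_simps)
    moreover have "2 * x * (x ^ 2 - 1) \<ge> 1 * 1"
      using assms x2 by (intro mult_mono) auto
    ultimately have "x ^ 4 \<le> (x ^ 2 - 1) * (x + 1) ^ 2" by linarith
    then have "1 / (x ^ 2 - 1) \<le> (x + 1) ^ 2 / x ^ 4"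
      using x2 assms by (simp add: field_simps)
    also have "\<dots> = (1 / x + 1 / x ^ 2) ^ 2"
      using assms by (simp add: field_simps power2_eq_square power4_eq_xxxx)
    finally show "t ^ 2 \<le> (1 / x + 1 / x ^ 2) ^ 2" unfolding t(2) .
    show "0 \<le> 1 / x + 1 / x ^ 2" using assms by simp
  qed
  finally show "arctan (1 / sqrt (x ^ 2 - 1)) \<le> 1 / x + 1 / x ^ 2" by (simp add: t_def)
qed

text \<open>\<open>C2\<close> is a \<open>Lim\<close>, hence informative only once convergence is
  known. Along the integers it follows from Mertens' theorem and the summable difference to 1/p; for
  real x the sum is constant between integers, and only the drift of ln(ln x) has to be
  estimated.\<close>

lemma C2_tendsto: 
  "(\<lambda>n. (\<Sum>p | prime p \<and> p \<le> n. arctan (1 / sqrt (real p ^ 2 - 1))) - ln (ln (real n))) \<longlonglongrightarrow> C2"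
proof -
  define h where "h = (\<lambda>p. if prime p then arctan (1 / sqrt (real p ^ 2 - 1)) - 1 / real p else 0)"
  define G where "G = (\<lambda>n. (\<Sum>p | prime p \<and> p \<le> n. arctan (1 / sqrt (real p ^ 2 - 1))) - ln (ln (real n)))"
  have "summable h"
  proof (rule summable_comparison_test')
    show "summable (\<lambda>p. 1 / real p ^ 2)" using inverse_power_summable[of 2, where ?'a=real] by (simp add: field_simps)
    show "norm (h p) \<le> 1 / real p ^ 2" for p
      using arctan_prime_bounds[of "real p"] by (auto simp: h_def dest: prime_ge_2_nat)
  qed
  then have "convergent (\<lambda>n. \<Sum>p\<le>n. h p)"
    using summable_LIMSEQ' convergent_def by blast
  then have "convergent (\<lambda>n. (\<Sum>p\<le>n. h p) + ((\<Sum>p | prime p \<and> p \<le> n. 1 / real p) - ln (ln (real n))))"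
    using mertens_second by (rule convergent_add)
  moreover have "(\<Sum>p\<le>n. h p) + ((\<Sum>p | prime p \<and> p \<le> n. 1 / real p) - ln (ln (real n))) = G n" for n
  proof -
    have "(\<Sum>p\<le>n. h p) = (\<Sum>p | prime p \<and> p \<le> n. arctan (1 / sqrt (real p ^ 2 - 1)) - 1 / real p)"
      unfolding h_def by (subst sum.inter_filter[symmetric]) (auto intro: sum.cong)
    then show ?thesis by (simp add: G_def sum_subtractf)
  qed
  ultimately obtain L where L: "G \<longlonglongrightarrow> L" by (auto simp: convergent_def)
  define F where "F = (\<lambda>x::real. (\<Sum>p | prime (p::nat) \<and> real p \<le> x. arctan (1 / sqrt (real p ^ 2 - 1))) - ln (ln x))"
  have "(F \<longlongrightarrow> L) at_top"
  proof -
    have fl: "filterlim (\<lambda>x::real. nat \<lfloor>x\<rfloor>) sequentially at_top"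
      using filterlim_compose[OF filterlim_nat_sequentially filterlim_floor_sequentially] .
    have "((\<lambda>x::real. G (nat \<lfloor>x\<rfloor>)) \<longlongrightarrow> L) at_top" by (rule filterlim_compose[OF L fl])
    moreover have "((\<lambda>x::real. ln (ln (real (nat \<lfloor>x\<rfloor>))) - ln (ln x)) \<longlongrightarrow> 0) at_top"
    proof (rule Lim_null_comparison)
      show "((\<lambda>x::real. ln (ln x) - ln (ln (x - 1))) \<longlongrightarrow> 0) at_top" by real_asymp
      show "eventually (\<lambda>x::real. norm (ln (ln (real (nat \<lfloor>x\<rfloor>))) - ln (ln x)) \<le> ln (ln x) - ln (ln (x - 1))) at_top"
        using eventually_gt_at_top[of 3]
      proof eventually_elim
        case (elim x)
        have "x - 1 \<le> real (nat \<lfloor>x\<rfloor>)" "real (nat \<lfloor>x\<rfloor>) \<le> x" using elim by linarith+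
        moreover from this have "ln (x - 1) \<le> ln (real (nat \<lfloor>x\<rfloor>))" "ln (real (nat \<lfloor>x\<rfloor>)) \<le> ln x"
          using elim by auto
        moreover have "0 < ln (x - 1)" using elim by simp
        ultimately show ?case by auto
      qed
    qed
    ultimately have "((\<lambda>x. G (nat \<lfloor>x\<rfloor>) + (ln (ln (real (nat \<lfloor>x\<rfloor>))) - ln (ln x))) \<longlongrightarrow> L + 0) at_top"
      by (rule tendsto_add)
    moreover have "eventually (\<lambda>x. G (nat \<lfloor>x\<rfloor>) + (ln (ln (real (nat \<lfloor>x\<rfloor>))) - ln (ln x)) = F x) at_top"
      using eventually_gt_at_top[of 0]
    proof eventually_elim
      case (elim x)
      have "{p. prime p \<and> p \<le> nat \<lfloor>x\<rfloor>} = {p. prime p \<and> real p \<le> x}"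
        using elim by (auto simp: le_nat_floor) linarith
      then show ?case by (simp add: F_def G_def)
    qed
    ultimately show ?thesis by (simp add: tendsto_cong)
  qed
  then have "C2 = L" unfolding C2_def F_def[symmetric] by (intro tendsto_Lim) auto
  then show ?thesis using L by (simp add: G_def)
qed

subsection \<open>Dirichlet characters\<close>

lemma dirichlet_character_mult: "dirichlet_character q chi \<Longrightarrow> chi (m * n) = chi m * chi n"
  by (simp add: dirichlet_character_def)

lemma dirichlet_character_periodic: "dirichlet_character q chi \<Longrightarrow> chi (n + q) = chi n"
  by (simp add: dirichlet_character_def)

lemma dirichlet_character_eq_0_iff: "dirichlet_character q chi \<Longrightarrow> chi n = 0 \<longleftrightarrow> \<not> coprime n q"
  by (simp add: dirichlet_character_def)

lemma dirichlet_character_pos: "dirichlet_character q chi \<Longrightarrow> q > 0"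
  by (simp add: dirichlet_character_def)

lemma dirichlet_character_1:
  assumes "dirichlet_character q chi"
  shows "chi (Suc 0) = 1"
proof -
  have "chi (Suc 0) \<noteq> 0" using dirichlet_character_eq_0_iff[OF assms, of "Suc 0"] by simp
  moreover have "chi (Suc 0) * chi (Suc 0) = chi (Suc 0) * 1"
    using dirichlet_character_mult[OF assms, of "Suc 0" "Suc 0"] by (metis mult.right_neutral One_nat_def)
  ultimately show ?thesis by (metis mult_left_cancel)
qed

lemma dirichlet_character_power:
  assumes "dirichlet_character q chi"
  shows "chi (n ^ k) = chi n ^ k"
  by (induction k) (simp_all add: dirichlet_character_1[OF assms] dirichlet_character_mult[OF assms])

lemma periodic_add_mult:
  fixes f :: "nat \<Rightarrow> 'a"
  assumes "\<And>n. f (n + q) = f n"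
  shows "f (n + k * q) = f n"
proof (induction k)
  case (Suc k)
  then show ?case using assms[of "n + k * q"] by (simp add: algebra_simps)
qed simp

lemma periodic_mod:
  fixes f :: "nat \<Rightarrow> 'a"
  assumes "\<And>n. f (n + q) = f n"
  shows "f (n mod q) = f n"
  using periodic_add_mult[of f q "n mod q" "n div q", OF assms] by simp

lemma dirichlet_character_mod: "dirichlet_character q chi \<Longrightarrow> chi (n mod q) = chi n"
  by (intro periodic_mod dirichlet_character_periodic)

text \<open>Euler's theorem; it yields both the modulus 1 of the values and the finiteness of the
  set of characters.\<close>

lemma dirichlet_character_power_totient:
  assumes "dirichlet_character q chi" "coprime n q"
  shows "chi n ^ totient q = 1"
proof -
  have "chi n ^ totient q = chi (n ^ totient q mod q)"
    by (simp add: dirichlet_character_power[OF assms(1)] dirichlet_character_mod[OF assms(1)])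
  also have "n ^ totient q mod q = 1 mod q"
    using euler_theorem[OF assms(2)] by (simp add: cong_def)
  also have "chi (1 mod q) = 1"
    using dirichlet_character_1[OF assms(1)] by (simp only: dirichlet_character_mod[OF assms(1)] One_nat_def)
  finally show ?thesis .
qed

lemma norm_dirichlet_character:
  assumes "dirichlet_character q chi" "coprime n q"
  shows "norm (chi n) = 1"
proof -
  have "norm (chi n) ^ totient q = 1"
    using dirichlet_character_power_totient[OF assms] by (metis norm_one norm_power)
  moreover have "totient q > 0" using dirichlet_character_pos[OF assms(1)] by simp
  ultimately show ?thesis using power_eq_imp_eq_base[of "norm (chi n)" "totient q" 1] by simp
qed

lemma norm_dirichlet_character_le:
  assumes "dirichlet_character q chi"
  shows "norm (chi n) \<le> 1"
  using norm_dirichlet_character[OF assms, of n] dirichlet_character_eq_0_iff[OF assms, of n] by (cases "coprime n q") auto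

lemma dirichlet_character_principal: "q > 0 \<Longrightarrow> dirichlet_character q (principal_character q)"
proof -
  assume "q > 0"
  have "coprime (n + q) q \<longleftrightarrow> coprime n q" for n
    by (metis coprime_iff_gcd_eq_1 gcd_add1)
  then show ?thesis using \<open>q > 0\<close>
    by (auto simp: dirichlet_character_def principal_character_def)
qed

lemma dirichlet_character_square:
  assumes "dirichlet_character q chi"
  shows "dirichlet_character q (\<lambda>n. chi n ^ 2)"
  using assms by (auto simp: dirichlet_character_def power_mult_distrib)

text \<open>Multiplication by a unit \<open>a\<close> with chi(a) different from 1 permutes the
  residues, so the sum equals chi(a) times itself.\<close>

lemma sum_dirichlet_character_nonprincipal:
  assumes chi: "dirichlet_character q chi" and np: "chi \<noteq> principal_character q"
  shows "(\<Sum>r<q. chi r) = 0"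
proof -
  obtain a where a: "chi a \<noteq> principal_character q a" using np by blast
  then have cop: "coprime a q" using dirichlet_character_eq_0_iff[OF chi, of a] by (auto simp: principal_character_def)
  then have a1: "chi a \<noteq> 1" using a by (auto simp: principal_character_def)
  have q: "q > 0" by (rule dirichlet_character_pos[OF chi])
  have inj: "inj_on (\<lambda>r. a * r mod q) {..<q}"
  proof (rule inj_onI)
    fix x y assume xy: "x \<in> {..<q}" "y \<in> {..<q}" "a * x mod q = a * y mod q"
    then have "[a * x = a * y] (mod q)" by (simp add: cong_def)
    then have "[x = y] (mod q)" using cop by (simp add: cong_mult_lcancel_nat)
    then show "x = y" using xy by (simp add: cong_def)
  qed
  have bij: "bij_betw (\<lambda>r. a * r mod q) {..<q} {..<q}"
    unfolding bij_betw_def using inj q by (intro conjI endo_inj_surj) auto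
  have "(\<Sum>r<q. chi r) = (\<Sum>r<q. chi (a * r mod q))"
    by (rule sum.reindex_bij_betw[OF bij, symmetric])
  also have "\<dots> = chi a * (\<Sum>r<q. chi r)"
    by (simp add: dirichlet_character_mod[OF chi] dirichlet_character_mult[OF chi] sum_distrib_left)
  finally show ?thesis using a1 by simp
qed

lemma sum_lessThan_add:
  fixes f :: "nat \<Rightarrow> 'a :: comm_monoid_add"
  shows "(\<Sum>n<a + b. f n) = (\<Sum>n<a. f n) + (\<Sum>n<b. f (n + a))"
  by (induction b) (simp_all add: add_ac)

text \<open>Complete periods cancel and fewer than q terms remain. Arbitrary periodic
  \<open>f\<close> are allowed because the bound is also applied to a character minus its mean
  value.\<close>

lemma periodic_partial_sum_bound:
  fixes f :: "nat \<Rightarrow> complex"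
  assumes q: "q > 0" and per: "\<And>n. f (n + q) = f n" and zero: "(\<Sum>r<q. f r) = 0" and le: "\<And>n. norm (f n) \<le> M"
  shows "norm (\<Sum>n<N. f n) \<le> real q * M"
proof -
  have block: "(\<Sum>n<k * q. f n) = 0" for k
  proof (induction k)
    case (Suc k)
    have "(\<Sum>n<Suc k * q. f n) = (\<Sum>n<k * q. f n) + (\<Sum>n<q. f (n + k * q))"
      using sum_lessThan_add[of f "k * q" q] by (simp add: add.commute)
    then show ?case using Suc zero by (simp add: periodic_add_mult[of f, OF per])
  qed simp
  define k r where "k = N div q" and "r = N mod q"
  have N: "N = k * q + r" by (simp add: k_def r_def)
  have "(\<Sum>n<N. f n) = (\<Sum>n<k * q. f n) + (\<Sum>n<r. f (n + k * q))"
    unfolding N by (rule sum_lessThan_add)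
  then have "norm (\<Sum>n<N. f n) = norm (\<Sum>n<r. f n)"
    by (simp add: block periodic_add_mult[of f, OF per])
  also have "\<dots> \<le> real r * M"
    using sum_norm_bound[of "{..<r}" f M] le by simp
  also have "\<dots> \<le> real q * M"
    using q order_trans[OF norm_ge_zero le[of 0]] by (intro mult_right_mono) (simp_all add: r_def less_imp_le)
  finally show ?thesis .
qed

lemma sum_dirichlet_character_Suc:
  assumes "dirichlet_character q chi"
  shows "(\<Sum>r<q. chi (Suc r)) = (\<Sum>r<q. chi r)"
  using sum.lessThan_Suc_shift[of chi q] sum.lessThan_Suc[of chi q] dirichlet_character_periodic[OF assms, of 0]
  by (simp add: add.commute)

lemma dirichlet_character_partial_sum_bound:
  assumes chi: "dirichlet_character q chi" and np: "chi \<noteq> principal_character q"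
  shows "norm (\<Sum>n<N. chi (Suc n)) \<le> real q"
proof -
  have "(\<Sum>r<q. chi (Suc r)) = 0"
    using sum_dirichlet_character_nonprincipal[OF assms] by (simp add: sum_dirichlet_character_Suc[OF chi])
  then show ?thesis
    using periodic_partial_sum_bound[of q "\<lambda>n. chi (Suc n)" 1 N] dirichlet_character_pos[OF chi] norm_dirichlet_character_le[OF chi]
      dirichlet_character_periodic[OF chi] by (metis add_Suc mult.right_neutral)
qed

text \<open>A character is determined by its values on \<open>{..<q}\<close>, which are 0 or roots
  of unity of a fixed order. Finiteness later allows the error term to be a maximum over all
  characters modulo q.\<close>

lemma finite_dirichlet_characters: "finite {chi. dirichlet_character q chi}"
proof -
  define R where "R = insert 0 {z::complex. z ^ totient q = 1}"
  show ?thesis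
  proof (cases "q = 0")
    case False
    then have "finite {z::complex. z ^ totient q = 1}" by (intro finite_roots_unity) (simp add: Suc_le_eq)
    then have "finite ({..<q} \<rightarrow>\<^sub>E R)" by (intro finite_PiE) (auto simp: R_def)
    moreover have "inj_on (\<lambda>chi. restrict chi {..<q}) {chi. dirichlet_character q chi}"
    proof (rule inj_onI, rule ext)
      fix f g :: "nat \<Rightarrow> complex" and n
      assume fg: "f \<in> {chi. dirichlet_character q chi}" "g \<in> {chi. dirichlet_character q chi}"
        and eq: "restrict f {..<q} = restrict g {..<q}"
      have "f (n mod q) = g (n mod q)" using fun_cong[OF eq, of "n mod q"] False by simp
      then show "f n = g n" using fg by (simp add: dirichlet_character_mod)
    qed
    moreover have "(\<lambda>chi. restrict chi {..<q}) ` {chi. dirichlet_character q chi} \<subseteq> {..<q} \<rightarrow>\<^sub>E R"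
    proof -
      have "chi n \<in> R" if "dirichlet_character q chi" for chi n
        using dirichlet_character_power_totient[OF that, of n] dirichlet_character_eq_0_iff[OF that, of n]
        by (auto simp: R_def)
      then show ?thesis by (simp add: image_subset_iff restrict_PiE_iff)
    qed
    ultimately show ?thesis by (metis finite_imageD finite_subset)
  qed (simp add: dirichlet_character_def)
qed

subsection \<open>Dirichlet series with bounded partial sums\<close>

text \<open>Mean value inequality along the segment; \<open>Re s \<ge> -1\<close> makes the modulus
  of the derivative, |s| u^(-Re s - 1), largest at the left end \<open>a\<close>.\<close>

lemma powr_neg_diff_bound:
  fixes a b :: real and s :: complex
  assumes "0 < a" "a \<le> b" "Re s \<ge> -1"
  shows "norm (of_real a powr (-s) - of_real b powr (-s)) \<le> norm s * a powr (- Re s - 1) * (b - a)"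
proof -
  define S where "S = closed_segment (complex_of_real a) (complex_of_real b)"
  have S: "\<exists>t. z = of_real t \<and> a \<le> t" if "z \<in> S" for z
    using that assms unfolding S_def closed_segment_of_real by (auto simp: closed_segment_eq_real_ivl)
  have "norm (of_real b powr (-s) - of_real a powr (-s))
        \<le> norm s * a powr (- Re s - 1) * norm (complex_of_real b - of_real a)"
  proof (rule field_differentiable_bound[where S = S and f' = "\<lambda>z. - s * z powr (- s - 1)"])
    fix z assume "z \<in> S"
    then obtain t where t: "z = of_real t" "a \<le> t" using S by blast
    have "z \<notin> \<real>\<^sub>\<le>\<^sub>0" using t assms by auto
    then show "((\<lambda>z. z powr - s) has_field_derivative - s * z powr (- s - 1)) (at z within S)"
      by (auto intro!: derivative_eq_intros simp: has_field_derivative_at_within)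
    have "norm (z powr (- s - 1)) = t powr (- Re s - 1)"
      using t assms by (simp add: norm_powr_real_powr)
    also have "\<dots> \<le> a powr (- Re s - 1)"
      using t assms by (intro powr_mono2') auto
    finally show "norm (- s * z powr (- s - 1)) \<le> norm s * a powr (- Re s - 1)"
      by (simp add: norm_mult mult_left_mono)
  qed (auto simp: S_def)
  also have "norm (complex_of_real b - of_real a) = b - a"
    using assms by (simp flip: of_real_diff)
  finally show ?thesis by (simp add: norm_minus_commute)
qed

text \<open>The right side is the integral of u^(-\<sigma>-1) over [m-1, m]; the comparison is
  obtained without integration, from -ln(1 - 1/m) >= 1/m and exp y >= 1 + y.\<close>

lemma powr_telescope_bound:
  fixes m \<sigma> :: real
  assumes "m > 1" "\<sigma> > 0"
  shows "m powr (- \<sigma> - 1) \<le> ((m - 1) powr (- \<sigma>) - m powr (- \<sigma>)) / \<sigma>"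
proof -
  have "1 + \<sigma> / m \<le> 1 + \<sigma> * (- ln (1 - 1 / m))"
    using mult_left_mono[of "1 / m" "- ln (1 - 1 / m)" \<sigma>] ln_le_minus_one[of "1 - 1 / m"] assms by simp
  also have "\<dots> \<le> exp (\<sigma> * (- ln (1 - 1 / m)))" by (rule exp_ge_add_one_self)
  also have "\<dots> = (1 - 1 / m) powr (- \<sigma>)" using assms by (simp add: powr_def)
  also have "\<dots> = (m - 1) powr (- \<sigma>) / m powr (- \<sigma>)"
    using assms by (subst powr_divide[symmetric]) (auto simp: diff_divide_distrib)
  finally have "(1 + \<sigma> / m) * m powr (- \<sigma>) \<le> (m - 1) powr (- \<sigma>)"
    using assms by (simp add: field_simps)
  then have "m powr (- \<sigma>) / m \<le> ((m - 1) powr (- \<sigma>) - m powr (- \<sigma>)) / \<sigma>"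
    using assms by (simp add: field_simps)
  then show ?thesis using assms by (simp add: powr_diff)
qed

lemma sums_powr_tail:
  fixes \<sigma> :: real
  assumes "\<sigma> > 0" "N > 0"
  shows "summable (\<lambda>n. real (Suc (n + N)) powr (- \<sigma> - 1))"
    "(\<Sum>n. real (Suc (n + N)) powr (- \<sigma> - 1)) \<le> real N powr (- \<sigma>) / \<sigma>"
proof -
  let ?g = "\<lambda>n. (real (n + N) powr (- \<sigma>)) / \<sigma>"
  have "?g \<longlonglongrightarrow> 0" using assms by real_asymp
  from telescope_sums'[OF this]
  have g: "(\<lambda>n. ?g n - ?g (Suc n)) sums (real N powr (- \<sigma>) / \<sigma>)" by simp
  have le: "real (Suc (n + N)) powr (- \<sigma> - 1) \<le> ?g n - ?g (Suc n)" for n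
    using powr_telescope_bound[of "real (Suc (n + N))" \<sigma>] assms by (simp add: diff_divide_distrib)
  show 1: "summable (\<lambda>n. real (Suc (n + N)) powr (- \<sigma> - 1))"
    by (rule summable_comparison_test'[OF sums_summable[OF g], of 0]) (use le in auto)
  show "(\<Sum>n. real (Suc (n + N)) powr (- \<sigma> - 1)) \<le> real N powr (- \<sigma>) / \<sigma>"
    using suminf_le[OF le 1 sums_summable[OF g]] sums_unique[OF g] by simp
qed

lemma suminf_powr_le:
  fixes \<sigma> :: real
  assumes "\<sigma> > 0"
  shows "summable (\<lambda>n. real (Suc n) powr (- \<sigma> - 1))"
    "(\<Sum>n. real (Suc n) powr (- \<sigma> - 1)) \<le> 1 + 1 / \<sigma>"
proof -
  have "summable (\<lambda>n. real (Suc (n + 1)) powr (- \<sigma> - 1))" by (rule sums_powr_tail) (use assms in auto)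
  then show 1: "summable (\<lambda>n. real (Suc n) powr (- \<sigma> - 1))"
    using summable_iff_shift[of "\<lambda>n. real (Suc n) powr (- \<sigma> - 1)" 1] by simp
  show "(\<Sum>n. real (Suc n) powr (- \<sigma> - 1)) \<le> 1 + 1 / \<sigma>"
    using suminf_split_initial_segment[OF 1, of 1] sums_powr_tail(2)[OF assms, of 1] by simp
qed

text \<open>Weierstrass' test. The majorants may depend on a bound for |s| as well, because the
  terms produced by partial summation grow linearly in |s|.\<close>

lemma holomorphic_suminf_half_plane:
  fixes f :: "nat \<Rightarrow> complex \<Rightarrow> complex"
  assumes hol: "\<And>n. f n holomorphic_on {s. Re s > a}"
    and dom: "\<And>d M. d > a \<Longrightarrow> \<exists>h. summable h \<and> (\<forall>n s. d \<le> Re s \<longrightarrow> norm s \<le> M \<longrightarrow> norm (f n s) \<le> h n)"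
  shows "(\<lambda>s. \<Sum>n. f n s) holomorphic_on {s. Re s > a}"
proof -
  have op: "open {s::complex. Re s > a}" by (rule open_halfspace_Re_gt)
  then obtain F where F: "\<forall>s\<in>{s. Re s > a}. (\<lambda>n. f n s) sums F s \<and> F field_differentiable (at s)"
  proof (rule series_differentiable_comparison_complex)
    fix n x assume "x \<in> {s::complex. Re s > a}"
    then show "f n field_differentiable at x"
      using hol op holomorphic_on_imp_differentiable_at by blast
  next
    fix x assume x: "x \<in> {s::complex. Re s > a}"
    define r where "r = (Re x - a) / 2"
    have r: "r > 0" using x by (simp add: r_def)
    obtain h where h: "summable h" "\<And>n s. a + r \<le> Re s \<Longrightarrow> norm s \<le> norm x + r \<Longrightarrow> norm (f n s) \<le> h n"
      using dom[of "a + r" "norm x + r"] r by auto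
    have "a + r \<le> Re x" using r by (simp add: r_def field_simps)
    then have "h n \<ge> 0" for n
      using order_trans[OF norm_ge_zero h(2)[of x n]] r by simp
    moreover have "norm (f n y) \<le> h n" if "y \<in> ball x r" for n y
    proof (rule h(2))
      have y: "norm (x - y) < r" using that by (simp add: dist_norm)
      have "Re x - Re y < r" using complex_Re_le_cmod[of "x - y"] y by simp
      then show "a + r \<le> Re y" by (simp add: r_def field_simps)
      show "norm y \<le> norm x + r" using y norm_triangle_ineq4[of x "x - y"] by simp
    qed
    ultimately show "\<exists>d h. 0 < d \<and> summable h \<and> range h \<subseteq> \<real>\<^sub>\<ge>\<^sub>0 \<and>
        (\<forall>\<^sub>F n in sequentially. \<forall>y\<in>ball x d \<inter> {s. Re s > a}. cmod (f n y) \<le> cmod (h n))"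
      using r h(1) by (intro exI[of _ r] exI[of _ "\<lambda>n. complex_of_real (h n)"]) (auto simp: summable_complex_of_real)
  qed
  have "F holomorphic_on {s. Re s > a}" using F by (auto simp: holomorphic_on_def intro: field_differentiable_at_within)
  then show ?thesis by (rule holomorphic_transform) (use F in \<open>auto simp: sums_iff\<close>)
qed

text \<open>Partial summation replaces the possibly only conditionally convergent series by one over
  bounded partial sums times differences of consecutive powers. These differences are O(|s| n^(-Re s
  - 1)), so the new series converges absolutely and gives holomorphy and the growth bound at
  once.\<close>

theorem dirichlet_series_bounded_partial_sums:
  fixes c :: "nat \<Rightarrow> complex"
  assumes B: "\<And>N. norm (\<Sum>n<N. c n) \<le> B"
  obtains F where "F holomorphic_on {s. Re s > 0}"
    and "\<And>s. Re s > 0 \<Longrightarrow> (\<lambda>n. c n / of_nat (Suc n) powr s) sums F s"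
    and "\<And>s. Re s > 0 \<Longrightarrow> norm (F s) \<le> B * norm s * (1 + 1 / Re s)"
proof -
  define C where "C = (\<lambda>N. \<Sum>n<N. c n)"
  define f where "f = (\<lambda>n s. C (Suc n) * (of_nat (Suc n) powr (-s) - of_nat (Suc (Suc n)) powr (-s)))"
  have B0: "B \<ge> 0" using B[of 0] by simp
  have fb: "norm (f n s) \<le> B * norm s * real (Suc n) powr (- Re s - 1)" if "Re s > 0" for n s
  proof -
    have "norm (of_nat (Suc n) powr (-s) - of_nat (Suc (Suc n)) powr (-s)) \<le> norm s * real (Suc n) powr (- Re s - 1)"
      using powr_neg_diff_bound[of "real (Suc n)" "real (Suc (Suc n))" s] that by simp
    then have "norm (f n s) \<le> B * (norm s * real (Suc n) powr (- Re s - 1))"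
      unfolding f_def norm_mult using B[of "Suc n"] B0 by (intro mult_mono) (auto simp: C_def)
    then show ?thesis by (simp add: mult_ac)
  qed
  have sm: "summable (\<lambda>n. B * norm s * real (Suc n) powr (- Re s - 1))" if "Re s > 0" for s
    by (intro summable_mult suminf_powr_le that)
  have smf: "summable (\<lambda>n. norm (f n s))" if "Re s > 0" for s
    by (rule summable_comparison_test'[OF sm[OF that], of 0]) (use fb[OF that] in auto)
  define F where "F = (\<lambda>s. \<Sum>n. f n s)"
  show ?thesis
  proof (rule that[of F])
    show "F holomorphic_on {s. Re s > 0}"
      unfolding F_def
    proof (rule holomorphic_suminf_half_plane)
      show "f n holomorphic_on {s. Re s > 0}" for n unfolding f_def by (intro holomorphic_intros)
      fix d M :: real assume d: "d > 0"
      have "norm (f n s) \<le> B * M * real (Suc n) powr (- d - 1)" if s: "d \<le> Re s" "norm s \<le> M" for n s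
      proof -
        have "norm (f n s) \<le> B * norm s * real (Suc n) powr (- Re s - 1)" using fb s d by simp
        also have "\<dots> \<le> B * M * real (Suc n) powr (- d - 1)"
          using B0 s order_trans[OF norm_ge_zero s(2)] by (intro mult_mono powr_mono) auto
        finally show ?thesis .
      qed
      then show "\<exists>h. summable h \<and> (\<forall>n s. d \<le> Re s \<longrightarrow> norm s \<le> M \<longrightarrow> norm (f n s) \<le> h n)"
        using suminf_powr_le(1)[OF d] summable_mult by blast
    qed
    fix s :: complex assume s: "Re s > 0"
    have "(\<lambda>N. C N * of_nat (Suc N) powr (-s)) \<longlonglongrightarrow> 0"
    proof (rule Lim_null_comparison)
      show "(\<lambda>N. B * real (Suc N) powr (- Re s)) \<longlonglongrightarrow> 0" using s by real_asymp
      have "norm (of_nat (Suc N) powr (-s)) = real (Suc N) powr (- Re s)" for N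
        by (subst norm_powr_real_powr) auto
      then show "eventually (\<lambda>N. norm (C N * of_nat (Suc N) powr (-s)) \<le> B * real (Suc N) powr (- Re s)) sequentially"
        using B by (simp add: norm_mult C_def mult_right_mono)
    qed
    moreover have "(\<lambda>N. \<Sum>n<N. f n s) \<longlonglongrightarrow> F s"
      unfolding F_def by (rule summable_LIMSEQ[OF summable_norm_cancel[OF smf[OF s]]])
    ultimately have "(\<lambda>N. (\<Sum>n<N. f n s) + C N * of_nat (Suc N) powr (-s)) \<longlonglongrightarrow> F s + 0" by (intro tendsto_add)
    moreover have "(\<Sum>n<N. f n s) + C N * of_nat (Suc N) powr (-s) = (\<Sum>n<N. c n / of_nat (Suc n) powr s)" for N
    proof (induction N)
      case (Suc N)
      have "(\<Sum>n<Suc N. f n s) + C (Suc N) * of_nat (Suc (Suc N)) powr (-s)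
          = (\<Sum>n<N. f n s) + C (Suc N) * of_nat (Suc N) powr (-s)"
        by (simp add: f_def algebra_simps)
      also have "\<dots> = (\<Sum>n<N. f n s) + C N * of_nat (Suc N) powr (-s) + c N * of_nat (Suc N) powr (-s)"
        by (simp add: C_def algebra_simps)
      also have "\<dots> = (\<Sum>n<Suc N. c n / of_nat (Suc n) powr s)"
        unfolding Suc by (simp add: powr_minus divide_inverse)
      finally show ?case .
    qed (simp add: C_def)
    ultimately show "(\<lambda>n. c n / of_nat (Suc n) powr s) sums F s" by (simp add: sums_def)
    have "norm (F s) \<le> (\<Sum>n. norm (f n s))" unfolding F_def by (rule summable_norm[OF smf[OF s]])
    also have "\<dots> \<le> (\<Sum>n. B * norm s * real (Suc n) powr (- Re s - 1))"
      by (rule suminf_le[OF fb[OF s] smf[OF s] sm[OF s]])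
    also have "\<dots> = B * norm s * (\<Sum>n. real (Suc n) powr (- Re s - 1))"
      by (intro suminf_mult suminf_powr_le s)
    also have "\<dots> \<le> B * norm s * (1 + 1 / Re s)"
      using B0 s by (intro mult_left_mono suminf_powr_le) auto
    finally show "norm (F s) \<le> B * norm s * (1 + 1 / Re s)" .
  qed
qed

text \<open>As \<open>Dirichlet_L\<close> is a choice, the series first serves as a witness that the
  specification can be met; the identity theorem then forces the chosen function to agree with the
  series on the whole half-plane.\<close>

theorem Dirichlet_L_nonprincipal:
  assumes chi: "dirichlet_character q chi" and np: "chi \<noteq> principal_character q"
  shows "Dirichlet_L q chi holomorphic_on {s. Re s > 0}"
    and "Re s > 0 \<Longrightarrow> (\<lambda>n. chi (Suc n) / of_nat (Suc n) powr s) sums Dirichlet_L q chi s"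
    and "Re s > 0 \<Longrightarrow> norm (Dirichlet_L q chi s) \<le> real q * norm s * (1 + 1 / Re s)"
proof -
  obtain F where F: "F holomorphic_on {s. Re s > 0}"
    "\<And>s. Re s > 0 \<Longrightarrow> (\<lambda>n. chi (Suc n) / of_nat (Suc n) powr s) sums F s"
    "\<And>s. Re s > 0 \<Longrightarrow> norm (F s) \<le> real q * norm s * (1 + 1 / Re s)"
    using dirichlet_series_bounded_partial_sums[of "\<lambda>n. chi (Suc n)" "real q"]
      dirichlet_character_partial_sum_bound[OF assms] by blast
  define P where "P = (\<lambda>f. f holomorphic_on L_domain q chi \<and>
        (\<forall>s. Re s > 1 \<longrightarrow> f s = (\<Sum>n. chi (Suc n) / of_nat (Suc n) powr s)))"
  have dom: "L_domain q chi = {s. Re s > 0}" using np by (simp add: L_domain_def)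
  have PF: "P F" unfolding P_def dom using F by (auto simp: sums_iff)
  then have "P (Dirichlet_L q chi)" unfolding Dirichlet_L_def P_def[symmetric] by (rule someI[of P F])
  then have PL: "Dirichlet_L q chi holomorphic_on {s. Re s > 0}"
    "\<And>s. Re s > 1 \<Longrightarrow> Dirichlet_L q chi s = F s"
    using F(2) unfolding P_def dom by (auto simp: sums_iff)
  have eq: "Dirichlet_L q chi s = F s" if "Re s > 0" for s
  proof (rule analytic_continuation_open[of "{s. Re s > 1}" "{s. Re s > 0}" "Dirichlet_L q chi" F])
    show "{s::complex. Re s > 1} \<noteq> {}" by (auto intro: exI[of _ 2])
    show "connected {s::complex. Re s > 0}" by (intro convex_connected convex_halfspace_Re_gt)
  qed (use that PL F in \<open>auto simp: open_halfspace_Re_gt\<close>)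
  show "Dirichlet_L q chi holomorphic_on {s. Re s > 0}" by (rule PL)
  show "Re s > 0 \<Longrightarrow> (\<lambda>n. chi (Suc n) / of_nat (Suc n) powr s) sums Dirichlet_L q chi s"
    "Re s > 0 \<Longrightarrow> norm (Dirichlet_L q chi s) \<le> real q * norm s * (1 + 1 / Re s)"
    using F eq by auto
qed

subsection \<open>Euler products\<close>

text \<open>Sieve of Eratosthenes: if P = N+1 is prime, the numbers without prime factors up to N
  are those also prime to P together with P times the whole set, which produces the factor 1 - g
  P.\<close>

lemma infsum_coprime_to_small_primes:
  fixes g :: "nat \<Rightarrow> complex"
  assumes mult: "\<And>m n. m > 0 \<Longrightarrow> n > 0 \<Longrightarrow> g (m * n) = g m * g n"
    and sm: "g summable_on {0<..}"
  shows "infsum g {n. n > 0 \<and> (\<forall>p. prime p \<longrightarrow> p \<le> N \<longrightarrow> \<not> p dvd n)} =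
    infsum g {0<..} * (\<Prod>p | prime p \<and> p \<le> N. 1 - g p)"
proof (induction N)
  case 0
  have "{n::nat. n > 0 \<and> (\<forall>p. prime p \<longrightarrow> p \<le> 0 \<longrightarrow> \<not> p dvd n)} = {0<..}" by auto
  moreover have "{p::nat. prime p \<and> p \<le> 0} = {}" by (auto dest: prime_gt_0_nat)
  ultimately show ?case by (simp only: prod.empty mult_1_right)
next
  case (Suc N)
  define A where "A = (\<lambda>N. {n::nat. n > 0 \<and> (\<forall>p. prime p \<longrightarrow> p \<le> N \<longrightarrow> \<not> p dvd n)})"
  have sA: "g summable_on A M" for M
    by (rule summable_on_subset_banach[OF sm]) (auto simp: A_def)
  show ?case
  proof (cases "prime (Suc N)")
    case False
    then have "A (Suc N) = A N" "{p. prime p \<and> p \<le> Suc N} = {p. prime p \<and> p \<le> N}"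
      by (auto simp: A_def le_Suc_eq)
    then show ?thesis using Suc by (simp add: A_def)
  next
    case True
    define P where "P = Suc N"
    have P: "prime P" "P > 0" using True by (auto simp: P_def)
    have split: "A N = A (Suc N) \<union> (*) P ` A N"
    proof (intro equalityI subsetI)
      fix n assume n: "n \<in> A N"
      show "n \<in> A (Suc N) \<union> (*) P ` A N"
      proof (cases "P dvd n")
        case True
        then obtain m where m: "n = P * m" by auto
        then have "m \<in> A N" using n by (auto simp: A_def)
        then show ?thesis using m by auto
      next
        case False
        then have "n \<in> A (Suc N)" using n by (auto simp: A_def P_def le_Suc_eq)
        then show ?thesis by simp
      qed
    next
      fix n assume "n \<in> A (Suc N) \<union> (*) P ` A N"
      then consider "n \<in> A (Suc N)" | m where "n = P * m" "m \<in> A N" by auto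
      then show "n \<in> A N"
      proof cases
        case 2
        have "\<not> p dvd n" if p: "prime p" "p \<le> N" for p
        proof
          assume "p dvd n"
          then have "p dvd P \<or> p dvd m" using 2 p by (simp add: prime_dvd_mult_iff)
          moreover have "\<not> p dvd m" using 2 p by (auto simp: A_def)
          moreover have "\<not> p dvd P" using p P primes_dvd_imp_eq[of p P] by (auto simp: P_def)
          ultimately show False by blast
        qed
        then show ?thesis using 2 P by (auto simp: A_def)
      qed (auto simp: A_def)
    qed
    have disj: "A (Suc N) \<inter> (*) P ` A N = {}"
    proof -
      have "\<not> P dvd n" if "n \<in> A (Suc N)" for n using that P(1) by (auto simp: A_def P_def)
      then show ?thesis using dvd_triv_left by blast
    qed
    have inj: "inj_on ((*) P) (A N)" using P by (auto simp: inj_on_def)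
    have "infsum g ((*) P ` A N) = infsum (g \<circ> (*) P) (A N)" by (rule infsum_reindex[OF inj])
    also have "\<dots> = infsum (\<lambda>m. g P * g m) (A N)"
      by (rule infsum_cong) (use mult P in \<open>auto simp: A_def\<close>)
    also have "\<dots> = g P * infsum g (A N)" by (rule infsum_cmult_right') 
    finally have img: "infsum g ((*) P ` A N) = g P * infsum g (A N)" .
    have "infsum g (A N) = infsum g (A (Suc N)) + infsum g ((*) P ` A N)"
    proof -
      have "(*) P ` A N \<subseteq> A N" using equalityD2[OF split] by simp
      then have "g summable_on (*) P ` A N" by (rule summable_on_subset_banach[OF sA])
      from infsum_Un_disjoint[OF sA this disj] show ?thesis by (simp only: split[symmetric])
    qed
    then have "infsum g (A (Suc N)) = infsum g (A N) * (1 - g P)" unfolding img by (simp add: algebra_simps)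
    moreover have "{p. prime p \<and> p \<le> Suc N} = insert P {p. prime p \<and> p \<le> N}"
      using P by (auto simp: P_def le_Suc_eq)
    ultimately show ?thesis using Suc by (simp add: A_def P_def)
  qed
qed

lemma bij_betw_Suc_pos: "bij_betw Suc UNIV {0<..}"
  by (auto simp: bij_betw_def image_iff gr0_conv_Suc)

text \<open>After the sieve only 1 and numbers above N remain, so the sieved sum tends to g(1) = 1.
  Leaving the product next to the sum avoids infinite products and any prior knowledge that the sum
  is nonzero.\<close>

lemma euler_product_tendsto:
  fixes g :: "nat \<Rightarrow> complex"
  assumes mult: "\<And>m n. m > 0 \<Longrightarrow> n > 0 \<Longrightarrow> g (m * n) = g m * g n" and g1: "g 1 = 1"
    and sm: "summable (\<lambda>n. norm (g (Suc n)))"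
  shows "(\<lambda>N. (\<Sum>n. g (Suc n)) * (\<Prod>p | prime p \<and> p \<le> N. 1 - g p)) \<longlonglongrightarrow> 1"
proof -
  have hs: "(g has_sum (\<Sum>n. g (Suc n))) {0<..}"
    using norm_summable_imp_has_sum[OF sm summable_sums[OF summable_norm_cancel[OF sm]]]
    by (simp add: has_sum_reindex_bij_betw[OF bij_betw_Suc_pos, of g, symmetric])
  have nsm: "(\<lambda>n. norm (g n)) summable_on {0<..}"
    using sm by (simp add: summable_on_reindex_bij_betw[OF bij_betw_Suc_pos, of "\<lambda>n. norm (g n)", symmetric] summable_on_UNIV_nonneg_real_iff)
  define A where "A = (\<lambda>N. {n::nat. n > 0 \<and> (\<forall>p. prime p \<longrightarrow> p \<le> N \<longrightarrow> \<not> p dvd n)})"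
  have eq: "infsum g (A N) = (\<Sum>n. g (Suc n)) * (\<Prod>p | prime p \<and> p \<le> N. 1 - g p)" for N
    unfolding A_def using infsum_coprime_to_small_primes[OF mult has_sum_imp_summable[OF hs]] infsumI[OF hs] by simp
  define T where "T = (\<lambda>N. \<Sum>n. norm (g (Suc (n + N))))"
  have T0: "T \<longlonglongrightarrow> 0"
  proof -
    have "(\<lambda>N. (\<Sum>n. norm (g (Suc n))) - (\<Sum>n<N. norm (g (Suc n)))) \<longlonglongrightarrow> (\<Sum>n. norm (g (Suc n))) - (\<Sum>n. norm (g (Suc n)))"
      by (intro tendsto_intros summable_LIMSEQ sm)
    then show ?thesis by (simp add: T_def suminf_minus_initial_segment[OF sm])
  qed
  have "norm (infsum g (A N) - 1) \<le> T N" for N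
  proof -
    have "1 \<in> A N" by (auto simp: A_def prime_nat_iff)
    have sub: "A N - {1} \<subseteq> {N<..}"
    proof
      fix n assume n: "n \<in> A N - {1}"
      then obtain p where p: "prime p" "p dvd n" using prime_factor_nat[of n] by blast
      then have "\<not> p \<le> N" using n p unfolding A_def by blast
      moreover have "p \<le> n" using p n by (intro dvd_imp_le) (simp_all add: A_def)
      ultimately show "n \<in> {N<..}" by simp
    qed
    have sAN: "(\<lambda>n. norm (g n)) summable_on (A N - {1})" "(\<lambda>n. norm (g n)) summable_on {N<..}"
      by (rule summable_on_subset_banach[OF nsm]; auto simp: A_def)+
    have "g summable_on (A N - {1})" using abs_summable_summable[OF sAN(1)] .
    then have "infsum g (insert 1 (A N - {1})) = g 1 + infsum g (A N - {1})"
      by (intro infsum_insert) auto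
    then have "infsum g (A N) - 1 = infsum g (A N - {1})"
      using \<open>1 \<in> A N\<close> by (simp add: insert_absorb g1[unfolded One_nat_def])
    then have "norm (infsum g (A N) - 1) = norm (infsum g (A N - {1}))" by simp
    also have "\<dots> \<le> infsum (\<lambda>n. norm (g n)) (A N - {1})"
      by (rule norm_infsum_bound[OF sAN(1)])
    also have "\<dots> \<le> infsum (\<lambda>n. norm (g n)) {N<..}"
      by (rule infsum_mono2[OF sAN sub]) auto
    also have "\<dots> = infsum (\<lambda>n. norm (g (Suc (n + N)))) UNIV"
    proof (rule infsum_reindex_bij_betw[symmetric])
      show "bij_betw (\<lambda>n. Suc (n + N)) UNIV {N<..}"
        by (rule bij_betw_byWitness[where f' = "\<lambda>n. n - Suc N"]) auto
    qed
    also have "\<dots> = T N"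
    proof -
      have "summable (\<lambda>n. norm (g (Suc (n + N))))"
        using summable_iff_shift[of "\<lambda>n. norm (g (Suc n))" N] sm by simp
      then have "((\<lambda>n. norm (g (Suc (n + N)))) has_sum T N) UNIV"
        unfolding T_def by (intro norm_summable_imp_has_sum summable_sums) auto
      then show ?thesis by (rule infsumI)
    qed
    finally show ?thesis .
  qed
  then have "(\<lambda>N. infsum g (A N) - 1) \<longlonglongrightarrow> 0"
    by (intro Lim_null_comparison[OF _ T0]) auto
  then show ?thesis unfolding eq by (simp add: LIM_zero_iff)
qed

section \<open>The Euler product as an exponential\<close>

definition dirichlet_series :: "(nat \<Rightarrow> complex) \<Rightarrow> complex \<Rightarrow> complex" where
  "dirichlet_series chi s = (\<Sum>n. chi (Suc n) / of_nat (Suc n) powr s)"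

definition prime_series :: "(nat \<Rightarrow> complex) \<Rightarrow> complex \<Rightarrow> complex" where
  "prime_series chi s = (\<Sum>n. if prime n then chi n / of_nat n powr s else 0)"

text \<open>Closed form of the terms k >= 2 in -log(1 - w) = w + w^2/2 + w^3/3 + ..., at w = chi(p)
  p^(-s). Being quadratic in w, they are summable over p as soon as Re s > 1/2.\<close>

definition prime_power_term :: "(nat \<Rightarrow> complex) \<Rightarrow> complex \<Rightarrow> nat \<Rightarrow> complex" where
  "prime_power_term chi s n =
     (if prime n then - Ln (1 - chi n / of_nat n powr s) - chi n / of_nat n powr s else 0)"

definition prime_power_series :: "(nat \<Rightarrow> complex) \<Rightarrow> complex \<Rightarrow> complex" where
  "prime_power_series chi s = (\<Sum>n. prime_power_term chi s n)"

lemma norm_of_nat_powr: "n > 0 \<Longrightarrow> norm (of_nat n powr s :: complex) = real n powr Re s"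
  by (subst norm_powr_real_powr) auto

lemma norm_character_term_le:
  assumes "dirichlet_character q chi" "n > 0"
  shows "norm (chi n / of_nat n powr s) \<le> real n powr (- Re s)"
proof -
  have "norm (chi n / of_nat n powr s) = norm (chi n) * real n powr (- Re s)"
    using assms(2) by (simp add: norm_divide norm_of_nat_powr powr_minus field_simps)
  also have "\<dots> \<le> 1 * real n powr (- Re s)"
    by (intro mult_right_mono norm_dirichlet_character_le[OF assms(1)]) auto
  finally show ?thesis by simp
qed

text \<open>3/4 is a rational number above 1/sqrt 2, the worst case p = 2 and Re s = 1/2. It keeps 1
  - chi(p) p^(-s) in the right half-plane, where \<open>Ln\<close> is holomorphic, and its distance
  1/4 from 1 is the source of the factor 4 in \<open>norm_prime_power_term_le\<close>.\<close>

lemma norm_prime_term_less: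
  assumes "dirichlet_character q chi" "prime n" "Re s \<ge> 1/2"
  shows "norm (chi n / of_nat n powr s) \<le> 3/4"
proof -
  have n: "n \<ge> 2" using assms prime_ge_2_nat by auto
  have "norm (chi n / of_nat n powr s) \<le> real n powr (- Re s)"
    using n by (intro norm_character_term_le[OF assms(1)]) auto
  also have "\<dots> \<le> real n powr (- 1/2)" using n assms by (intro powr_mono) auto
  also have "\<dots> \<le> 2 powr (- 1/2)" using n by (intro powr_mono2') auto
  also have "\<dots> = 1 / sqrt 2" using powr_minus_divide[of 2 "1/2::real"] by (simp add: powr_half_sqrt)
  also have "\<dots> \<le> 3/4"
  proof -
    have "4 / 3 \<le> sqrt 2" by (rule real_le_rsqrt) (simp add: power2_eq_square)
    then show ?thesis by (simp add: field_simps)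
  qed
  finally show ?thesis .
qed

lemma norm_prime_power_term_le:
  assumes chi: "dirichlet_character q chi" and s: "Re s \<ge> 1/2"
  shows "norm (prime_power_term chi s n) \<le> 4 * real n powr (- 2 * Re s)"
proof (cases "prime n")
  case True
  define z where "z = chi n / of_nat n powr s"
  have n: "n > 0" by (rule prime_gt_0_nat[OF True])
  have z: "norm z \<le> 3/4" unfolding z_def by (rule norm_prime_term_less[OF chi True s])
  have "norm (prime_power_term chi s n) = norm (Ln (1 + (-z)) - (-z))"
  proof -
    have "prime_power_term chi s n = - (Ln (1 + (-z)) - (-z))"
      using True unfolding prime_power_term_def z_def[symmetric] by simp
    then show ?thesis by (simp only: norm_minus_cancel)
  qed
  also have "\<dots> \<le> norm (-z) ^ 2 / (1 - norm (-z))"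
    using z by (intro Ln_approx_linear) auto
  also have "\<dots> \<le> norm z ^ 2 / (1/4)" using z by (intro frac_le) auto
  also have "\<dots> = 4 * norm z ^ 2" by simp
  also have "norm z ^ 2 \<le> (real n powr (- Re s)) ^ 2"
    unfolding z_def by (intro power_mono norm_character_term_le[OF chi n]) auto
  also have "\<dots> = real n powr (- 2 * Re s)" using n by (simp add: powr_power)
  finally show ?thesis by simp
qed (simp add: prime_power_term_def)

lemma holomorphic_prime_power_term:
  assumes chi: "dirichlet_character q chi"
  shows "(\<lambda>s. prime_power_term chi s n) holomorphic_on {s. Re s > 1/2}"
proof (cases "prime n")
  case True
  have n: "n > 0" by (rule prime_gt_0_nat[OF True])
  have "1 - chi n / of_nat n powr s \<notin> \<real>\<^sub>\<le>\<^sub>0" if "Re s > 1/2" for s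
  proof -
    have "Re (chi n / of_nat n powr s) \<le> 3/4"
      using norm_prime_term_less[OF chi True, of s] that complex_Re_le_cmod[of "chi n / of_nat n powr s"] by simp
    then show ?thesis by (auto simp: complex_nonpos_Reals_iff)
  qed
  then have "(\<lambda>s. - Ln (1 - chi n / of_nat n powr s) - chi n / of_nat n powr s) holomorphic_on {s. Re s > 1/2}"
    using n by (intro holomorphic_intros) simp_all
  then show ?thesis using True by (simp add: prime_power_term_def)
qed (simp add: prime_power_term_def)

lemma summable_nat_powr:
  assumes "\<sigma> > (1::real)"
  shows "summable (\<lambda>n. real n powr (- \<sigma>))"
  using assms by (simp add: summable_real_powr_iff)

lemma summable_prime_power_term:
  assumes "dirichlet_character q chi" "Re s > 1/2"
  shows "summable (\<lambda>n. norm (prime_power_term chi s n))"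
proof (rule summable_comparison_test'[where N = 0])
  show "summable (\<lambda>n. 4 * real n powr (- (2 * Re s)))"
    using assms by (intro summable_mult summable_nat_powr) auto
qed (use norm_prime_power_term_le[OF assms(1), of s] assms in auto)

text \<open>As the first two terms vanish, the tail estimate starts at N = 1 and gives C/\<sigma>
  rather than C(1 + 1/\<sigma>). This decay in \<sigma> is what later makes log L tend to 0 along
  the real axis.\<close>

lemma suminf_from_2_bound:
  fixes f :: "nat \<Rightarrow> complex"
  assumes f: "f 0 = 0" "f (Suc 0) = 0" and \<sigma>: "\<sigma> > 0"
    and le: "\<And>n. norm (f n) \<le> C * real n powr (- \<sigma> - 1)"
  shows "norm (\<Sum>n. f n) \<le> C / \<sigma>"
proof -
  have C: "C \<ge> 0" using order_trans[OF norm_ge_zero le[of 1]] by simp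
  have sm: "summable (\<lambda>n. C * real (Suc (n + 1)) powr (- \<sigma> - 1))"
    by (intro summable_mult sums_powr_tail \<sigma>) auto
  have le': "norm (f (Suc (n + 1))) \<le> C * real (Suc (n + 1)) powr (- \<sigma> - 1)" for n by (rule le)
  have smn: "summable (\<lambda>n. norm (f (Suc (n + 1))))"
    by (rule summable_comparison_test'[OF sm, of 0]) (use le' in auto)
  then have "summable (\<lambda>n. f (n + 2))" using summable_norm_cancel by fastforce
  then have "summable f" by (simp only: summable_iff_shift)
  then have "(\<Sum>n. f n) = (\<Sum>n. f (Suc (n + 1)))"
    using suminf_minus_initial_segment[of f 2] f by (simp add: numeral_2_eq_2)
  also have "norm \<dots> \<le> (\<Sum>n. norm (f (Suc (n + 1))))" by (rule summable_norm[OF smn])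
  also have "\<dots> \<le> (\<Sum>n. C * real (Suc (n + 1)) powr (- \<sigma> - 1))" by (rule suminf_le[OF le' smn sm])
  also have "\<dots> = C * (\<Sum>n. real (Suc (n + 1)) powr (- \<sigma> - 1))"
    by (intro suminf_mult sums_powr_tail \<sigma>) auto
  also have "\<dots> \<le> C * (real 1 powr (- \<sigma>) / \<sigma>)" using C by (intro mult_left_mono sums_powr_tail \<sigma>) auto
  finally show ?thesis by simp
qed

lemma norm_prime_power_series_le:
  assumes chi: "dirichlet_character q chi" and s: "Re s > 1/2"
  shows "norm (prime_power_series chi s) \<le> 4 / (2 * Re s - 1)"
  unfolding prime_power_series_def
  by (rule suminf_from_2_bound) (use norm_prime_power_term_le[OF chi, of s] s in \<open>auto simp: prime_power_term_def\<close>)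

lemma norm_prime_series_le:
  assumes chi: "dirichlet_character q chi" and s: "Re s > 1"
  shows "norm (prime_series chi s) \<le> 1 / (Re s - 1)"
  unfolding prime_series_def
proof (rule suminf_from_2_bound)
  fix n
  show "norm (if prime n then chi n / of_nat n powr s else 0) \<le> 1 * real n powr (- (Re s - 1) - 1)"
    using norm_character_term_le[OF chi, of n s] by (auto dest: prime_gt_0_nat)
qed (use s in auto)

text \<open>Used with \<open>k = 1\<close> for the sum over primes and \<open>k = 2\<close> for the
  higher prime powers.\<close>

lemma holomorphic_suminf_powr:
  fixes f :: "nat \<Rightarrow> complex \<Rightarrow> complex"
  assumes hol: "\<And>n. f n holomorphic_on {s. Re s > a}" and k: "k > 0" "k * a \<ge> 1" and C: "C \<ge> 0"
    and le: "\<And>n s. Re s > a \<Longrightarrow> norm (f n s) \<le> C * real n powr (- (k * Re s))"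
  shows "(\<lambda>s. \<Sum>n. f n s) holomorphic_on {s. Re s > a}"
proof (rule holomorphic_suminf_half_plane[OF hol])
  fix d M :: real assume d: "d > a"
  have "norm (f n s) \<le> C * real n powr (- (k * d))" if s: "d \<le> Re s" for n s
  proof (cases "n = 0")
    case False
    have "norm (f n s) \<le> C * real n powr (- (k * Re s))" using le s d by simp
    also have "\<dots> \<le> C * real n powr (- (k * d))"
      using s False C k by (intro mult_left_mono powr_mono) auto
    finally show ?thesis .
  qed (use le[of s n] s d in simp)
  moreover have "k * d > 1" using k mult_strict_left_mono[OF d k(1)] by linarith
  then have "summable (\<lambda>n. C * real n powr (- (k * d)))"
    by (intro summable_mult summable_nat_powr)
  ultimately show "\<exists>h. summable h \<and> (\<forall>n s. d \<le> Re s \<longrightarrow> norm s \<le> M \<longrightarrow> norm (f n s) \<le> h n)" by blast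
qed

lemma prime_power_series_tail:
  assumes chi: "dirichlet_character q chi" and N: "N > 0"
  shows "norm (prime_power_series chi 1 - (\<Sum>n\<le>N. prime_power_term chi 1 n)) \<le> 4 / real N"
proof -
  have smt: "summable (\<lambda>n. norm (prime_power_term chi 1 n))"
    using summable_prime_power_term[OF chi, of 1] by simp
  have smt': "summable (\<lambda>n. norm (prime_power_term chi 1 (n + Suc N)))"
    using summable_iff_shift[of "\<lambda>n. norm (prime_power_term chi 1 n)" "Suc N"] smt by simp
  have "prime_power_series chi 1 - (\<Sum>n\<le>N. prime_power_term chi 1 n) = (\<Sum>n. prime_power_term chi 1 (n + Suc N))"
    using suminf_minus_initial_segment[OF summable_norm_cancel[OF smt], of "Suc N"]
    by (simp add: prime_power_series_def lessThan_Suc_atMost)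
  also have "norm \<dots> \<le> (\<Sum>n. norm (prime_power_term chi 1 (n + Suc N)))"
    by (rule summable_norm[OF smt'])
  also have "\<dots> \<le> (\<Sum>n. 4 * real (Suc (n + N)) powr (- 1 - 1))"
  proof (rule suminf_le[OF _ smt'])
    show "norm (prime_power_term chi 1 (n + Suc N)) \<le> 4 * real (Suc (n + N)) powr (- 1 - 1)" for n
      using norm_prime_power_term_le[OF chi, of 1 "n + Suc N"] by simp
    show "summable (\<lambda>n. 4 * real (Suc (n + N)) powr (- 1 - 1))"
      by (intro summable_mult sums_powr_tail(1)[of 1 N]) (use N in auto)
  qed
  also have "\<dots> = 4 * (\<Sum>n. real (Suc (n + N)) powr (- 1 - 1))"
    by (intro suminf_mult sums_powr_tail(1)[of 1 N]) (use N in auto)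
  also have "\<dots> \<le> 4 * (real N powr (- 1) / 1)"
    using N by (intro mult_left_mono sums_powr_tail(2)) auto
  also have "\<dots> = 4 / real N" using N by (simp add: powr_minus_divide)
  finally show ?thesis .
qed

lemma holomorphic_prime_power_series:
  assumes chi: "dirichlet_character q chi"
  shows "prime_power_series chi holomorphic_on {s. Re s > 1/2}"
  unfolding prime_power_series_def
  by (rule holomorphic_suminf_powr[where k = 2 and C = 4])
     (use norm_prime_power_term_le[OF chi] holomorphic_prime_power_term[OF chi] in auto)

lemma holomorphic_prime_series:
  assumes chi: "dirichlet_character q chi"
  shows "prime_series chi holomorphic_on {s. Re s > 1}"
  unfolding prime_series_def
proof (rule holomorphic_suminf_powr[where k = 1 and C = 1])
  fix n
  show "(\<lambda>s. if prime n then chi n / of_nat n powr s else 0) holomorphic_on {s. Re s > 1}"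
    by (cases "prime n") (auto intro!: holomorphic_intros dest: prime_gt_0_nat)
  show "norm (if prime n then chi n / of_nat n powr s else 0) \<le> 1 * real n powr (- (1 * Re s))" for s
    using norm_character_term_le[OF chi, of n s] by (auto dest: prime_gt_0_nat)
qed auto

lemma summable_prime_series:
  assumes "dirichlet_character q chi" "Re s > 1"
  shows "summable (\<lambda>n. norm (if prime n then chi n / of_nat n powr s else 0))"
  using norm_character_term_le[OF assms(1)] assms(2)
  by (intro summable_comparison_test'[OF summable_nat_powr[of "Re s"], of 0]) (auto simp: prime_gt_0_nat)

lemma summable_dirichlet_series:
  assumes "dirichlet_character q chi" "Re s > 1"
  shows "summable (\<lambda>n. norm (chi (Suc n) / of_nat (Suc n) powr s))"
proof (rule summable_comparison_test'[where N = 0])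
  show "summable (\<lambda>n. real (Suc n) powr (- Re s))"
    using suminf_powr_le(1)[of "Re s - 1"] assms by simp
qed (use norm_character_term_le[OF assms(1), of "Suc _" s] in auto)

theorem dirichlet_series_euler_product:
  assumes chi: "dirichlet_character q chi" and s: "Re s > 1"
  shows "(\<lambda>N. dirichlet_series chi s * (\<Prod>p | prime p \<and> p \<le> N. 1 - chi p / of_nat p powr s)) \<longlonglongrightarrow> 1"
proof -
  define g where "g = (\<lambda>n. chi n / of_nat n powr s)"
  have mult: "g (m * n) = g m * g n" if "m > 0" "n > 0" for m n
  proof -
    have "(of_nat (m * n) powr s :: complex) = of_nat m powr s * of_nat n powr s"
      by (simp add: powr_times_real)
    then show ?thesis by (simp add: g_def dirichlet_character_mult[OF chi])
  qed
  have g1: "g 1 = 1" using dirichlet_character_1[OF chi] by (simp add: g_def)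
  show ?thesis
    using euler_product_tendsto[OF mult g1] summable_dirichlet_series[OF assms]
    by (simp add: dirichlet_series_def g_def)
qed

text \<open>The exponential of minus a partial sum is exactly a partial Euler product, because exp
  undoes each \<open>Ln\<close>; no question about branches of a sum of logarithms arises.\<close>

theorem dirichlet_series_eq_exp:
  assumes chi: "dirichlet_character q chi" and s: "Re s > 1"
  shows "dirichlet_series chi s = exp (prime_series chi s + prime_power_series chi s)"
proof -
  define g where "g = (\<lambda>n. chi n / of_nat n powr s)"
  have L: "(\<lambda>N. dirichlet_series chi s * (\<Prod>p | prime p \<and> p \<le> N. 1 - g p)) \<longlonglongrightarrow> 1"
    using dirichlet_series_euler_product[OF assms] by (simp add: g_def)
  define t where "t = (\<lambda>n. (if prime n then g n else 0) + prime_power_term chi s n)"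
  have nz: "1 - g p \<noteq> 0" if "prime p" for p
    using norm_prime_term_less[OF chi that, of s] s by (auto simp: g_def)
  have "(\<lambda>N. \<Sum>n\<le>N. t n) \<longlonglongrightarrow> prime_series chi s + prime_power_series chi s"
  proof -
    have "t sums (prime_series chi s + prime_power_series chi s)"
      unfolding t_def prime_series_def prime_power_series_def g_def
      by (intro sums_add summable_sums summable_norm_cancel[OF summable_prime_series[OF assms]]
            summable_norm_cancel[OF summable_prime_power_term[OF chi]]) (use s in auto)
    then show ?thesis by (simp add: sums_def_le)
  qed
  then have "(\<lambda>N. exp (- (\<Sum>n\<le>N. t n))) \<longlonglongrightarrow> exp (- (prime_series chi s + prime_power_series chi s))"
    by (intro tendsto_intros)
  moreover have "exp (- (\<Sum>n\<le>N. t n)) = (\<Prod>p | prime p \<and> p \<le> N. 1 - g p)" for N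
  proof -
    have "exp (- (\<Sum>n\<le>N. t n)) = (\<Prod>n\<le>N. exp (- t n))" by (simp add: sum_negf[symmetric] exp_sum)
    also have "\<dots> = (\<Prod>n\<le>N. if prime n then 1 - g n else 1)"
      using nz by (intro prod.cong refl) (auto simp: t_def prime_power_term_def g_def)
    also have "\<dots> = (\<Prod>p | prime p \<and> p \<le> N. 1 - g p)"
      by (subst prod.inter_filter[symmetric]) (auto intro: prod.cong)
    finally show ?thesis .
  qed
  ultimately have "(\<lambda>N. dirichlet_series chi s * (\<Prod>p | prime p \<and> p \<le> N. 1 - g p)) \<longlonglongrightarrow>
      dirichlet_series chi s * exp (- (prime_series chi s + prime_power_series chi s))"
    by (intro tendsto_intros) simp
  with L have "dirichlet_series chi s * exp (- (prime_series chi s + prime_power_series chi s)) = 1"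
    using LIMSEQ_unique by blast
  then show ?thesis by (metis exp_minus_inverse mult.assoc mult.commute mult.right_neutral)
qed

subsection \<open>Non-vanishing on the line Re s = 1\<close>

text \<open>Taking logarithms and expanding, the n-th coefficient is r^n / n times 3 + 4 Re u +
  Re(u^2) = 2 (1 + Re u)^2 with u = z^n on the unit circle, hence nonnegative.\<close>

lemma three_four_one:
  fixes r :: real and z :: complex
  assumes "0 \<le> r" "r < 1" "norm z = 1"
  shows "(1 - r) ^ 3 * norm (1 - of_real r * z) ^ 4 * norm (1 - of_real r * z ^ 2) \<le> 1"
proof -
  let ?a = "\<lambda>n. 3 * Re (of_real r ^ n / of_nat n) + 4 * Re ((of_real r * z) ^ n / of_nat n) + Re ((of_real r * z ^ 2) ^ n / of_nat n)"
  let ?l = "3 * (- ln (norm (1 - complex_of_real r))) + 4 * (- ln (norm (1 - of_real r * z))) + (- ln (norm (1 - of_real r * z ^ 2)))"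
  have sums: "(\<lambda>n. Re (w ^ n / of_nat n)) sums (- ln (norm (1 - w)))" if "norm w < 1" for w :: complex
  proof -
    have "1 - w \<noteq> 0" using that by auto
    have "(\<lambda>n. - ((- (- w)) ^ n) / of_nat n) sums Ln (1 + (- w))"
      using that by (intro Ln_series') auto
    then have "(\<lambda>n. - (- (w ^ n) / of_nat n)) sums (- Ln (1 - w))" using sums_minus by fastforce
    from sums_Re[OF this] show ?thesis using \<open>1 - w \<noteq> 0\<close> by simp
  qed
  have r: "norm (complex_of_real r) < 1" "norm (of_real r * z) < 1" "norm (of_real r * z ^ 2) < 1"
    using assms by (simp_all add: norm_mult norm_power)
  have nz: "1 - r \<noteq> 0" "1 - of_real r * z \<noteq> 0" "1 - of_real r * z ^ 2 \<noteq> 0"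
    using r assms by auto
  have "?a
     sums ?l"
    by (intro sums_add sums_mult sums r)
  moreover have "0 \<le> ?a n" for n
  proof -
    define u where "u = z ^ n"
    have "norm u = 1" using assms by (simp add: u_def norm_power)
    then have "Re u ^ 2 + Im u ^ 2 = 1" by (simp add: cmod_def)
    then have u2: "Re (u ^ 2) = 2 * Re u ^ 2 - 1" by (simp add: power2_eq_square)
    have "?a n
      = r ^ n / real n * (3 + 4 * Re u + Re (u ^ 2))"
    proof -
      have *: "Re (of_real r ^ n * v / of_nat n) = r ^ n / real n * Re v" for v :: complex
      proof -
        have "of_real r ^ n * v / of_nat n = complex_of_real (r ^ n / real n) * v" by simp
        then show ?thesis by (simp del: of_real_divide of_real_power)
      qed
      have "(z ^ 2) ^ n = u ^ 2" by (simp add: u_def power_mult[symmetric] mult.commute)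
      then show ?thesis using *[of 1] *[of u] *[of "u ^ 2"]
        unfolding power_mult_distrib u_def[symmetric] by (simp only: mult_1_right one_complex.simps) (simp add: algebra_simps)
    qed
    also have "3 + 4 * Re u + Re (u ^ 2) = 2 * (1 + Re u) ^ 2" unfolding u2 by (simp add: power2_eq_square algebra_simps)
    finally show ?thesis using assms by simp
  qed
  ultimately have "0 \<le> ?l"
    by (rule sums_le[OF _ sums_zero, rotated]) 
  also have "norm (1 - complex_of_real r) = 1 - r" using assms by (metis abs_of_nonneg diff_ge_0_iff_ge less_imp_le norm_of_real of_real_1 of_real_diff)
  finally have "ln ((1 - r) ^ 3 * norm (1 - of_real r * z) ^ 4 * norm (1 - of_real r * z ^ 2)) \<le> ln 1"
    using nz assms by (simp add: ln_mult ln_realpow)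
  then show ?thesis using nz assms by (subst (asm) ln_le_cancel_iff) auto
qed

text \<open>The inequality at each prime is multiplied over finitely many primes: the product
  \<open>Y N\<close> is at most 1, while \<open>X * Y N\<close> tends to 1 by the Euler products.
  Primes dividing q contribute the factor 1.\<close>

lemma dirichlet_series_three_four_one:
  assumes chi: "dirichlet_character q chi" and \<sigma>: "\<sigma> > 1"
  shows "1 \<le> norm (dirichlet_series (principal_character q) (of_real \<sigma>)) ^ 3
            * norm (dirichlet_series chi (Complex \<sigma> t)) ^ 4
            * norm (dirichlet_series (\<lambda>n. chi n ^ 2) (Complex \<sigma> (2 * t)))" (is "1 \<le> ?X")
proof -
  let ?t = "\<lambda>p. norm (1 - principal_character q p / of_nat p powr (of_real \<sigma>)) ^ 3
    * norm (1 - chi p / of_nat p powr (Complex \<sigma> t)) ^ 4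
    * norm (1 - chi p ^ 2 / of_nat p powr (Complex \<sigma> (2 * t)))"
  have q: "q > 0" by (rule dirichlet_character_pos[OF chi])
  define P where "P = (\<lambda>chi s N. \<Prod>p | prime p \<and> p \<le> N. 1 - chi p / of_nat p powr (s :: complex))"
  define X where "X = ?X"
  define Y where "Y = (\<lambda>N. norm (P (principal_character q) (of_real \<sigma>) N) ^ 3 * norm (P chi (Complex \<sigma> t) N) ^ 4
       * norm (P (\<lambda>n. chi n ^ 2) (Complex \<sigma> (2 * t)) N))"
  have lim: "(\<lambda>N. norm (dirichlet_series psi s * P psi s N)) \<longlonglongrightarrow> norm (1::complex)"
    if "dirichlet_character q psi" "Re s > 1" for psi s
    unfolding P_def by (rule tendsto_norm[OF dirichlet_series_euler_product[OF that]])
  have "(\<lambda>N. norm (dirichlet_series (principal_character q) (of_real \<sigma>) * P (principal_character q) (of_real \<sigma>) N) ^ 3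
      * norm (dirichlet_series chi (Complex \<sigma> t) * P chi (Complex \<sigma> t) N) ^ 4
      * norm (dirichlet_series (\<lambda>n. chi n ^ 2) (Complex \<sigma> (2 * t)) * P (\<lambda>n. chi n ^ 2) (Complex \<sigma> (2 * t)) N))
     \<longlonglongrightarrow> norm (1::complex) ^ 3 * norm (1::complex) ^ 4 * norm (1::complex)"
    using \<sigma> by (intro tendsto_intros lim dirichlet_character_principal dirichlet_character_square chi q) auto
  then have XY: "(\<lambda>N. X * Y N) \<longlonglongrightarrow> 1"
    by (simp add: X_def Y_def norm_mult power_mult_distrib mult_ac)
  have "Y N \<le> 1" for N
  proof -
    have "Y N = (\<Prod>p | prime p \<and> p \<le> N. ?t p)"
      by (simp add: Y_def P_def prod_norm[symmetric] prod_power_distrib[symmetric] prod.distrib)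
    also have "\<dots> \<le> (\<Prod>p | prime p \<and> p \<le> N. 1)"
    proof (rule prod_mono, intro conjI)
      fix p assume "p \<in> {p. prime p \<and> p \<le> N}"
      then have p: "p > 1" by (auto dest: prime_gt_1_nat)
      show "?t p \<le> 1"
      proof (cases "coprime p q")
        case True
        define r where "r = real p powr (- \<sigma>)"
        define z where "z = chi p * of_nat p powr (- \<i> * of_real t)"
        have "r < 1" unfolding r_def using p \<sigma> by (subst powr_less_one) auto
        have z: "norm z = 1" using norm_dirichlet_character[OF chi True] p
          by (simp add: z_def norm_mult norm_of_nat_powr)
        have e: "of_nat p powr - of_real \<sigma> = complex_of_real r"
          using powr_of_real[of "real p" "- \<sigma>"] by (simp add: r_def)
        have 1: "principal_character q p / of_nat p powr (of_real \<sigma>) = of_real r"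
          using True e by (simp add: principal_character_def powr_minus divide_inverse)
        have 2: "chi p / of_nat p powr (Complex \<sigma> t) = of_real r * z"
        proof -
          have "chi p / of_nat p powr (Complex \<sigma> t) = chi p * of_nat p powr (- of_real \<sigma> + - \<i> * of_real t)"
            by (simp add: Complex_eq powr_minus[symmetric] divide_inverse)
          then show ?thesis unfolding z_def e[symmetric] by (simp only: powr_add mult_ac)
        qed
        have 3: "chi p ^ 2 / of_nat p powr (Complex \<sigma> (2 * t)) = of_real r * z ^ 2"
        proof -
          have "chi p ^ 2 / of_nat p powr (Complex \<sigma> (2 * t)) = chi p ^ 2 * of_nat p powr (- of_real \<sigma> + (- \<i> * of_real t + - \<i> * of_real t))"
            by (simp add: Complex_eq powr_minus[symmetric] divide_inverse algebra_simps)
          then show ?thesis unfolding z_def e[symmetric] by (simp only: powr_add mult_ac power2_eq_square)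
        qed
        have "norm (1 - complex_of_real r) = 1 - r" using \<open>r < 1\<close> by (metis abs_of_nonneg diff_ge_0_iff_ge less_imp_le norm_of_real of_real_1 of_real_diff)
        then show ?thesis unfolding 1 2 3 using three_four_one[of r z] z \<open>r < 1\<close> by (simp add: r_def)
      next
        case False
        then have "chi p = 0" using dirichlet_character_eq_0_iff[OF chi] by simp
        then show ?thesis using False by (simp add: principal_character_def)
      qed
    qed auto
    finally show ?thesis by simp
  qed
  then have "X * Y N \<le> X" for N
    using mult_left_mono[of "Y N" 1 X] by (simp add: X_def)
  then have "1 \<le> X" using LIMSEQ_le_const2[OF XY] by blast
  then show ?thesis by (simp add: X_def)
qed

lemma norm_dirichlet_series_le:
  assumes chi: "dirichlet_character q chi" and s: "Re s > 1"
  shows "norm (dirichlet_series chi s) \<le> 1 + 1 / (Re s - 1)"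
proof -
  have sm: "summable (\<lambda>n. real (Suc n) powr (- (Re s - 1) - 1))"
    using s by (intro suminf_powr_le) auto
  have "norm (dirichlet_series chi s) \<le> (\<Sum>n. norm (chi (Suc n) / of_nat (Suc n) powr s))"
    unfolding dirichlet_series_def by (rule summable_norm[OF summable_dirichlet_series[OF assms]])
  also have "\<dots> \<le> (\<Sum>n. real (Suc n) powr (- (Re s - 1) - 1))"
    by (rule suminf_le[OF _ summable_dirichlet_series[OF assms] sm])
       (use norm_character_term_le[OF chi, of "Suc _" s] in auto)
  also have "\<dots> \<le> 1 + 1 / (Re s - 1)"
    using s by (intro suminf_powr_le) auto
  finally show ?thesis .
qed

text \<open>The pole term 1/(s-1) is the integral of u^(-s) over [1, \<infinity>), cut at the
  integers into the differences of \<open>h\<close>; each differs from its term by O(|s| n^(-Re s -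
  1)).\<close>

lemma zeta_minus_pole_bound:
  assumes s: "Re s > 1"
  shows "norm ((\<Sum>n. 1 / of_nat (Suc n) powr s) - 1 / (s - 1)) \<le> norm s * (1 + 1 / Re s)"
proof -
  have s1: "s \<noteq> 1" using s by auto
  define h where "h = (\<lambda>n. of_nat (Suc n) powr (1 - s) / (s - 1))"
  have tm: "norm (1 / of_nat (Suc n) powr s - (h n - h (Suc n))) \<le> norm s * real (Suc n) powr (- Re s - 1)" for n
  proof -
    define a where "a = real (Suc n)"
    define S where "S = closed_segment (complex_of_real a) (complex_of_real (a + 1))"
    \<comment> \<open>A primitive of a^(-s) - u^(-s), so that its increment over [a, a+1] is the
      term minus the integral.\<close>
    define f where "f = (\<lambda>u. u powr (1 - s) / (s - 1) + u * of_real a powr (-s))"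
    have a: "a > 0" by (simp add: a_def)
    have S: "\<exists>t. z = of_real t \<and> a \<le> t \<and> t \<le> a + 1" if "z \<in> S" for z
      using that unfolding S_def closed_segment_of_real by (auto simp: closed_segment_eq_real_ivl)
    have "norm (f (of_real (a + 1)) - f (of_real a)) \<le> norm s * a powr (- Re s - 1) * norm (complex_of_real (a + 1) - of_real a)"
    proof (rule field_differentiable_bound[where S = S and f' = "\<lambda>u. of_real a powr (-s) - u powr (-s)"])
      fix z assume "z \<in> S"
      then obtain t where t: "z = of_real t" "a \<le> t" "t \<le> a + 1" using S by blast
      have "z \<notin> \<real>\<^sub>\<le>\<^sub>0" using t a by auto
      have "1 - s \<noteq> 0" using s1 by auto
      have "(f has_field_derivative (1 - s) * z powr (1 - s - 1) / (s - 1) + of_real a powr (-s)) (at z within S)"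
        unfolding f_def using \<open>z \<notin> \<real>\<^sub>\<le>\<^sub>0\<close> s1
        by (auto intro!: derivative_eq_intros simp: has_field_derivative_at_within)
      also have "(1 - s) * z powr (1 - s - 1) / (s - 1) = - (z powr (-s))"
        using s1 by (simp add: field_simps)
      finally show "(f has_field_derivative of_real a powr (-s) - z powr (-s)) (at z within S)" by simp
      have "norm (of_real a powr (-s) - z powr (-s)) \<le> norm s * a powr (- Re s - 1) * (t - a)"
        unfolding t(1) by (rule powr_neg_diff_bound) (use t a s in auto)
      also have "\<dots> \<le> norm s * a powr (- Re s - 1) * 1"
        using t by (intro mult_left_mono) auto
      finally show "norm (of_real a powr (-s) - z powr (-s)) \<le> norm s * a powr (- Re s - 1)" by simp
    qed (auto simp: S_def)
    also have "norm (complex_of_real (a + 1) - of_real a) = 1" by simp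
    also have "f (of_real (a + 1)) - f (of_real a) = 1 / of_nat (Suc n) powr s - (h n - h (Suc n))"
      by (simp add: f_def h_def a_def powr_minus divide_inverse algebra_simps)
    finally show ?thesis by (simp add: a_def)
  qed
  have "h \<longlonglongrightarrow> 0"
  proof (rule Lim_null_comparison)
    show "eventually (\<lambda>n. norm (h n) \<le> real (Suc n) powr (1 - Re s) / norm (s - 1)) sequentially"
      unfolding h_def norm_divide using norm_of_nat_powr[of "Suc _" "1 - s"] by simp
    have "(\<lambda>n. real (Suc n) powr (1 - Re s)) \<longlonglongrightarrow> 0" using s by real_asymp
    then show "(\<lambda>n. real (Suc n) powr (1 - Re s) / norm (s - 1)) \<longlonglongrightarrow> 0"
      by (rule tendsto_divide_zero)
  qed
  from telescope_sums'[OF this] have h: "(\<lambda>n. h n - h (Suc n)) sums (1 / (s - 1))" by (simp add: h_def)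
  have "dirichlet_character 1 (\<lambda>_. 1)" by (simp add: dirichlet_character_def)
  from summable_norm_cancel[OF summable_dirichlet_series[OF this s]]
  have z: "summable (\<lambda>n. 1 / of_nat (Suc n) powr s)" by simp
  have sm: "summable (\<lambda>n. norm s * real (Suc n) powr (- Re s - 1))"
    using s by (intro summable_mult suminf_powr_le) auto
  have sm2: "summable (\<lambda>n. norm (1 / of_nat (Suc n) powr s - (h n - h (Suc n))))"
    by (rule summable_comparison_test'[OF sm, of 0]) (use tm in auto)
  have "(\<Sum>n. 1 / of_nat (Suc n) powr s) - 1 / (s - 1) = (\<Sum>n. 1 / of_nat (Suc n) powr s - (h n - h (Suc n)))"
    using suminf_diff[OF z sums_summable[OF h]] sums_unique[OF h] by simp
  also have "norm \<dots> \<le> (\<Sum>n. norm (1 / of_nat (Suc n) powr s - (h n - h (Suc n))))"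
    by (rule summable_norm[OF sm2])
  also have "\<dots> \<le> (\<Sum>n. norm s * real (Suc n) powr (- Re s - 1))"
    by (rule suminf_le[OF tm sm2 sm])
  also have "\<dots> = norm s * (\<Sum>n. real (Suc n) powr (- Re s - 1))"
    using s by (intro suminf_mult suminf_powr_le) auto
  also have "\<dots> \<le> norm s * (1 + 1 / Re s)"
    using s by (intro mult_left_mono suminf_powr_le) auto
  finally show ?thesis .
qed

section \<open>Real characters at s = 1\<close>

definition divisor_sum :: "(nat \<Rightarrow> real) \<Rightarrow> nat \<Rightarrow> real" where
  "divisor_sum f m = (\<Sum>d | d dvd m. f d)"

lemma divisor_sum_prime_power_mult:
  fixes f :: "nat \<Rightarrow> real"
  assumes mult: "\<And>m n. f (m * n) = f m * f n" and f1: "f 1 = 1"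
    and p: "prime p" and m: "\<not> p dvd m" "m > 0"
  shows "divisor_sum f (p ^ k * m) = (\<Sum>i\<le>k. f p ^ i) * divisor_sum f m"
proof -
  have pow: "f (p ^ i) = f p ^ i" for i by (induction i) (use f1 mult in auto)
  have bij: "bij_betw (\<lambda>(i, d). p ^ i * d) ({..k} \<times> {d. d dvd m}) {d. d dvd p ^ k * m}"
    unfolding bij_betw_def
  proof (intro conjI inj_onI equalityI subsetI)
    fix x y assume xy: "x \<in> {..k} \<times> {d. d dvd m}" "y \<in> {..k} \<times> {d. d dvd m}"
      "(case x of (i, d) \<Rightarrow> p ^ i * d) = (case y of (i, d) \<Rightarrow> p ^ i * d)"
    obtain i d j e where [simp]: "x = (i, d)" "y = (j, e)" by (cases x, cases y)
    have nd: "\<not> p dvd d" "\<not> p dvd e" "d \<noteq> 0" "e \<noteq> 0" using xy m dvd_trans by auto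
    have "multiplicity p (p ^ i * d) = i" "multiplicity p (p ^ j * e) = j"
      using nd p by (simp_all add: multiplicity_prime_elem_times_other prime_elem_multiplicity_mult_distrib not_dvd_imp_multiplicity_0)
    then have "i = j" using xy by simp
    then show "x = y" using xy p by simp
  next
    fix n assume "n \<in> (\<lambda>(i, d). p ^ i * d) ` ({..k} \<times> {d. d dvd m})"
    then show "n \<in> {d. d dvd p ^ k * m}" by (auto intro!: mult_dvd_mono le_imp_power_dvd)
  next
    fix n assume "n \<in> {d. d dvd p ^ k * m}"
    then obtain a b where ab: "n = a * b" "a dvd p ^ k" "b dvd m" using division_decomp by blast
    then obtain i where "i \<le> k" "a = p ^ i" using p divides_primepow_nat by blast
    then show "n \<in> (\<lambda>(i, d). p ^ i * d) ` ({..k} \<times> {d. d dvd m})" using ab by force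
  qed
  have "divisor_sum f (p ^ k * m) = (\<Sum>(i, d)\<in>{..k} \<times> {d. d dvd m}. f (p ^ i * d))"
    unfolding divisor_sum_def by (subst sum.reindex_bij_betw[OF bij, symmetric]) (simp add: case_prod_unfold)
  also have "\<dots> = (\<Sum>i\<le>k. f p ^ i) * divisor_sum f m"
    by (simp add: mult pow divisor_sum_def sum_product sum.cartesian_product)
  finally show ?thesis .
qed

text \<open>Induction peeling off a full prime power p^e: the factor 1 + f(p) + ... + f(p)^e with
  f(p) in {-1, 0, 1} is never negative, and it is at least 1 for even e, as happens for every prime
  of a square.\<close>

lemma divisor_sum_quadratic:
  fixes f :: "nat \<Rightarrow> real"
  assumes mult: "\<And>m n. f (m * n) = f m * f n" and f1: "f 1 = 1"
    and range: "\<And>n. f n \<in> {-1, 0, 1}" and m: "m > 0"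
  shows "divisor_sum f m \<ge> 0 \<and> (\<forall>k. m = k ^ 2 \<longrightarrow> divisor_sum f m \<ge> 1)"
  using m
proof (induction m rule: less_induct)
  case (less m)
  show ?case
  proof (cases "m = 1")
    case True
    then have "divisor_sum f m = 1" using f1 by (simp add: divisor_sum_def)
    then show ?thesis by (metis order_refl zero_le_one)
  next
    case False
    then obtain p where p: "prime p" "p dvd m" using prime_factor_nat by blast
    define e where "e = multiplicity p m"
    have e: "e > 0" unfolding e_def using p less.prems by (intro multiplicity_gt_zero_iff[THEN iffD2]) auto
    obtain n where n: "m = p ^ e * n" "\<not> p dvd n"
      using multiplicity_decompose'[of m p] p less.prems unfolding e_def by (metis not_prime_unit not_gr_zero)
    have n0: "n > 0" using n less.prems by (cases n) auto
    have "p ^ e > 1" using p e by (intro one_less_power prime_gt_1_nat)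
    then have "n < m" using n0 n by simp
    note IH = less.IH[OF this n0]
    have ds: "divisor_sum f m = (\<Sum>i\<le>e. f p ^ i) * divisor_sum f n"
      unfolding n(1) by (rule divisor_sum_prime_power_mult[OF mult f1 p(1) n(2) n0])
    have alt: "(\<Sum>i\<le>e. (-1::real) ^ i) = (if even e then 1 else 0)" for e by (induction e) auto
    have zer: "(\<Sum>i\<le>e. (0::real) ^ i) = 1" for e by (induction e) auto
    have S: "(\<Sum>i\<le>e. f p ^ i) \<ge> (if even e then 1 else 0)"
      using range[of p] by (auto simp: alt zer)
    then have S0: "(\<Sum>i\<le>e. f p ^ i) \<ge> 0" by (auto split: if_splits)
    have "divisor_sum f m \<ge> 1" if k: "m = k ^ 2" for k
    proof -
      have "e = 2 * multiplicity p k"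
        unfolding e_def k using p less.prems k by (subst prime_elem_multiplicity_power_distrib) auto
      then have "even e" by simp
      define j where "j = multiplicity p k"
      have "p ^ j dvd k" by (simp add: j_def multiplicity_dvd)
      then obtain l where l: "k = p ^ j * l" by auto
      have "p ^ e = (p ^ j) ^ 2" using \<open>e = 2 * multiplicity p k\<close> by (simp add: j_def power_even_eq)
      then have "p ^ e * n = p ^ e * l ^ 2"
        by (metis n(1) k l power_mult_distrib)
      then have "n = l ^ 2" using p by simp
      then have "divisor_sum f n \<ge> 1" using IH by blast
      moreover have "(\<Sum>i\<le>e. f p ^ i) \<ge> 1" using S \<open>even e\<close> by simp
      ultimately show ?thesis unfolding ds using mult_mono[of 1 "\<Sum>i\<le>e. f p ^ i" 1 "divisor_sum f n"] by simp
    qed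
    then show ?thesis using S0 IH unfolding ds by simp
  qed
qed

text \<open>Expanding x^n / (1 - x^n) geometrically and grouping the pairs (n, k) by m = nk yields
  the power series with coefficients \<open>divisor_sum f m\<close>; all its terms are nonnegative,
  so keeping only squares gives a lower bound. Absolute summability over pairs justifies the
  regrouping.\<close>

lemma lambert_series_lower_bound:
  fixes f :: "nat \<Rightarrow> real"
  assumes mult: "\<And>m n. f (m * n) = f m * f n" and f1: "f 1 = 1"
    and range: "\<And>n. f n \<in> {-1, 0, 1}" and x: "0 < x" "x < 1"
  shows "summable (\<lambda>n. f (Suc n) * (x ^ Suc n / (1 - x ^ Suc n)))"
    and "(\<Sum>k=1..K. x ^ (k ^ 2)) \<le> (\<Sum>n. f (Suc n) * (x ^ Suc n / (1 - x ^ Suc n)))"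
proof -
  let ?l = "\<lambda>n. f (Suc n) * (x ^ Suc n / (1 - x ^ Suc n))"
  have fle: "\<bar>f n\<bar> \<le> 1" for n using range[of n] by auto
  define A where "A = ({0<..} :: nat set) \<times> ({0<..} :: nat set)"
  define F where "F = (\<lambda>(n, k). f n * x ^ (n * k))"
  have xn: "0 < x ^ n" "x ^ n < 1" if "n > 0" for n using x that by (auto simp: power_less_one_iff)
  have geo: "(\<lambda>k. norm (c * x ^ (n * k))) summable_on {0<..}" "((\<lambda>k. c * x ^ (n * k)) has_sum (c * (x ^ n / (1 - x ^ n)))) {0<..}"
    if n: "n > 0" for n :: nat and c :: real
  proof -
    have pw: "x ^ (n * Suc k) = x ^ n * (x ^ n) ^ k" for k by (simp add: power_add power_mult)
    have s: "(\<lambda>k. c * x ^ (n * Suc k)) sums (c * (x ^ n / (1 - x ^ n)))"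
    proof -
      have "(\<lambda>k. (x ^ n) ^ k) sums (1 / (1 - x ^ n))" using xn[OF n] by (intro geometric_sums) auto
      from sums_mult[OF this, of "c * x ^ n"] show ?thesis unfolding pw by (simp add: mult_ac)
    qed
    have sa: "summable (\<lambda>k. norm (c * x ^ (n * Suc k)))"
    proof -
      have "summable (\<lambda>k. (x ^ n) ^ k)" using xn[OF n] by (intro summable_geometric) auto
      from summable_mult[OF this, of "\<bar>c\<bar> * x ^ n"] show ?thesis unfolding pw using x by (simp add: abs_mult mult_ac)
    qed
    show "((\<lambda>k. c * x ^ (n * k)) has_sum (c * (x ^ n / (1 - x ^ n)))) {0<..}"
      using norm_summable_imp_has_sum[OF sa s] by (simp only: has_sum_reindex_bij_betw[OF bij_betw_Suc_pos, of "\<lambda>k. c * x ^ (n * k)"])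
    show "(\<lambda>k. norm (c * x ^ (n * k))) summable_on {0<..}"
      using summable_nonneg_imp_summable_on[OF sa] by (simp only: summable_on_reindex_bij_betw[OF bij_betw_Suc_pos, of "\<lambda>k. norm (c * x ^ (n * k))"] norm_ge_zero)
  qed
  have abs: "(\<lambda>p. norm (F p)) summable_on A"
    unfolding A_def
  proof (rule Infinite_Sum.abs_summable_on_Sigma_iff[THEN iffD2], intro conjI ballI)
    fix n :: nat assume n: "n \<in> {0<..}"
    then show "(\<lambda>k. norm (F (n, k))) summable_on {0<..}" using geo(1)[of n "f n"] by (simp add: F_def)
  next
    have e: "infsum (\<lambda>k. norm (F (n, k))) {0<..} = \<bar>f n\<bar> * (x ^ n / (1 - x ^ n))" if "n > 0" for n
      using geo(2)[OF that, of "\<bar>f n\<bar>"] x by (intro infsumI) (simp add: F_def abs_mult)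
    have "summable (\<lambda>n. norm (norm (infsum (\<lambda>k. norm (F (Suc n, k))) {0<..})))"
    proof (rule summable_comparison_test'[where N = 0])
      show "summable (\<lambda>n. x ^ n * (1 / (1 - x)))" using x by (intro summable_mult2 summable_geometric) auto
      fix n :: nat
      have "x ^ Suc n \<le> x ^ 1" using x by (intro power_decreasing) auto
      then have "x ^ Suc n / (1 - x ^ Suc n) \<le> x ^ n / (1 - x)"
        using x by (intro frac_le) (auto simp: mult_left_le_one_le)
      then have "\<bar>f (Suc n)\<bar> * (x ^ Suc n / (1 - x ^ Suc n)) \<le> 1 * (x ^ n / (1 - x))"
        using fle[of "Suc n"] x xn[of "Suc n"] by (intro mult_mono) auto
      moreover have nn: "0 \<le> \<bar>f (Suc n)\<bar> * (x ^ Suc n / (1 - x ^ Suc n))" using xn[of "Suc n"] by auto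
      ultimately show "norm (norm (norm (infsum (\<lambda>k. norm (F (Suc n, k))) {0<..}))) \<le> x ^ n * (1 / (1 - x))"
        unfolding e[OF zero_less_Suc] by (simp only: real_norm_def abs_abs abs_of_nonneg mult_1_left times_divide_eq_right mult_1_right)
    qed
    then have "(\<lambda>n. norm (infsum (\<lambda>k. norm (F (Suc n, k))) {0<..})) summable_on UNIV"
      by (rule norm_summable_imp_summable_on)
    then show "(\<lambda>n. norm (infsum (\<lambda>k. norm (F (n, k))) {0<..})) summable_on {0<..}"
      by (simp only: summable_on_reindex_bij_betw[OF bij_betw_Suc_pos, of "\<lambda>n. norm (infsum (\<lambda>k. norm (F (n, k))) {0<..})"])
  qed
  define S where "S = infsum F A"
  have "(F has_sum S) A" unfolding S_def by (rule has_sum_infsum[OF abs_summable_summable[OF abs]])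
  then have "((\<lambda>n. f n * (x ^ n / (1 - x ^ n))) has_sum S) {0<..}"
    unfolding A_def
  proof (rule has_sum_SigmaD)
    fix n :: nat assume "n \<in> {0<..}"
    then show "((\<lambda>k. F (n, k)) has_sum (f n * (x ^ n / (1 - x ^ n)))) {0<..}"
      using geo(2)[of n "f n"] by (simp add: F_def)
  qed
  then have "(?l has_sum S) UNIV"
    by (simp only: has_sum_reindex_bij_betw[OF bij_betw_Suc_pos, of "\<lambda>n. f n * (x ^ n / (1 - x ^ n))"])
  then have Ssum: "?l sums S" by (rule has_sum_imp_sums)
  define B where "B = (SIGMA m:{0<..}. {d::nat. d dvd m})"
  have bij: "bij_betw (\<lambda>(m, d). (d, m div d)) B A"
    by (rule bij_betw_byWitness[where f' = "\<lambda>(n, k). (n * k, n)"])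
       (auto simp: A_def B_def elim!: dvdE)
  have "((\<lambda>(m, d). f d * x ^ m) has_sum S) B"
  proof -
    have "((\<lambda>md. F (case md of (m, d) \<Rightarrow> (d, m div d))) has_sum S) B"
      using \<open>(F has_sum S) A\<close> by (simp only: has_sum_reindex_bij_betw[OF bij, of F])
    then show ?thesis
      by (rule has_sum_cong[THEN iffD1, rotated]) (auto simp: B_def F_def)
  qed
  then have m_sum: "((\<lambda>m. divisor_sum f m * x ^ m) has_sum S) {0<..}"
    unfolding B_def
  proof (rule has_sum_SigmaD)
    fix m :: nat assume "m \<in> {0<..}"
    then have "finite {d. d dvd m}" by simp
    from has_sum_finite[OF this, of "\<lambda>d. f d * x ^ m"]
    show "((\<lambda>d. case (m, d) of (m, d) \<Rightarrow> f d * x ^ m) has_sum (divisor_sum f m * x ^ m)) {d. d dvd m}"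
      by (simp add: divisor_sum_def sum_distrib_right)
  qed
  have dpos: "0 \<le> divisor_sum f m * x ^ m" if "m > 0" for m
    using divisor_sum_quadratic[OF mult f1 range that] x by simp
  show "summable ?l" by (rule sums_summable[OF Ssum])
  have "(\<Sum>k=1..K. x ^ (k ^ 2)) \<le> (\<Sum>k=1..K. divisor_sum f (k ^ 2) * x ^ (k ^ 2))"
  proof (rule sum_mono)
    fix k assume "k \<in> {1..K}"
    then have "divisor_sum f (k ^ 2) \<ge> 1" using divisor_sum_quadratic[OF mult f1 range, of "k ^ 2"] by auto
    then show "x ^ (k ^ 2) \<le> divisor_sum f (k ^ 2) * x ^ (k ^ 2)" using x by simp
  qed
  also have "\<dots> = (\<Sum>m\<in>(\<lambda>k. k ^ 2) ` {1..K}. divisor_sum f m * x ^ m)"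
    by (subst sum.reindex) (auto simp: inj_on_def)
  also have "\<dots> \<le> S"
    by (rule finite_sum_le_has_sum[OF m_sum]) (use dpos in auto)
  also have "S = suminf ?l" by (rule sums_unique[OF Ssum])
  finally show "(\<Sum>k=1..K. x ^ (k ^ 2)) \<le> suminf ?l" .
qed

lemma abel_bound_decreasing:
  fixes b c :: "nat \<Rightarrow> real"
  assumes dec: "\<And>n. b (Suc n) \<le> b n" and pos: "\<And>n. 0 \<le> b n"
    and B: "\<And>N. \<bar>\<Sum>n<N. c n\<bar> \<le> B"
  shows "\<bar>\<Sum>n<N. c n * b n\<bar> \<le> B * b 0"
proof -
  define C where "C = (\<lambda>N. \<Sum>n<N. c n)"
  have eq: "(\<Sum>n<N. c n * b n) = (\<Sum>n<N. C (Suc n) * (b n - b (Suc n))) + C N * b N"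
    by (induction N) (simp_all add: C_def algebra_simps)
  have "\<bar>\<Sum>n<N. c n * b n\<bar> \<le> \<bar>\<Sum>n<N. C (Suc n) * (b n - b (Suc n))\<bar> + \<bar>C N * b N\<bar>"
    unfolding eq by (rule abs_triangle_ineq)
  also have "\<bar>\<Sum>n<N. C (Suc n) * (b n - b (Suc n))\<bar> \<le> (\<Sum>n<N. \<bar>C (Suc n) * (b n - b (Suc n))\<bar>)"
    by (rule sum_abs)
  also have "\<dots> \<le> (\<Sum>n<N. B * (b n - b (Suc n)))"
    using dec B by (intro sum_mono) (auto simp: abs_mult C_def intro!: mult_right_mono simp del: sum.lessThan_Suc)
  also have "\<dots> = B * (b 0 - b N)" by (simp add: sum_distrib_left[symmetric] sum_lessThan_telescope')
  also have "\<bar>C N * b N\<bar> \<le> B * b N" using B pos by (auto simp: abs_mult C_def intro!: mult_right_mono)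
  finally show ?thesis by (simp add: algebra_simps)
qed

text \<open>With \<open>T n\<close> = 1 + x + ... + x^(n-1), the claim reduces to m (m+1) x^m <=
  T(m) T(m+1). Pairing x^i with x^(n-1-i), the inequality of arithmetic and geometric means gives
  T(n) >= n x^((n-1)/2), which suffices.\<close>

lemma geometric_lambert_decreasing:
  fixes x :: real
  assumes x: "0 < x" "x < 1"
  defines "b \<equiv> \<lambda>n. 1 / (real (Suc n) * (1 - x)) - x ^ Suc n / (1 - x ^ Suc n)"
  shows "b (Suc n) \<le> b n"
proof -
  define T where "T = (\<lambda>n. \<Sum>i<n. x ^ i)"
  have Tx: "1 - x ^ n = (1 - x) * T n" for n unfolding T_def by (rule one_diff_power_eq)
  have T: "real n * sqrt x ^ (n - 1) \<le> T n" for n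
  proof -
    have "2 * T n = (\<Sum>i<n. x ^ i + x ^ (n - Suc i))"
      unfolding T_def sum.distrib by (simp add: sum.nat_diff_reindex)
    also have "\<dots> \<ge> (\<Sum>i<n. 2 * sqrt x ^ (n - 1))"
    proof (rule sum_mono)
      fix i assume "i \<in> {..<n}"
      then have "x ^ i * x ^ (n - Suc i) = x ^ (n - 1)" by (simp add: power_add[symmetric])
      then have "sqrt (x ^ i * x ^ (n - Suc i)) = sqrt x ^ (n - 1)" by (simp add: real_sqrt_power)
      then have "sqrt x ^ (n - 1) \<le> (x ^ i + x ^ (n - Suc i)) / 2"
        using arith_geo_mean_sqrt[of "x ^ i" "x ^ (n - Suc i)"] x by simp
      then show "2 * sqrt x ^ (n - 1) \<le> x ^ i + x ^ (n - Suc i)" by simp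
    qed
    finally show ?thesis by simp
  qed
  define m where "m = Suc n"
  have m: "m > 0" by (simp add: m_def)
  have Tpos: "T m > 0" "T (Suc m) > 0"
    unfolding T_def by (rule sum_pos; use x m in auto)+
  have "real m * real (Suc m) * x ^ m \<le> T m * T (Suc m)"
  proof -
    have "real m * real (Suc m) * (sqrt x ^ m * sqrt x ^ m) \<le> (real m * sqrt x ^ m) * (real (Suc m) * sqrt x ^ m)" by (simp add: mult_ac)
    also have "\<dots> \<le> T m * T (Suc m)"
    proof (rule mult_mono)
      have "real m * sqrt x ^ m \<le> real m * sqrt x ^ (m - 1)"
        using x by (intro mult_left_mono power_decreasing) auto
      then show "real m * sqrt x ^ m \<le> T m" using T[of m] by (rule order_trans)
      show "real (Suc m) * sqrt x ^ m \<le> T (Suc m)" using T[of "Suc m"] by simp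
    qed (use x Tpos in auto)
    finally show ?thesis using x by (simp add: power_mult_distrib[symmetric])
  qed
  then have h1: "x ^ m / (T m * T (Suc m)) \<le> 1 / (real m * real (Suc m))"
  proof -
    have *: "y / A \<le> 1 / D" if "D > 0" "A > 0" "D * y \<le> A" for D A y :: real
      using that by (simp add: field_simps)
    assume "real m * real (Suc m) * x ^ m \<le> T m * T (Suc m)"
    then show ?thesis using Tpos m by (intro *) auto
  qed
  have h2: "x ^ m / (1 - x ^ m) - x ^ Suc m / (1 - x ^ Suc m) = (x ^ m / (T m * T (Suc m))) / (1 - x)"
  proof -
    have "x ^ m * (1 - x ^ Suc m) - x ^ Suc m * (1 - x ^ m) = x ^ m * (1 - x)" by (simp add: algebra_simps)
    moreover have "1 - x ^ m \<noteq> 0" "1 - x ^ Suc m \<noteq> 0" using x m by (auto simp: Tx Tpos less_imp_neq[symmetric] simp del: power_Suc)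
    ultimately have "x ^ m / (1 - x ^ m) - x ^ Suc m / (1 - x ^ Suc m) = x ^ m * (1 - x) / ((1 - x ^ m) * (1 - x ^ Suc m))"
      by (simp add: diff_frac_eq del: power_Suc)
    then show ?thesis unfolding Tx using x by simp
  qed
  have h3: "1 / (real m * (1 - x)) - 1 / (real (Suc m) * (1 - x)) = (1 / (real m * real (Suc m))) / (1 - x)"
  proof -
    have "1 / real m - 1 / real (Suc m) = 1 / (real m * real (Suc m))" using m by (simp add: field_simps)
    then show ?thesis by (metis diff_divide_distrib divide_divide_eq_left)
  qed
  have "x ^ m / (1 - x ^ m) - x ^ Suc m / (1 - x ^ Suc m) \<le> 1 / (real m * (1 - x)) - 1 / (real (Suc m) * (1 - x))"
    unfolding h2 h3 using h1 by (rule divide_right_mono) (use x in simp)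
  then show ?thesis unfolding b_def m_def by linarith
qed

text \<open>
  Monsky's argument: if the sum were 0, subtracting \<open>1/(1-x)\<close> times it from the Lambert series
  \<open>\<Sum>n. f n x^n / (1 - x^n)\<close> would leave a series with monotone weights, bounded as \<open>x \<rightarrow> 1\<close>, whereas
  the coefficients of the Lambert series as a power series are nonnegative, and at least 1 at the squares.
\<close>

theorem quadratic_sum_nonzero:
  fixes f :: "nat \<Rightarrow> real"
  assumes mult: "\<And>m n. f (m * n) = f m * f n" and f1: "f 1 = 1"
    and range: "\<And>n. f n \<in> {-1, 0, 1}"
    and B: "\<And>N. \<bar>\<Sum>n<N. f (Suc n)\<bar> \<le> B"
  shows "\<not> (\<lambda>n. f (Suc n) / real (Suc n)) sums 0"
proof
  assume zero: "(\<lambda>n. f (Suc n) / real (Suc n)) sums 0"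
  have bound: "(\<Sum>k=1..K. x ^ (k ^ 2)) \<le> B" if x: "0 < x" "x < 1" for K and x :: real
  proof -
    define b where "b = (\<lambda>n. 1 / (real (Suc n) * (1 - x)) - x ^ Suc n / (1 - x ^ Suc n))"
    define S where "S = (\<Sum>n. f (Suc n) * (x ^ Suc n / (1 - x ^ Suc n)))"
    have "(\<lambda>n. f (Suc n) * (x ^ Suc n / (1 - x ^ Suc n))) sums S"
      unfolding S_def by (rule summable_sums[OF lambert_series_lower_bound(1)[OF mult f1 range x]])
    from sums_diff[OF sums_divide[OF zero, of "1 - x"] this]
    have "(\<lambda>n. f (Suc n) * b n) sums (- S)"
      by (simp add: b_def right_diff_distrib)
    then have lim: "(\<lambda>N. \<Sum>n<N. f (Suc n) * b n) \<longlonglongrightarrow> - S" by (simp add: sums_def)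
    have dec: "b (Suc n) \<le> b n" for n unfolding b_def by (rule geometric_lambert_decreasing[OF x])
    have "b \<longlonglongrightarrow> 0" unfolding b_def using x by real_asymp
    then have pos: "0 \<le> b n" for n
      using dec by (intro decseq_ge[of b 0 n]) (auto intro: decseq_SucI)
    have "\<bar>\<Sum>n<N. f (Suc n) * b n\<bar> \<le> B * b 0" for N
      using abel_bound_decreasing[of b "\<lambda>n. f (Suc n)" B N, OF dec pos B] .
    then have "\<bar>- S\<bar> \<le> B * b 0"
      by (intro LIMSEQ_le_const2[OF tendsto_rabs[OF lim]]) auto
    \<comment> \<open>This value is the same for all x, which makes the bound on \<open>S\<close>
      uniform as x approaches 1.\<close>
    moreover have "b 0 = 1" using x by (simp add: b_def field_simps)
    ultimately have "S \<le> B" by simp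
    then show ?thesis using lambert_series_lower_bound(2)[OF mult f1 range x, of K] by (simp add: S_def)
  qed
  \<comment> \<open>Chosen to exceed \<open>B\<close>: as x tends to 1, the K terms of the lower
    bound sum to K.\<close>
  define K where "K = nat \<lceil>B\<rceil> + 1"
  have "((\<lambda>x::real. \<Sum>k=1..K. x ^ (k ^ 2)) \<longlongrightarrow> (\<Sum>k=1..K. 1 ^ (k ^ 2))) (at_left 1)"
    by (intro tendsto_intros)
  moreover have "eventually (\<lambda>x::real. (\<Sum>k=1..K. x ^ (k ^ 2)) \<le> B) (at_left 1)"
    by (rule eventually_mono[OF eventually_at_left_real[OF zero_less_one]]) (use bound in auto)
  ultimately have "(\<Sum>k=1..K. (1::real) ^ (k ^ 2)) \<le> B"
    by (intro tendsto_upperbound[of _ _ "at_left 1"]) auto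
  then show False unfolding K_def by simp linarith
qed

section \<open>Boundedness near Re s = 1 and the non-vanishing theorem\<close>

lemma dirichlet_series_nonprincipal:
  assumes "dirichlet_character q chi" "chi \<noteq> principal_character q" "Re s > 1"
  shows "Dirichlet_L q chi s = dirichlet_series chi s"
  using Dirichlet_L_nonprincipal(2)[OF assms(1,2), of s] assms(3) by (simp add: dirichlet_series_def sums_iff)

text \<open>Subtracting the mean \<open>m\<close> of psi over a period leaves coefficients with
  bounded partial sums, so the series is a bounded function plus \<open>m\<close> times zeta. For t
  different from 0 zeta is bounded there; for t = 0 the character is non-principal and
  \<open>m\<close> vanishes.\<close>

lemma dirichlet_series_bounded_near_line:
  assumes psi: "dirichlet_character q psi" and np: "psi \<noteq> principal_character q \<or> t \<noteq> 0"
  obtains M where "\<And>\<sigma>. 1 < \<sigma> \<Longrightarrow> \<sigma> \<le> 2 \<Longrightarrow> norm (dirichlet_series psi (Complex \<sigma> t)) \<le> M"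
proof -
  have q: "q > 0" by (rule dirichlet_character_pos[OF psi])
  have ns: "norm (Complex \<sigma> t) * (1 + 1 / \<sigma>) \<le> (2 + \<bar>t\<bar>) * 2" if "1 < \<sigma>" "\<sigma> \<le> 2" for \<sigma>
  proof (rule mult_mono)
    show "norm (Complex \<sigma> t) \<le> 2 + \<bar>t\<bar>" using norm_triangle_ineq[of "of_real \<sigma>" "\<i> * of_real t"] that
      by (simp add: Complex_eq norm_mult)
  qed (use that in auto)
  define m where "m = (\<Sum>r<q. psi r) / of_nat q"
  define c where "c = (\<lambda>n. psi (Suc n) - m)"
  have "norm m \<le> 1"
    using sum_norm_bound[of "{..<q}" psi 1] norm_dirichlet_character_le[OF psi] q
    by (simp add: m_def norm_divide divide_le_eq)
  have sumc: "(\<Sum>r<q. c r) = 0"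
    using q by (simp add: c_def sum_subtractf m_def sum_dirichlet_character_Suc[OF psi])
  have cb: "norm (\<Sum>n<N. c n) \<le> real q * 2" for N
  proof (rule periodic_partial_sum_bound[OF q _ sumc])
    show "c (n + q) = c n" for n using dirichlet_character_periodic[OF psi, of "Suc n"] by (simp add: c_def)
    show "norm (c n) \<le> 2" for n
      using norm_triangle_ineq4[of "psi (Suc n)" m] norm_dirichlet_character_le[OF psi, of "Suc n"] \<open>norm m \<le> 1\<close>
      by (simp add: c_def)
  qed
  obtain F where "F holomorphic_on {s. Re s > 0}"
    and F: "\<And>s. Re s > 0 \<Longrightarrow> (\<lambda>n. c n / of_nat (Suc n) powr s) sums F s"
      "\<And>s. Re s > 0 \<Longrightarrow> norm (F s) \<le> real q * 2 * norm s * (1 + 1 / Re s)"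
    using dirichlet_series_bounded_partial_sums[OF cb] by blast
  define Z where "Z = (\<lambda>s. \<Sum>n. 1 / of_nat (Suc n) powr s :: complex)"
  have one: "dirichlet_character 1 (\<lambda>_. 1)" by (simp add: dirichlet_character_def)
  have split: "dirichlet_series psi s = F s + m * Z s" if "Re s > 1" for s
  proof -
    have "(\<lambda>n. 1 / of_nat (Suc n) powr s) sums Z s"
      unfolding Z_def using summable_norm_cancel[OF summable_dirichlet_series[OF one that]] by (simp add: summable_sums)
    then have "(\<lambda>n. c n / of_nat (Suc n) powr s + m * (1 / of_nat (Suc n) powr s)) sums (F s + m * Z s)"
      using that by (intro sums_add sums_mult F) auto
    then show ?thesis by (simp add: dirichlet_series_def c_def diff_divide_distrib sums_iff)
  qed
  show ?thesis
  proof (rule that[of "real q * 2 * ((2 + \<bar>t\<bar>) * 2) + ((2 + \<bar>t\<bar>) * 2 + (if t = 0 then 0 else 1 / \<bar>t\<bar>))"])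
    fix \<sigma> :: real assume \<sigma>: "1 < \<sigma>" "\<sigma> \<le> 2"
    let ?s = "Complex \<sigma> t"
    have "norm (dirichlet_series psi ?s) \<le> norm (F ?s) + norm (m * Z ?s)"
      using \<sigma> by (simp add: split norm_triangle_ineq)
    also have "norm (F ?s) \<le> real q * 2 * (norm ?s * (1 + 1 / \<sigma>))" using F(2)[of ?s] \<sigma> by (simp add: mult.assoc)
    also have "\<dots> \<le> real q * 2 * ((2 + \<bar>t\<bar>) * 2)" by (intro mult_left_mono ns \<sigma>) auto
    also have "norm (m * Z ?s) \<le> (2 + \<bar>t\<bar>) * 2 + (if t = 0 then 0 else 1 / \<bar>t\<bar>)"
    proof (cases "t = 0")
      case True
      then have "m = 0" using np sum_dirichlet_character_nonprincipal[OF psi] by (simp add: m_def)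
      then show ?thesis by simp
    next
      case False
      have "norm (Z ?s) \<le> norm (Z ?s - 1 / (?s - 1)) + norm (1 / (?s - 1))"
        using norm_triangle_ineq[of "Z ?s - 1 / (?s - 1)" "1 / (?s - 1)"] by simp
      also have "norm (Z ?s - 1 / (?s - 1)) \<le> norm ?s * (1 + 1 / \<sigma>)"
        unfolding Z_def using zeta_minus_pole_bound[of ?s] \<sigma> by simp
      also have "\<dots> \<le> (2 + \<bar>t\<bar>) * 2" by (rule ns[OF \<sigma>])
      also have "norm (1 / (?s - 1)) \<le> 1 / \<bar>t\<bar>"
      proof -
        have "\<bar>t\<bar> \<le> norm (?s - 1)" using abs_Im_le_cmod[of "?s - 1"] by simp
        then show ?thesis using False by (simp add: norm_divide frac_le)
      qed
      finally have "norm (Z ?s) \<le> (2 + \<bar>t\<bar>) * 2 + 1 / \<bar>t\<bar>" by simp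
      then show ?thesis using False \<open>norm m \<le> 1\<close> mult_mono[of "norm m" 1 "norm (Z ?s)" "(2 + \<bar>t\<bar>) * 2 + 1 / \<bar>t\<bar>"]
        by (simp add: norm_mult)
    qed
    finally show "norm (dirichlet_series psi ?s) \<le> real q * 2 * ((2 + \<bar>t\<bar>) * 2) + ((2 + \<bar>t\<bar>) * 2 + (if t = 0 then 0 else 1 / \<bar>t\<bar>))" by simp
  qed
qed

text \<open>A character with principal square takes only the values -1, 0 and 1, so
  \<open>quadratic_sum_nonzero\<close> applies to its real part.\<close>

lemma Dirichlet_L_quadratic_nonzero:
  assumes chi: "dirichlet_character q chi" and np: "chi \<noteq> principal_character q"
    and sq: "(\<lambda>n. chi n ^ 2) = principal_character q"
  shows "Dirichlet_L q chi 1 \<noteq> 0"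
proof
  assume z: "Dirichlet_L q chi 1 = 0"
  define f where "f = (\<lambda>n. Re (chi n))"
  have vals: "chi n \<in> {-1, 0, 1}" for n
  proof -
    have "chi n ^ 2 = 0 \<or> chi n ^ 2 = 1" using fun_cong[OF sq, of n] by (simp add: principal_character_def)
    then show ?thesis using power2_eq_1_iff[of "chi n"] by auto
  qed
  have real: "chi n = of_real (f n)" for n using vals[of n] by (auto simp: f_def)
  have "\<not> (\<lambda>n. f (Suc n) / real (Suc n)) sums 0"
  proof (rule quadratic_sum_nonzero)
    show "f (m * n) = f m * f n" for m n
      using dirichlet_character_mult[OF chi, of m n] real by (metis of_real_eq_iff of_real_mult)
    show "f 1 = 1" using dirichlet_character_1[OF chi] by (simp add: f_def)
    show "f n \<in> {-1, 0, 1}" for n using vals[of n] by (auto simp: f_def)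
    show "\<bar>\<Sum>n<N. f (Suc n)\<bar> \<le> real q" for N
      using dirichlet_character_partial_sum_bound[OF chi np, of N] abs_Re_le_cmod[of "\<Sum>n<N. chi (Suc n)"]
      by (simp add: f_def)
  qed
  moreover have "(\<lambda>n. chi (Suc n) / of_nat (Suc n)) sums 0"
    using Dirichlet_L_nonprincipal(2)[OF chi np, of 1] z by simp
  then have "(\<lambda>n. Re (chi (Suc n) / of_nat (Suc n))) sums Re 0" by (rule sums_Re)
  then have "(\<lambda>n. f (Suc n) / real (Suc n)) sums 0"
    unfolding f_def by (simp del: of_nat_Suc)
  ultimately show False by blast
qed

text \<open>\<open>GRH\<close> only concerns the open strip, so zeros on its boundary have to be excluded unconditionally.\<close>

theorem Dirichlet_L_nonzero_Re_1:
  assumes chi: "dirichlet_character q chi" and np: "chi \<noteq> principal_character q"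
  shows "Dirichlet_L q chi (Complex 1 t) \<noteq> 0"
proof (cases "(\<lambda>n. chi n ^ 2) = principal_character q \<and> t = 0")
  case True
  then show ?thesis using Dirichlet_L_quadratic_nonzero[OF chi np] by (simp add: one_complex.code)
next
  case False
  show ?thesis
  proof
    assume z: "Dirichlet_L q chi (Complex 1 t) = 0"
    obtain M where M: "\<And>\<sigma>. 1 < \<sigma> \<Longrightarrow> \<sigma> \<le> 2 \<Longrightarrow> norm (dirichlet_series (\<lambda>n. chi n ^ 2) (Complex \<sigma> (2 * t))) \<le> M"
      using dirichlet_series_bounded_near_line[OF dirichlet_character_square[OF chi], of "2 * t"] False by auto
    have q: "q > 0" by (rule dirichlet_character_pos[OF chi])
    obtain D where D: "(Dirichlet_L q chi has_field_derivative D) (at (Complex 1 t))"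
      using holomorphic_on_imp_differentiable_at[OF Dirichlet_L_nonprincipal(1)[OF chi np] open_halfspace_Re_gt, of "Complex 1 t"]
      by (auto simp: field_differentiable_def)
    define C where "C = norm D + 1"
    have "((\<lambda>h. Dirichlet_L q chi (Complex 1 t + h) / h) \<longlongrightarrow> D) (at 0)"
      using D z by (simp add: DERIV_def)
    then have "((\<lambda>h. norm (Dirichlet_L q chi (Complex 1 t + h) / h)) \<longlongrightarrow> norm D) (at 0)" by (rule tendsto_norm)
    then have "eventually (\<lambda>h. norm (Dirichlet_L q chi (Complex 1 t + h) / h) < C) (at 0)"
      by (rule order_tendstoD) (simp add: C_def)
    moreover have "filterlim complex_of_real (at 0) (at_right 0)"
      using tendsto_of_real[OF tendsto_ident_at, of 0 "{0<..}", where 'a = complex]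
      by (intro filterlim_atI) (simp_all add: eventually_at_filter)
    ultimately have "eventually (\<lambda>h::real. norm (Dirichlet_L q chi (Complex 1 t + of_real h) / of_real h) < C) (at_right 0)"
      by (rule eventually_compose_filterlim)
    moreover have "eventually (\<lambda>h::real. h \<in> {0<..<1}) (at_right 0)"
      by (rule eventually_at_right_real) simp
    \<comment> \<open>A zero contributes h^4 against a growth of only h^(-3) from the principal
      character, so the right side tends to 0 with h.\<close>
    ultimately have "eventually (\<lambda>h::real. 1 \<le> ((1 + 1 / h) ^ 3 * h ^ 4) * (C ^ 4 * M)) (at_right 0)"
    proof eventually_elim
      case (elim h)
      have e: "Complex 1 t + of_real h = Complex (1 + h) t" by (simp add: complex_eq_iff)
      have "norm (Dirichlet_L q chi (Complex (1 + h) t)) \<le> C * h"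
        using elim by (simp add: e norm_divide divide_less_eq)
      then have 1: "norm (dirichlet_series chi (Complex (1 + h) t)) \<le> C * h"
        using dirichlet_series_nonprincipal[OF chi np, of "Complex (1 + h) t"] elim by simp
      have 2: "norm (dirichlet_series (principal_character q) (of_real (1 + h))) \<le> 1 + 1 / h"
        using norm_dirichlet_series_le[OF dirichlet_character_principal[OF q], of "of_real (1 + h)"] elim by simp
      have "1 \<le> norm (dirichlet_series (principal_character q) (of_real (1 + h))) ^ 3
            * norm (dirichlet_series chi (Complex (1 + h) t)) ^ 4
            * norm (dirichlet_series (\<lambda>n. chi n ^ 2) (Complex (1 + h) (2 * t)))"
        by (rule dirichlet_series_three_four_one[OF chi]) (use elim in auto)
      also have "\<dots> \<le> (1 + 1 / h) ^ 3 * (C * h) ^ 4 * M"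
        using elim by (intro mult_mono power_mono 1 2 M) (auto simp: C_def)
      finally show ?case by (simp add: power_mult_distrib mult_ac)
    qed
    moreover have "((\<lambda>h::real. (1 + 1 / h) ^ 3 * h ^ 4 * (C ^ 4 * M)) \<longlongrightarrow> 0 * (C ^ 4 * M)) (at_right 0)"
      by (intro tendsto_mult tendsto_const) real_asymp
    ultimately have "1 \<le> 0 * (C ^ 4 * M)"
      by (intro tendsto_lowerbound[of _ _ "at_right (0::real)"]) auto
    then show False by simp
  qed
qed

subsection \<open>The logarithm of L\<close>

text \<open>The rescaled difference \<open>g\<close> maps the unit disc into the half-plane Re w <
  A' and 0 to 0. The map w / (2A' - w) sends this half-plane into the unit disc and fixes 0, so
  Schwarz' lemma bounds \<open>h\<close>, and solving for \<open>g\<close> gives the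
  estimate.\<close>

lemma borel_caratheodory:
  assumes hol: "f holomorphic_on ball c R" and r: "0 \<le> r" "r < R"
    and A: "\<And>w. w \<in> ball c R \<Longrightarrow> Re (f w) < A" and z: "norm (z - c) \<le> r"
  shows "norm (f z) \<le> norm (f c) + 2 * (A - Re (f c)) * r / (R - r)"
proof -
  define A' where "A' = A - Re (f c)"
  have R: "R > 0" using r by simp
  have A': "A' > 0" using A[of c] R by (simp add: A'_def)
  define g where "g = (\<lambda>w. f (c + of_real R * w) - f c)"
  have inb: "c + of_real R * w \<in> ball c R" if "w \<in> ball 0 1" for w
    using that R by (simp add: dist_norm norm_mult)
  have gh: "g holomorphic_on ball 0 1"
    unfolding g_def
    by (intro holomorphic_intros holomorphic_on_compose_gen[OF _ hol, unfolded o_def]) (use inb in auto)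
  have gA: "Re (g w) < A'" if "w \<in> ball 0 1" for w
    using A[OF inb[OF that]] by (simp add: g_def A'_def)
  have nz: "2 * of_real A' - g w \<noteq> 0" if "w \<in> ball 0 1" for w
  proof
    assume "2 * of_real A' - g w = 0"
    then have "Re (2 * of_real A' - g w) = 0" by simp
    then show False using gA[OF that] A' by simp
  qed
  define h where "h = (\<lambda>w. g w / (2 * of_real A' - g w))"
  have hh: "h holomorphic_on ball 0 1" unfolding h_def using gh nz by (intro holomorphic_intros) auto
  have h1: "norm (h w) < 1" if "norm w < 1" for w
  proof -
    have w: "w \<in> ball 0 1" using that by simp
    have "norm (g w) < norm (2 * of_real A' - g w)"
    proof (rule power2_less_imp_less)
      have "(norm (2 * of_real A' - g w))\<^sup>2 - (norm (g w))\<^sup>2 = 4 * A' * (A' - Re (g w))"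
        unfolding cmod_power2 by (simp add: power2_eq_square algebra_simps)
      also have "\<dots> > 0" using gA[OF w] A' by simp
      finally show "(norm (g w))\<^sup>2 < (norm (2 * of_real A' - g w))\<^sup>2" by simp
    qed auto
    then show ?thesis using nz[OF w] by (simp add: h_def norm_divide)
  qed
  define w where "w = (z - c) / of_real R"
  have w: "norm w \<le> r / R" using z R by (simp add: w_def norm_divide divide_right_mono)
  have w1: "norm w < 1" using w r R by (simp add: le_less_trans)
  have "norm (h w) \<le> norm w"
    by (rule Schwarz_Lemma(1)[OF hh _ h1 w1]) (simp_all add: h_def g_def)
  then have hw: "norm (h w) \<le> r / R" using w by simp
  have "g w = h w * (2 * of_real A' - g w)" using nz[of w] w1 by (simp add: h_def)
  then have "norm (g w) = norm (h w) * norm (2 * of_real A' - g w)" by (metis norm_mult)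
  also have "\<dots> \<le> r / R * (2 * A' + norm (g w))"
  proof (rule mult_mono[OF hw])
    have "norm (2 * of_real A' - g w) \<le> norm (2 * complex_of_real A') + norm (g w)" by (rule norm_triangle_ineq4)
    then show "norm (2 * of_real A' - g w) \<le> 2 * A' + norm (g w)" using A' by (simp add: norm_mult)
  qed (use r R in auto)
  finally have "norm (g w) * (R - r) \<le> 2 * A' * r" using R by (simp add: field_simps)
  then have "norm (g w) \<le> 2 * A' * r / (R - r)" using r by (simp add: pos_le_divide_eq)
  moreover have "g w = f z - f c" using R by (simp add: g_def w_def)
  ultimately show ?thesis using norm_triangle_ineq[of "f z - f c" "f c"] by (simp add: A'_def)
qed

text \<open>Three sources meet here: the Euler product to the right of 1, the unconditional theorem
  on the line, and \<open>GRH\<close> inside the strip.\<close>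

lemma Dirichlet_L_nonzero:
  assumes GRH and chi: "dirichlet_character q chi" and np: "chi \<noteq> principal_character q" and s: "Re s > 1/2"
  shows "Dirichlet_L q chi s \<noteq> 0"
proof -
  consider "Re s > 1" | "Re s = 1" | "Re s < 1" by linarith
  then show ?thesis
  proof cases
    case 1
    then show ?thesis using dirichlet_series_nonprincipal[OF chi np] dirichlet_series_eq_exp[OF chi] by simp
  next
    case 2
    then show ?thesis using Dirichlet_L_nonzero_Re_1[OF chi np, of "Im s"] complex_surj[of s] by simp
  next
    case 3
    then show ?thesis using \<open>GRH\<close> chi s unfolding GRH_def by force
  qed
qed

lemma holomorphic_exp_eq_1_constant:
  assumes S: "convex S" "open S" and d: "d holomorphic_on S" and e: "\<And>s. s \<in> S \<Longrightarrow> exp (d s) = 1"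
  shows "\<exists>k. \<forall>s\<in>S. d s = k"
proof (rule has_field_derivative_zero_constant[OF S(1)])
  fix s assume s: "s \<in> S"
  obtain D where D: "(d has_field_derivative D) (at s)"
    using holomorphic_on_imp_differentiable_at[OF d S(2) s] by (auto simp: field_differentiable_def)
  have "((\<lambda>s. exp (d s)) has_field_derivative exp (d s) * D) (at s)"
    using D by (rule DERIV_fun_exp)
  then have "((\<lambda>s. 1) has_field_derivative exp (d s) * D) (at s)"
    by (rule has_field_derivative_transform_within_open[OF _ S(2) s]) (use e in auto)
  then have "exp (d s) * D = 0" using DERIV_const DERIV_unique by blast
  then have "D = 0" by simp
  then show "(d has_field_derivative 0) (at s within S)" using D by (simp add: has_field_derivative_at_within)
qed

text \<open>A holomorphic logarithm exists on the half-plane and differs from the Euler product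
  logarithm by a constant \<open>k\<close> with exp k = 1. Removing \<open>k\<close> selects the
  branch tending to 0 at +\<infinity>, the one that \<open>arg_from_infinity\<close>
  measures.\<close>

lemma log_Dirichlet_L:
  assumes GRH and chi: "dirichlet_character q chi" and np: "chi \<noteq> principal_character q"
  obtains G where "G holomorphic_on {s. Re s > 1/2}"
    and "\<And>s. Re s > 1/2 \<Longrightarrow> Dirichlet_L q chi s = exp (G s)"
    and "\<And>s. Re s > 1 \<Longrightarrow> G s = prime_series chi s + prime_power_series chi s"
proof -
  have holL: "Dirichlet_L q chi holomorphic_on {s. Re s > 1/2}"
    by (rule holomorphic_on_subset[OF Dirichlet_L_nonprincipal(1)[OF chi np]]) auto
  have contr: "contractible {s::complex. Re s > 1/2}"
    by (intro convex_imp_contractible convex_halfspace_Re_gt)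
  obtain g where g: "g holomorphic_on {s. Re s > 1/2}"
    "\<And>s. s \<in> {s. Re s > 1/2} \<Longrightarrow> Dirichlet_L q chi s = exp (g s)"
    by (rule contractible_imp_holomorphic_log[OF holL contr]) (use Dirichlet_L_nonzero[OF assms] in auto)
  define P where "P = (\<lambda>s. prime_series chi s + prime_power_series chi s)"
  have "\<exists>k. \<forall>s\<in>{s. Re s > 1}. g s - P s = k"
  proof (rule holomorphic_exp_eq_1_constant)
    show "(\<lambda>s. g s - P s) holomorphic_on {s. Re s > 1}"
      unfolding P_def
      by (intro holomorphic_intros holomorphic_prime_series[OF chi]
            holomorphic_on_subset[OF g(1)] holomorphic_on_subset[OF holomorphic_prime_power_series[OF chi]]) auto
    fix s assume "s \<in> {s::complex. Re s > 1}"
    then have "exp (g s) = exp (P s)"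
      using g(2)[of s] dirichlet_series_nonprincipal[OF chi np, of s] dirichlet_series_eq_exp[OF chi, of s]
      by (simp add: P_def)
    then show "exp (g s - P s) = 1" by (simp add: exp_diff)
  qed (auto intro: convex_halfspace_Re_gt open_halfspace_Re_gt)
  then obtain k where k: "\<And>s. Re s > 1 \<Longrightarrow> g s - P s = k" by auto
  have "exp k = 1"
  proof -
    have "exp (g 2) = exp (P 2)"
      using g(2)[of 2] dirichlet_series_nonprincipal[OF chi np, of 2] dirichlet_series_eq_exp[OF chi, of 2]
      by (simp add: P_def)
    then show ?thesis using k[of 2] by (auto simp: exp_diff)
  qed
  show ?thesis
  proof (rule that[of "\<lambda>s. g s - k"])
    show "(\<lambda>s. g s - k) holomorphic_on {s. Re s > 1/2}" by (intro holomorphic_intros g)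
    show "Dirichlet_L q chi s = exp (g s - k)" if "Re s > 1/2" for s
      using g(2)[of s] that \<open>exp k = 1\<close> by (simp add: exp_diff)
    show "g s - k = prime_series chi s + prime_power_series chi s" if "Re s > 1" for s
      using k[OF that] by (simp add: P_def algebra_simps)
  qed
qed

text \<open>Borel-Caratheodory about 2 + i Im s, where log L is at most 1 + 4/3 <= 3, with Re log L
  bounded through the trivial bound for |L|. The radius 3/2 - \<delta> reaches the abscissa 1/2 +
  \<delta>, and the larger disc still stays to the right of 1/2; the gap \<delta>/2 between the
  radii produces the factor 6/\<delta>.\<close>

lemma log_Dirichlet_L_bound:
  assumes chi: "dirichlet_character q chi" and np: "chi \<noteq> principal_character q"
    and G: "G holomorphic_on {s. Re s > 1/2}"
      "\<And>s. Re s > 1/2 \<Longrightarrow> Dirichlet_L q chi s = exp (G s)"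
      "\<And>s. Re s > 1 \<Longrightarrow> G s = prime_series chi s + prime_power_series chi s"
    and \<delta>: "0 < \<delta>" "\<delta> < 1/2" and s: "1/2 + \<delta> \<le> Re s" "Re s \<le> 2"
  shows "norm (G s) \<le> 3 + 6 / \<delta> * (ln (3 * real q * (\<bar>Im s\<bar> + 4)) + 4)"
proof -
  define c where "c = Complex 2 (Im s)"
  \<comment> \<open>The summand 1 makes the bound on the real part strict, as
    \<open>borel_caratheodory\<close> demands.\<close>
  define A where "A = ln (3 * real q * (\<bar>Im s\<bar> + 4)) + 1"
  define R where "R = 3/2 - \<delta>/2"
  define r where "r = 3/2 - \<delta>"
  have q: "q > 0" by (rule dirichlet_character_pos[OF chi])
  have c3: "norm (G c) \<le> 3"
  proof -
    have "norm (G c) \<le> norm (prime_series chi c) + norm (prime_power_series chi c)"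
      using G(3)[of c] by (simp add: c_def norm_triangle_ineq)
    also have "norm (prime_series chi c) \<le> 1" using norm_prime_series_le[OF chi, of c] by (simp add: c_def)
    also have "norm (prime_power_series chi c) \<le> 4/3" using norm_prime_power_series_le[OF chi, of c] by (simp add: c_def)
    finally show ?thesis by simp
  qed
  have lnpos: "ln (3 * real q * (\<bar>Im s\<bar> + 4)) \<ge> 0"
  proof -
    have "1 * 1 \<le> 3 * real q * (\<bar>Im s\<bar> + 4)" using q by (intro mult_mono) auto
    then show ?thesis by simp
  qed
  have ball: "Re w > 1/2 + \<delta>/2 \<and> norm w \<le> \<bar>Im s\<bar> + 4" if "w \<in> ball c R" for w
  proof -
    have d: "norm (c - w) < R" using that by (simp add: dist_norm)
    have "Re (c - w) < R" using d complex_Re_le_cmod[of "c - w"] by linarith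
    then have 1: "Re w > 1/2 + \<delta>/2" by (simp add: c_def R_def)
    have "norm w \<le> norm c + norm (c - w)" using norm_triangle_ineq4[of c "c - w"] by simp
    also have "norm c \<le> 2 + \<bar>Im s\<bar>" using cmod_le[of c] by (simp add: c_def)
    finally have "norm w \<le> \<bar>Im s\<bar> + 4" using d \<delta> by (simp add: R_def)
    with 1 show ?thesis by simp
  qed
  have "norm (G s) \<le> norm (G c) + 2 * (A - Re (G c)) * r / (R - r)"
  proof (rule borel_caratheodory[where f = G and c = c and z = s and A = A and R = R and r = r])
    show "G holomorphic_on ball c R"
      by (rule holomorphic_on_subset[OF G(1)]) (use ball \<delta> in force)
    show "0 \<le> r" "r < R" using \<delta> by (auto simp: r_def R_def)
    have "s - c = of_real (Re s - 2)" by (simp add: complex_eq_iff c_def)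
    then have "norm (s - c) = \<bar>Re s - 2\<bar>" by (metis norm_of_real)
    then show "norm (s - c) \<le> r" using s by (simp add: r_def)
    fix w assume w: "w \<in> ball c R"
    have Rew: "Re w > 1/2" using ball[OF w] \<delta> by simp
    have "exp (Re (G w)) = norm (Dirichlet_L q chi w)" using G(2)[OF Rew] by simp
    also have "\<dots> \<le> real q * norm w * (1 + 1 / Re w)" using Dirichlet_L_nonprincipal(3)[OF chi np] Rew by simp
    also have "\<dots> \<le> real q * (\<bar>Im s\<bar> + 4) * 3"
      using ball[OF w] Rew by (intro mult_mono mult_nonneg_nonneg) (auto simp: field_simps)
    finally have "Re (G w) \<le> ln (real q * (\<bar>Im s\<bar> + 4) * 3)"
      using q by (intro ln_ge_iff[THEN iffD2]) auto
    then show "Re (G w) < A" by (simp add: A_def mult_ac)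
  qed
  also have "\<dots> \<le> 3 + 2 * (A + 3) * (3/2) / (\<delta>/2)"
  proof (rule add_mono[OF c3])
    have "- Re (G c) \<le> 3" using c3 abs_Re_le_cmod[of "G c"] by linarith
    then have "2 * (A - Re (G c)) * r \<le> 2 * (A + 3) * r"
      using \<delta> by (intro mult_right_mono) (auto simp: r_def)
    also have "\<dots> \<le> 2 * (A + 3) * (3/2)"
      using \<delta> lnpos by (intro mult_left_mono) (auto simp: r_def A_def)
    finally have "2 * (A - Re (G c)) * r / (\<delta>/2) \<le> 2 * (A + 3) * (3/2) / (\<delta>/2)"
      using \<delta> by (intro divide_right_mono) auto
    moreover have "R - r = \<delta>/2" by (simp add: R_def r_def)
    ultimately show "2 * (A - Re (G c)) * r / (R - r) \<le> 2 * (A + 3) * (3/2) / (\<delta>/2)" by (simp only:)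
  qed
  also have "2 * (A + 3) * (3/2) / (\<delta>/2) = 6 / \<delta> * (ln (3 * real q * (\<bar>Im s\<bar> + 4)) + 4)"
    using \<delta> by (simp add: A_def field_simps)
  finally show ?thesis .
qed

text \<open>To evaluate the \<open>THE\<close>, Im G along the real axis provides one admissible
  variation of the argument. Any other differs from it by a continuous function with values in the
  multiples of 2 pi, hence by a constant, which the limit at infinity shows to be 0.\<close>

lemma arg_from_infinity_eq:
  assumes chi: "dirichlet_character q chi" and np: "chi \<noteq> principal_character q"
    and G: "G holomorphic_on {s. Re s > 1/2}"
      "\<And>s. Re s > 1/2 \<Longrightarrow> Dirichlet_L q chi s = exp (G s)"
      "\<And>s. Re s > 1 \<Longrightarrow> G s = prime_series chi s + prime_power_series chi s"
  shows "arg_from_infinity (Dirichlet_L q chi) 1 = Im (G 1)"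
proof -
  define \<psi> where "\<psi> = (\<lambda>\<sigma>::real. Im (G (of_real \<sigma>)))"
  define Q where "Q = (\<lambda>\<phi>. continuous_on {1..} \<phi> \<and>
        (\<forall>\<sigma>\<ge>1. Dirichlet_L q chi (of_real \<sigma>) = of_real (cmod (Dirichlet_L q chi (of_real \<sigma>))) * cis (\<phi> \<sigma>)) \<and>
        (\<phi> \<longlongrightarrow> (0::real)) at_top)"
  have L: "Dirichlet_L q chi (of_real \<sigma>) = of_real (cmod (Dirichlet_L q chi (of_real \<sigma>))) * cis (\<psi> \<sigma>)"
    "Dirichlet_L q chi (of_real \<sigma>) \<noteq> 0" if "\<sigma> \<ge> 1" for \<sigma> :: real
    using G(2)[of "of_real \<sigma>"] that by (simp_all add: exp_eq_polar \<psi>_def norm_mult)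
  have cont: "continuous_on {1..} \<psi>"
    unfolding \<psi>_def
    by (intro continuous_intros continuous_on_compose2[OF holomorphic_on_imp_continuous_on[OF G(1)]]) auto
  have lim: "(\<psi> \<longlongrightarrow> 0) at_top"
  proof (rule Lim_null_comparison)
    show "((\<lambda>\<sigma>::real. 1 / (\<sigma> - 1) + 4 / (2 * \<sigma> - 1)) \<longlongrightarrow> 0) at_top" by real_asymp
    show "eventually (\<lambda>\<sigma>. norm (\<psi> \<sigma>) \<le> 1 / (\<sigma> - 1) + 4 / (2 * \<sigma> - 1)) at_top"
      using eventually_gt_at_top[of 1]
    proof eventually_elim
      case (elim \<sigma>)
      have "norm (\<psi> \<sigma>) \<le> norm (G (of_real \<sigma>))" using abs_Im_le_cmod by (simp add: \<psi>_def)
      also have "\<dots> \<le> norm (prime_series chi (of_real \<sigma>)) + norm (prime_power_series chi (of_real \<sigma>))"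
        using G(3)[of "of_real \<sigma>"] elim by (simp add: norm_triangle_ineq)
      also have "\<dots> \<le> 1 / (\<sigma> - 1) + 4 / (2 * \<sigma> - 1)"
        using norm_prime_series_le[OF chi, of "of_real \<sigma>"] norm_prime_power_series_le[OF chi, of "of_real \<sigma>"] elim
        by (intro add_mono) auto
      finally show ?case .
    qed
  qed
  have Q\<psi>: "Q \<psi>" using cont L lim by (auto simp: Q_def)
  have uniq: "\<phi> 1 = \<psi> 1" if \<phi>: "Q \<phi>" for \<phi>
  proof -
    define d where "d = (\<lambda>\<sigma>. \<phi> \<sigma> - \<psi> \<sigma>)"
    have "\<exists>k. \<forall>\<sigma>\<in>{1..}. d \<sigma> = k"
    proof -
      have "d constant_on {1..}"
      proof (rule continuous_discrete_range_constant)
        show "connected {1::real..}" by simp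
        show "continuous_on {1..} d" unfolding d_def using \<phi> cont by (auto simp: Q_def intro!: continuous_intros)
        fix x :: real assume x: "x \<in> {1..}"
        have int: "\<exists>n::int. d \<sigma> = 2 * pi * of_int n" if "\<sigma> \<ge> 1" for \<sigma>
        proof -
          have "cis (\<phi> \<sigma>) = cis (\<psi> \<sigma>)"
            using \<phi> L[OF that] that unfolding Q_def by (metis mult_cancel_left norm_eq_zero of_real_eq_0_iff)
          then have "cis (d \<sigma>) = 1" by (simp add: d_def flip: cis_divide)
          then have "cos (d \<sigma>) = 1" by (metis Re_complex_of_real cis.simps(1) one_complex.simps(1))
          then show ?thesis by (auto simp: cos_one_2pi_int mult_ac)
        qed
        show "\<exists>e>0. \<forall>y. y \<in> {1..} \<and> d y \<noteq> d x \<longrightarrow> e \<le> norm (d y - d x)"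
        proof (intro exI[of _ "2 * pi"] conjI allI impI)
          fix y assume y: "y \<in> {1..} \<and> d y \<noteq> d x"
          obtain m n :: int where mn: "d y = 2 * pi * of_int m" "d x = 2 * pi * of_int n" using int x y by fastforce
          then have "m \<noteq> n" using y by auto
          then have "1 \<le> \<bar>real_of_int (m - n)\<bar>" by linarith
          then have "2 * pi * 1 \<le> 2 * pi * \<bar>real_of_int (m - n)\<bar>" by (intro mult_left_mono) auto
          also have "\<dots> = norm (d y - d x)"
          proof -
            have "d y - d x = 2 * pi * real_of_int (m - n)" unfolding mn by (simp add: algebra_simps)
            then show ?thesis by (simp add: abs_mult)
          qed
          finally show "2 * pi \<le> norm (d y - d x)" by simp
        qed simp
      qed
      then show ?thesis by (auto simp: constant_on_def)
    qed
    then obtain k where k: "\<And>\<sigma>. \<sigma> \<ge> 1 \<Longrightarrow> d \<sigma> = k" by auto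
    have "(d \<longlongrightarrow> 0 - 0) at_top" unfolding d_def using \<phi> lim by (intro tendsto_diff) (auto simp: Q_def)
    moreover have "(d \<longlongrightarrow> k) at_top"
      by (rule tendsto_eventually) (rule eventually_mono[OF eventually_ge_at_top[of 1]], rule k)
    ultimately have "k = 0" using tendsto_unique[of at_top d] by (simp add: trivial_limit_at_top_linorder)
    then show ?thesis using k[of 1] by (simp add: d_def)
  qed
  have "arg_from_infinity (Dirichlet_L q chi) 1 = (THE t. \<exists>\<phi>. Q \<phi> \<and> t = \<phi> 1)"
    unfolding arg_from_infinity_def Q_def by (simp only: conj_assoc)
  also have "\<dots> = \<psi> 1"
  proof (rule the_equality)
    show "\<exists>\<phi>. Q \<phi> \<and> \<psi> 1 = \<phi> 1" using Q\<psi> by blast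
    show "t = \<psi> 1" if "\<exists>\<phi>. Q \<phi> \<and> t = \<phi> 1" for t using that uniq by blast
  qed
  finally show ?thesis by (simp add: \<psi>_def)
qed

subsection \<open>Newman's contour\<close>

text \<open>Comparison with an integral. For a <= 1 the summands decrease and the first term on the
  right is enough; for a > 1 they increase and the last summand must be added. Both cases occur,
  since the left half-circle reaches down to Re z = -R.\<close>

lemma sum_powr_le:
  fixes a :: real
  assumes a: "a > 0" and N: "N > 0"
  shows "(\<Sum>n=1..N. real n powr (a - 1)) \<le> real N powr a / a + real N powr (a - 1)"
proof -
  have mvt: "\<exists>z. x < z \<and> z < x + 1 \<and> (x + 1) powr a - x powr a = a * z powr (a - 1)" if "x > 0" for x :: real
  proof -
    have "\<exists>z. x < z \<and> z < x + 1 \<and> (x + 1) powr a - x powr a = (x + 1 - x) * (a * z powr (a - 1))"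
      by (rule MVT2) (use that in \<open>auto intro!: derivative_eq_intros simp: powr_diff\<close>)
    then show ?thesis by simp
  qed
  show ?thesis
  proof (cases "a \<le> 1")
    case True
    have "(\<Sum>n=1..N. real n powr (a - 1)) \<le> real N powr a / a"
    proof (induction N)
      case (Suc N)
      have "real (Suc N) powr (a - 1) \<le> (real (Suc N) powr a - real N powr a) / a"
      proof (cases "N = 0")
        case False
        then obtain z where z: "real N < z" "z < real N + 1" "(real N + 1) powr a - real N powr a = a * z powr (a - 1)"
          using mvt[of "real N"] by auto
        have "real (Suc N) powr (a - 1) \<le> z powr (a - 1)" using z True False by (intro powr_mono2') auto
        then show ?thesis using z a by (simp add: add.commute)
      qed (use a True in auto)
      then show ?case using Suc by (simp add: diff_divide_distrib)
    qed simp
    then show ?thesis using powr_ge_zero[of "real N" "a - 1"] by linarith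
  next
    case False
    show ?thesis using N
    proof (induction N rule: nat_induct_non_zero)
      case (Suc N)
      then obtain z where z: "real N < z" "z < real N + 1" "(real N + 1) powr a - real N powr a = a * z powr (a - 1)"
        using mvt[of "real N"] by auto
      have "real N powr (a - 1) \<le> z powr (a - 1)" using z False by (intro powr_mono2) auto
      also have "\<dots> = real (Suc N) powr a / a - real N powr a / a"
        using z a by (simp add: add.commute flip: diff_divide_distrib)
      finally show ?case using Suc by simp
    qed (use a in auto)
  qed
qed

text \<open>Keeping the decay 1/(b + |t|) makes the pole part of the kernel contribute only a
  logarithm of the length of the side; \<open>B\<close> takes up the part of the kernel without
  decay.\<close>

lemma contour_integral_vertical_bound:
  assumes ha: "(h has_contour_integral I) (linepath (Complex x 0) (Complex x y))"
    and b: "b > 0" and A: "A \<ge> 0"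
    and le: "\<And>t. \<bar>t\<bar> \<le> \<bar>y\<bar> \<Longrightarrow> norm (h (Complex x t)) \<le> A / (b + \<bar>t\<bar>) + B"
  shows "norm I \<le> A * ln (1 + \<bar>y\<bar> / b) + B * \<bar>y\<bar>"
proof -
  define R where "R = \<bar>y\<bar>"
  have R: "R \<ge> 0" by (simp add: R_def)
  have lp: "linepath (Complex x 0) (Complex x y) u = Complex x (u * y)" for u
    by (simp add: linepath_def complex_eq_iff algebra_simps)
  have hi: "((\<lambda>u. h (Complex x (u * y)) * (Complex x y - Complex x 0)) has_integral I) {0..1}"
    using ha unfolding has_contour_integral_linepath lp .
  have pos: "b + R * u > 0" if "u \<in> {0..1}" for u using b R that by (intro add_pos_nonneg) auto
  have gi: "((\<lambda>u. (A / (b + R * u) + B) * R) has_integral ((A * ln (b + R * 1) + B * R * 1) - (A * ln (b + R * 0) + B * R * 0))) {0..1}"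
  proof (rule fundamental_theorem_of_calculus)
    fix u :: real assume u: "u \<in> {0..1}"
    have "((\<lambda>u. A * ln (b + R * u) + B * R * u) has_field_derivative (A / (b + R * u) + B) * R) (at u within {0..1})"
      using pos[OF u] by (auto intro!: derivative_eq_intros simp: field_simps)
    then show "((\<lambda>u. A * ln (b + R * u) + B * R * u) has_vector_derivative (A / (b + R * u) + B) * R) (at u within {0..1})"
      by (simp add: has_real_derivative_iff_has_vector_derivative)
  qed simp
  have "norm I = norm (integral {0..1} (\<lambda>u. h (Complex x (u * y)) * (Complex x y - Complex x 0)))"
    by (simp only: integral_unique[OF hi])
  also have "\<dots> \<le> integral {0..1} (\<lambda>u. (A / (b + R * u) + B) * R)"
  proof (rule integral_norm_bound_integral)
    show "(\<lambda>u. h (Complex x (u * y)) * (Complex x y - Complex x 0)) integrable_on {0..1}" using hi by blast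
    show "(\<lambda>u. (A / (b + R * u) + B) * R) integrable_on {0..1}" using gi by blast
    fix u :: real assume u: "u \<in> {0..1}"
    have uy: "\<bar>u * y\<bar> = R * u" using u by (simp add: abs_mult R_def)
    have "R * u \<le> R" using u R by (simp add: mult_left_le)
    then have "norm (h (Complex x (u * y))) \<le> A / (b + R * u) + B" using le[of "u * y"] uy by (simp add: R_def)
    moreover have "norm (Complex x y - Complex x 0) = R" by (simp add: R_def cmod_def)
    ultimately show "norm (h (Complex x (u * y)) * (Complex x y - Complex x 0)) \<le> (A / (b + R * u) + B) * R"
      unfolding norm_mult using R by (simp add: mult_right_mono)
  qed
  also have "\<dots> = A * ln (b + R) - A * ln b + B * R" using integral_unique[OF gi] by simp
  also have "A * ln (b + R) - A * ln b = A * ln (1 + R / b)"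
  proof -
    have "1 + R / b = (b + R) / b" using b by (simp add: field_simps)
    then show ?thesis using b R by (simp add: ln_div right_diff_distrib)
  qed
  finally show ?thesis by (simp add: R_def)
qed

text \<open>The return path \<gamma> is left free so that one formula serves both the rectangle used
  for F and the left half-circle used for the partial sum. The winding number comes from primitives
  of 1/z, namely Ln z on the right and Ln(-z) on the left, each contributing i pi.\<close>

lemma cauchy_formula_right_arc:
  assumes S: "convex S" "open S" "0 \<in> S" and H: "H holomorphic_on S" and R: "R > 0"
    and \<gamma>: "valid_path \<gamma>" "pathstart \<gamma> = \<i> * of_real R" "pathfinish \<gamma> = - \<i> * of_real R"
      "path_image \<gamma> \<subseteq> S" "\<And>z. z \<in> path_image \<gamma> \<Longrightarrow> Re z \<le> 0 \<and> z \<noteq> 0"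
    and arc: "path_image (part_circlepath 0 R (-pi/2) (pi/2)) \<subseteq> S"
  shows "((\<lambda>z. H z / z) has_contour_integral (2 * pi * \<i> * H 0 -
            contour_integral \<gamma> (\<lambda>z. H z / z))) (part_circlepath 0 R (-pi/2) (pi/2))"
proof -
  define \<rho> where "\<rho> = part_circlepath 0 R (-pi/2) (pi/2)"
  have \<rho>: "valid_path \<rho>" "pathstart \<rho> = - \<i> * of_real R" "pathfinish \<rho> = \<i> * of_real R"
    by (simp_all add: \<rho>_def exp_eq_polar mult.commute) 
  have \<rho>im: "Re z \<ge> 0 \<and> z \<noteq> 0" if zin: "z \<in> path_image \<rho>" for z
  proof -
    obtain x where x: "z = of_real R * exp (\<i> * of_real x)" "-pi/2 \<le> x" "x \<le> pi/2"
      using zin by (auto simp: \<rho>_def path_image_part_circlepath)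
    then show ?thesis using cos_ge_zero[of x] R by (simp add: exp_eq_polar)
  qed
  have LnR: "Ln (\<i> * of_real R) - Ln (- \<i> * of_real R) = \<i> * of_real pi"
    using R Ln_times_of_real[of R \<i>] Ln_times_of_real[of R "-\<i>"] by (simp add: mult.commute)
  have i1: "((\<lambda>z. 1 / z) has_contour_integral \<i> * of_real pi) \<rho>"
  proof -
    have "((\<lambda>z. 1 / z) has_contour_integral (Ln (pathfinish \<rho>) - Ln (pathstart \<rho>))) \<rho>"
    proof (rule contour_integral_primitive[where S = "path_image \<rho>"])
      fix z assume "z \<in> path_image \<rho>"
      then have "z \<notin> \<real>\<^sub>\<le>\<^sub>0" using \<rho>im[of z] by (auto simp: complex_nonpos_Reals_iff complex_eq_iff)
      then show "(Ln has_field_derivative 1 / z) (at z within path_image \<rho>)"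
        by (auto intro!: derivative_eq_intros simp: divide_inverse)
    qed (use \<rho> in auto)
    then show ?thesis using LnR \<rho> by simp
  qed
  have i2: "((\<lambda>z. 1 / z) has_contour_integral \<i> * of_real pi) \<gamma>"
  proof -
    have "((\<lambda>z. 1 / z) has_contour_integral (Ln (- pathfinish \<gamma>) - Ln (- pathstart \<gamma>))) \<gamma>"
    proof (rule contour_integral_primitive[where S = "path_image \<gamma>" and f = "\<lambda>z. Ln (- z)"])
      fix z assume "z \<in> path_image \<gamma>"
      then have "- z \<notin> \<real>\<^sub>\<le>\<^sub>0" "z \<noteq> 0" using \<gamma>(5)[of z] by (auto simp: complex_nonpos_Reals_iff complex_eq_iff)
      then show "((\<lambda>z. Ln (- z)) has_field_derivative 1 / z) (at z within path_image \<gamma>)"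
        by (auto intro!: derivative_eq_intros simp: divide_inverse)
    qed (use \<gamma> in auto)
    then show ?thesis using LnR \<gamma> by simp
  qed
  \<comment> \<open>With the removable singularity filled in, Cauchy's theorem on the convex set
    disposes of this part and only H(0)/z remains.\<close>
  define \<phi> where "\<phi> = (\<lambda>z. if z = 0 then deriv H 0 else (H z - H 0) / (z - 0))"
  have \<phi>: "\<phi> holomorphic_on S" unfolding \<phi>_def by (rule pole_lemma_open[OF H S(2)])
  have cont: "\<phi> contour_integrable_on p" if "valid_path p" "path_image p \<subseteq> S" for p
    using contour_integrable_holomorphic_simple[OF \<phi> S(2) that] .
  have sub: "path_image \<rho> \<subseteq> S" using arc by (simp add: \<rho>_def)
  have z0: "(\<phi> has_contour_integral 0) (\<rho> +++ \<gamma>)"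
    by (rule Cauchy_theorem_convex_simple[OF \<phi> S(1)])
       (use \<rho> \<gamma> sub in \<open>auto simp: path_image_join valid_path_imp_path\<close>)
  have "(\<phi> has_contour_integral (contour_integral \<rho> \<phi> + contour_integral \<gamma> \<phi>)) (\<rho> +++ \<gamma>)"
    by (rule has_contour_integral_join)
       (use \<rho> \<gamma> sub cont in \<open>auto intro: has_contour_integral_integral\<close>)
  with z0 have sum0: "contour_integral \<rho> \<phi> + contour_integral \<gamma> \<phi> = 0"
    using contour_integral_unique by metis
  have dec: "((\<lambda>z. H z / z) has_contour_integral (contour_integral p \<phi> + H 0 * (\<i> * of_real pi))) p"
    if p: "valid_path p" "path_image p \<subseteq> S" "\<And>z. z \<in> path_image p \<Longrightarrow> z \<noteq> 0"
       "((\<lambda>z. 1 / z) has_contour_integral \<i> * of_real pi) p" for p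
  proof -
    have "((\<lambda>z. \<phi> z + H 0 * (1 / z)) has_contour_integral (contour_integral p \<phi> + H 0 * (\<i> * of_real pi))) p"
      by (intro has_contour_integral_add has_contour_integral_lmul p has_contour_integral_integral cont)
    then show ?thesis
      by (rule has_contour_integral_eq) (use p(3) in \<open>auto simp: \<phi>_def diff_divide_distrib\<close>)
  qed
  have d1: "((\<lambda>z. H z / z) has_contour_integral (contour_integral \<rho> \<phi> + H 0 * (\<i> * of_real pi))) \<rho>"
    by (rule dec) (use \<rho> sub \<rho>im i1 in auto)
  have d2: "((\<lambda>z. H z / z) has_contour_integral (contour_integral \<gamma> \<phi> + H 0 * (\<i> * of_real pi))) \<gamma>"
    by (rule dec) (use \<gamma> i2 in auto)
  have "contour_integral \<rho> \<phi> + H 0 * (\<i> * of_real pi) = 2 * pi * \<i> * H 0 - contour_integral \<gamma> (\<lambda>z. H z / z)"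
    unfolding contour_integral_unique[OF d2] using sum0 by (simp add: algebra_simps eq_neg_iff_add_eq_0)
  then show ?thesis using d1 unfolding \<rho>_def by (simp only:)
qed

text \<open>On the circle 1/z is the conjugate of z divided by R^2, so the kernel is 2 Re z / R^2.
  Its zeros at iR and -iR compensate the factor 1/|Re z| in the bounds for the tail and the partial
  sum.\<close>

lemma newman_kernel_circle:
  assumes "norm z = R" "R > 0"
  shows "norm (1 / z + z / of_real (R ^ 2)) = 2 * \<bar>Re z\<bar> / R ^ 2"
proof -
  have "z \<noteq> 0" using assms by auto
  then have "1 / z = cnj z / of_real (R ^ 2)"
    using assms complex_div_cnj[of 1 z] by simp
  then have "1 / z + z / of_real (R ^ 2) = of_real (2 * Re z) / of_real (R ^ 2)"
    using complex_add_cnj[of z] by (simp add: add_divide_distrib[symmetric] add.commute)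
  then show ?thesis by (simp only: of_real_divide[symmetric] norm_of_real) (simp add: abs_mult)
qed

text \<open>On the right arc the tail N^(-\<sigma>)/\<sigma> meets a kernel of size 2 \<sigma>
  N^\<sigma> / R^2, so the integrand is at most 2/R^2; on the left arc the partial sum similarly
  gives 4/R^2. Both arcs have length pi R, and division by 2 pi leaves 3/R. The horizontal sides
  account for M/R and the left side for the last term. Taking \<open>b < b'\<close> keeps the
  rectangle inside the region of holomorphy.\<close>

theorem newman_partial_sum_bound:
  fixes c :: "nat \<Rightarrow> complex" and F :: "complex \<Rightarrow> complex"
  assumes hol: "F holomorphic_on {s. Re s > - b'}" and b: "0 < b" "b < b'" "b \<le> 1/2"
    and c: "\<And>n. norm (c n) \<le> 1"
    and F: "\<And>s. Re s > 0 \<Longrightarrow> (\<lambda>n. c (Suc n) / of_nat (Suc n) powr (1 + s)) sums F s"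
    and M: "\<And>s. - b \<le> Re s \<Longrightarrow> Re s \<le> 0 \<Longrightarrow> \<bar>Im s\<bar> \<le> R \<Longrightarrow> norm (F s) \<le> M"
    and R: "1 \<le> R" "R \<le> real N"
  shows "norm (F 0 - (\<Sum>n=1..N. c n / of_nat n)) \<le> 3 / R + M / R + M * real N powr (- b) * (ln (1 + R / b) + 1)"
proof -
  have R0: "R > 0" and N: "N > 0" using R by auto
  have M0: "M \<ge> 0" using order_trans[OF norm_ge_zero M[of 0]] b R by simp
  define FN where "FN = (\<lambda>s. \<Sum>n=1..N. c n / of_nat n powr (1 + s))"
  \<comment> \<open>\<open>k\<close> is the kernel freed of its pole, entire with
    \<open>k 0 = 1\<close>, as the Cauchy formula requires; \<open>K\<close> is the kernel including
    the pole, in the form in which it is estimated.\<close>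
  define k where "k = (\<lambda>s::complex. of_nat N powr s * (1 + s ^ 2 / of_real (R ^ 2)))"
  define K where "K = (\<lambda>s::complex. of_nat N powr s * (1 / s + s / of_real (R ^ 2)))"
  let ?f = "\<lambda>z. F z * k z / z" and ?g = "\<lambda>z. FN z * k z / z"
  have kK: "k s / s = K s" if "s \<noteq> 0" for s using that R0
    by (simp add: k_def K_def field_simps power2_eq_square)
  have kK': "G * k s / s = G * K s" if "s \<noteq> 0" for G s using kK[OF that] by (metis times_divide_eq_right)
  have k0: "k 0 = 1" using N by (simp add: k_def)
  have khol: "k holomorphic_on S" for S unfolding k_def using N by (intro holomorphic_intros) auto
  have normK: "norm (K s) = real N powr Re s * norm (1 / s + s / of_real (R ^ 2))" for s
    unfolding K_def norm_mult using norm_of_nat_powr[OF N] by simp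
  define \<rho> where "\<rho> = part_circlepath 0 R (-pi/2) (pi/2)"
  define \<alpha> where "\<alpha> = part_circlepath 0 R (pi/2) (3*pi/2)"
  define p1 where "p1 = linepath (Complex 0 R) (Complex (-b) R)"
  \<comment> \<open>The left side is cut at the real axis because
    \<open>contour_integral_vertical_bound\<close> measures |t| from height 0.\<close>
  define p2 where "p2 = linepath (Complex (-b) R) (Complex (-b) 0)"
  define p3 where "p3 = linepath (Complex (-b) 0) (Complex (-b) (-R))"
  define p4 where "p4 = linepath (Complex (-b) (-R)) (Complex 0 (-R))"
  define \<beta> where "\<beta> = p1 +++ p2 +++ p3 +++ p4"
  have iR: "\<i> * of_real R = Complex 0 R" "- \<i> * of_real R = Complex 0 (-R)" by (simp_all add: complex_eq_iff)
  have \<rho>im: "norm z = R \<and> Re z \<ge> 0" if zin: "z \<in> path_image \<rho>" for z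
  proof -
    obtain x where x: "z = of_real R * exp (\<i> * of_real x)" "-pi/2 \<le> x" "x \<le> pi/2"
      using zin by (auto simp: \<rho>_def path_image_part_circlepath)
    then show ?thesis using cos_ge_zero[of x] R0 by (simp add: exp_eq_polar norm_mult)
  qed
  have \<alpha>im: "norm z = R \<and> Re z \<le> 0" if zin: "z \<in> path_image \<alpha>" for z
  proof -
    obtain x where x: "z = of_real R * exp (\<i> * of_real x)" "pi/2 \<le> x" "x \<le> 3*pi/2"
      using zin by (auto simp: \<alpha>_def path_image_part_circlepath)
    have "cos (x - pi) \<ge> 0" using x by (intro cos_ge_zero) auto
    then have "cos x \<le> 0" by (simp add: cos_diff)
    then show ?thesis using x R0 by (simp add: exp_eq_polar norm_mult mult_nonneg_nonpos)
  qed
  \<comment> \<open>The estimates on the arcs divide by Re z, so these two points are excluded; a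
    finite set does not affect the integral bounds.\<close>
  have edge: "norm z = R \<and> Re z = 0 \<longleftrightarrow> z \<in> {Complex 0 R, Complex 0 (-R)}" for z
  proof
    assume "norm z = R \<and> Re z = 0"
    then show "z \<in> {Complex 0 R, Complex 0 (-R)}" using cmod_power2[of z] R0 by (auto simp: complex_eq_iff power2_eq_iff)
  qed (use R0 in \<open>auto simp: cmod_def\<close>)
  have seg: "path_image p1 = (\<lambda>x. Complex x R) ` {-b..0}" "path_image p4 = (\<lambda>x. Complex x (-R)) ` {-b..0}"
    "path_image p2 = (\<lambda>y. Complex (-b) y) ` {0..R}" "path_image p3 = (\<lambda>y. Complex (-b) y) ` {-R..0}"
  proof -
    have h: "path_image (linepath (Complex x y) (Complex x' y)) = (\<lambda>u. Complex u y) ` closed_segment x x'" for x x' y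
      by (auto simp: closed_segment_def image_iff complex_eq_iff algebra_simps)
    have v: "path_image (linepath (Complex x y) (Complex x y')) = (\<lambda>u. Complex x u) ` closed_segment y y'" for x y y'
      by (auto simp: closed_segment_def image_iff complex_eq_iff algebra_simps)
    show "path_image p1 = (\<lambda>x. Complex x R) ` {-b..0}" "path_image p4 = (\<lambda>x. Complex x (-R)) ` {-b..0}"
      "path_image p2 = (\<lambda>y. Complex (-b) y) ` {0..R}" "path_image p3 = (\<lambda>y. Complex (-b) y) ` {-R..0}"
      unfolding p1_def p2_def p3_def p4_def h v using b R0 by (auto simp: closed_segment_eq_real_ivl)
  qed
  have \<beta>im: "path_image \<beta> = path_image p1 \<union> path_image p2 \<union> path_image p3 \<union> path_image p4"
    unfolding \<beta>_def by (simp add: path_image_join p1_def p2_def p3_def p4_def Un_assoc)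
  have \<beta>box: "- b \<le> Re z \<and> Re z \<le> 0 \<and> \<bar>Im z\<bar> \<le> R \<and> z \<noteq> 0" if "z \<in> path_image \<beta>" for z
    using that b R0 unfolding \<beta>im seg by (auto simp: complex_eq_iff)
  have \<beta>: "valid_path \<beta>" "pathstart \<beta> = \<i> * of_real R" "pathfinish \<beta> = - \<i> * of_real R"
    unfolding iR by (simp_all add: \<beta>_def p1_def p2_def p3_def p4_def)
  define H where "H = {s. Re s > - b'}"
  have Hb: "0 \<in> H" "path_image \<rho> \<subseteq> H" "path_image \<beta> \<subseteq> H"
    using b \<rho>im \<beta>box by (force simp: H_def)+
  have Hco: "convex H" "open H" unfolding H_def by (rule convex_halfspace_Re_gt open_halfspace_Re_gt)+
  have FK: "(\<lambda>s. F s * k s) holomorphic_on H" using hol unfolding H_def by (intro holomorphic_intros khol)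
  have e1: "(?f has_contour_integral (2 * pi * \<i> * (F 0 * k 0) -
            contour_integral \<beta> ?f)) \<rho>"
    unfolding \<rho>_def
    by (rule cauchy_formula_right_arc[OF Hco Hb(1) FK R0 \<beta> Hb(3)]) (use \<beta>box Hb in \<open>auto simp: \<rho>_def\<close>)
  have FNhol: "FN holomorphic_on S" for S unfolding FN_def
    by (intro holomorphic_intros) auto
  have \<alpha>p: "valid_path \<alpha>" "pathstart \<alpha> = \<i> * of_real R" "pathfinish \<alpha> = - \<i> * of_real R"
  proof -
    have E: "exp (\<i> * complex_of_real (pi/2)) = \<i>" using cis_conv_exp[of "pi/2"] by simp
    have "cis (pi + pi/2) = - \<i>" using cis_mult[of pi "pi/2"] by simp
    moreover have "pi + pi/2 = 3*pi/2" by simp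
    ultimately have E': "exp (\<i> * complex_of_real (3*pi/2)) = - \<i>" using cis_conv_exp[of "3*pi/2"] by metis
    show "valid_path \<alpha>" by (simp add: \<alpha>_def)
    show "pathstart \<alpha> = \<i> * of_real R" unfolding \<alpha>_def pathstart_part_circlepath E by simp
    show "pathfinish \<alpha> = - \<i> * of_real R" unfolding \<alpha>_def pathfinish_part_circlepath E' by simp
  qed
  have \<alpha>0: "Re z \<le> 0 \<and> z \<noteq> 0" if "z \<in> path_image \<alpha>" for z using \<alpha>im[OF that] R0 by auto
  have FNk: "(\<lambda>s. FN s * k s) holomorphic_on UNIV" by (intro holomorphic_intros FNhol khol)
  have e2: "(?g has_contour_integral (2 * pi * \<i> * (FN 0 * k 0) -
            contour_integral \<alpha> ?g)) \<rho>"
    unfolding \<rho>_def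
    by (rule cauchy_formula_right_arc[OF convex_UNIV open_UNIV UNIV_I FNk R0 \<alpha>p])
       (use \<alpha>0 in auto)
  have e3: "((\<lambda>z. F z * k z / z - FN z * k z / z) has_contour_integral
     (2 * pi * \<i> * (F 0 * k 0) - contour_integral \<beta> ?f
        - (2 * pi * \<i> * (FN 0 * k 0) - contour_integral \<alpha> ?g))) \<rho>"
    by (rule has_contour_integral_diff[OF e1 e2])
  define I1 where "I1 = 2 * pi * \<i> * (F 0 * k 0) - contour_integral \<beta> ?f
        - (2 * pi * \<i> * (FN 0 * k 0) - contour_integral \<alpha> ?g)"
  have I1: "norm I1 \<le> 2 / R ^ 2 * R * (pi/2 - (-pi/2))"
  proof (rule has_contour_integral_bound_part_circlepath_strong[of _ _ 0 R "-pi/2" "pi/2" "{Complex 0 R, Complex 0 (-R)}"])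
    show "((\<lambda>z. F z * k z / z - FN z * k z / z) has_contour_integral I1) (part_circlepath 0 R (-pi/2) (pi/2))"
      using e3 by (simp only: I1_def \<rho>_def)
    fix z assume "z \<in> path_image (part_circlepath 0 R (-pi/2) (pi/2)) - {Complex 0 R, Complex 0 (-R)}"
    then have z: "norm z = R" "Re z > 0" using \<rho>im[of z] edge[of z] by (auto simp: \<rho>_def less_le)
    define \<sigma> where "\<sigma> = Re z"
    have \<sigma>: "\<sigma> > 0" using z by (simp add: \<sigma>_def)
    have "norm (F z - FN z) \<le> real N powr (- \<sigma>) / \<sigma>"
    proof -
      have sm: "summable (\<lambda>n. real (Suc (n + N)) powr (- \<sigma> - 1))" by (rule sums_powr_tail(1)[OF \<sigma> N])
      have le: "norm (c (Suc (n + N)) / of_nat (Suc (n + N)) powr (1 + z)) \<le> real (Suc (n + N)) powr (- \<sigma> - 1)" for n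
      proof -
        have "norm (c (Suc (n + N)) / of_nat (Suc (n + N)) powr (1 + z)) = norm (c (Suc (n + N))) * real (Suc (n + N)) powr (- \<sigma> - 1)"
          unfolding norm_divide norm_of_nat_powr[OF zero_less_Suc] by (simp add: \<sigma>_def powr_minus divide_inverse powr_add powr_diff)
        also have "\<dots> \<le> 1 * real (Suc (n + N)) powr (- \<sigma> - 1)" by (intro mult_right_mono c) auto
        finally show ?thesis by simp
      qed
      have smn: "summable (\<lambda>n. norm (c (Suc (n + N)) / of_nat (Suc (n + N)) powr (1 + z)))"
        by (rule summable_comparison_test'[OF sm, of 0]) (use le in auto)
      have "FN z = (\<Sum>n<N. c (Suc n) / of_nat (Suc n) powr (1 + z))"
        unfolding FN_def by (rule sum.reindex_bij_witness[of _ Suc "\<lambda>n. n - 1"]) auto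
      then have "F z - FN z = (\<Sum>n. c (Suc (n + N)) / of_nat (Suc (n + N)) powr (1 + z))"
        using F[OF z(2)] suminf_minus_initial_segment[of "\<lambda>n. c (Suc n) / of_nat (Suc n) powr (1 + z)" N]
        by (simp add: sums_iff)
      also have "norm \<dots> \<le> (\<Sum>n. norm (c (Suc (n + N)) / of_nat (Suc (n + N)) powr (1 + z)))" by (rule summable_norm[OF smn])
      also have "\<dots> \<le> (\<Sum>n. real (Suc (n + N)) powr (- \<sigma> - 1))" by (rule suminf_le[OF le smn sm])
      also have "\<dots> \<le> real N powr (- \<sigma>) / \<sigma>" by (rule sums_powr_tail(2)[OF \<sigma> N])
      finally show ?thesis .
    qed
    then have "norm ((F z - FN z) * K z) \<le> real N powr (- \<sigma>) / \<sigma> * (real N powr \<sigma> * (2 * \<sigma> / R ^ 2))"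
      unfolding norm_mult normK newman_kernel_circle[OF z(1) R0] using z \<sigma>
      by (intro mult_mono) (auto simp: \<sigma>_def)
    also have "\<dots> = 2 / R ^ 2" using \<sigma> N by (simp add: powr_minus field_simps)
    finally have "norm ((F z - FN z) * K z) \<le> 2 / R ^ 2" .
    then show "norm (F z * k z / z - FN z * k z / z) \<le> 2 / R ^ 2"
    proof -
      assume bd: "norm ((F z - FN z) * K z) \<le> 2 / R ^ 2"
      have z0: "z \<noteq> 0" using z by auto
      show ?thesis using bd by (simp only: kK'[OF z0] left_diff_distrib)
    qed
  qed (use R0 in auto)
  have I2: "norm (contour_integral \<alpha> ?g) \<le> 4 / R ^ 2 * R * (3*pi/2 - pi/2)"
    unfolding \<alpha>_def
  proof (rule contour_integral_bound_part_circlepath_strong[where k = "{Complex 0 R, Complex 0 (-R)}"])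
    have "?g holomorphic_on - {0}" by (intro holomorphic_intros FNhol khol) auto
    then show "?g contour_integrable_on part_circlepath 0 R (pi/2) (3*pi/2)"
      by (rule contour_integrable_holomorphic_simple) (use \<alpha>0 in \<open>auto simp: \<alpha>_def\<close>)
    fix z assume "z \<in> path_image (part_circlepath 0 R (pi/2) (3*pi/2)) - {Complex 0 R, Complex 0 (-R)}"
    then have z: "norm z = R" "Re z < 0" using \<alpha>im[of z] edge[of z] by (auto simp: \<alpha>_def less_le)
    define a where "a = - Re z"
    have a: "a > 0" "a \<le> R" using z abs_Re_le_cmod[of z] by (auto simp: a_def)
    have "norm (FN z) \<le> (\<Sum>n=1..N. norm (c n / of_nat n powr (1 + z)))" unfolding FN_def by (rule norm_sum)
    also have "\<dots> \<le> (\<Sum>n=1..N. real n powr (a - 1))"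
    proof (rule sum_mono)
      fix n assume "n \<in> {1..N}"
      then have n: "n > 0" by simp
      have "norm (c n / of_nat n powr (1 + z)) = norm (c n) * real n powr (a - 1)"
        unfolding norm_divide norm_of_nat_powr[OF n] using n by (simp add: a_def divide_inverse powr_minus[symmetric] minus_diff_commute)
      also have "\<dots> \<le> 1 * real n powr (a - 1)" by (intro mult_right_mono c) auto
      finally show "norm (c n / of_nat n powr (1 + z)) \<le> real n powr (a - 1)" by simp
    qed
    also have "\<dots> \<le> real N powr a / a + real N powr (a - 1)" by (rule sum_powr_le[OF a(1) N])
    also have "\<dots> = real N powr a * (1 / a + 1 / real N)" using N by (simp add: powr_diff field_simps)
    finally have FNa: "norm (FN z) \<le> real N powr a * (1 / a + 1 / real N)" .
    have Ka: "norm (K z) = real N powr (-a) * (2 * a / R ^ 2)"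
      unfolding normK newman_kernel_circle[OF z(1) R0] using z by (simp add: a_def)
    have "norm (FN z * K z) \<le> real N powr a * (1 / a + 1 / real N) * (real N powr (-a) * (2 * a / R ^ 2))"
      unfolding norm_mult Ka by (intro mult_right_mono FNa) (use a in auto)
    also have "\<dots> = (1 / a + 1 / real N) * (2 * a / R ^ 2)"
    proof -
      have 1: "real N powr a * real N powr (-a) = 1" using N by (simp flip: powr_add)
      have "X * u * (Y * v) = u * v" if "X * Y = 1" for X Y u v :: real
        using that by (metis mult.assoc mult.commute mult_1)
      from this[OF 1] show ?thesis .
    qed
    \<comment> \<open>Here \<open>R \<le> real N\<close> enters: a <= R <= N makes 1/N at most
      1/a.\<close>
    also have "\<dots> \<le> (1 / a + 1 / a) * (2 * a / R ^ 2)"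
      using a R by (intro mult_right_mono add_left_mono divide_left_mono) auto
    also have "\<dots> = 4 / R ^ 2" using a by simp
    finally have bd: "norm (FN z * K z) \<le> 4 / R ^ 2" .
    have z0: "z \<noteq> 0" using z by auto
    show "norm (FN z * k z / z) \<le> 4 / R ^ 2" using bd by (simp only: kK'[OF z0])
  qed (use R0 in auto)
  have Kbox: "norm (1 / s + s / of_real (R ^ 2)) \<le> 1 / norm s + 2 / R" if "- b \<le> Re s" "Re s \<le> 0" "\<bar>Im s\<bar> \<le> R" for s
  proof -
    have "norm (1 / s + s / of_real (R ^ 2)) \<le> norm (1 / s) + norm (s / of_real (R ^ 2))" by (rule norm_triangle_ineq)
    also have "norm (s / of_real (R ^ 2)) = norm s / R ^ 2" unfolding norm_divide norm_of_real using R0 by simp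
    also have "norm s / R ^ 2 \<le> (2 * R) / R ^ 2"
      using cmod_le[of s] that b R by (intro divide_right_mono) auto
    also have "(2 * R) / R ^ 2 = 2 / R" using R0 by (simp add: power2_eq_square)
    finally show ?thesis by (simp add: norm_divide)
  qed
  have FKint: "?f contour_integrable_on p" if "valid_path p" "path_image p \<subseteq> path_image \<beta>" for p
  proof (rule contour_integrable_holomorphic_simple)
    show "?f holomorphic_on H - {0}"
      by (intro holomorphic_intros holomorphic_on_subset[OF FK]) auto
    show "open (H - {0})" using Hco by auto
    have "0 \<notin> path_image \<beta>" using \<beta>box[of 0] by blast
    then show "path_image p \<subseteq> H - {0}" using that(2) Hb(3) by blast
  qed (use that in auto)
  have int: "(?f has_contour_integral (contour_integral p ?f)) p"
    if "p \<in> {p1, p2, p3, p4}" for p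
    using that by (intro has_contour_integral_integral FKint) (auto simp: \<beta>im p1_def p2_def p3_def p4_def)
  have \<beta>int: "contour_integral \<beta> ?f = contour_integral p1 ?f + (contour_integral p2 ?f
      + (contour_integral p3 ?f + contour_integral p4 ?f))"
    unfolding \<beta>_def
    by (intro contour_integral_unique has_contour_integral_join int) (auto simp: p1_def p2_def p3_def p4_def)
  have hor: "norm (F z * k z / z) \<le> M * (3 / R)" if z: "- b \<le> Re z" "Re z \<le> 0" "\<bar>Im z\<bar> = R" for z
  proof -
    have "z \<noteq> 0" using z R0 by auto
    have "norm (K z) \<le> 1 * (1 / norm z + 2 / R)"
    proof -
      have "real N powr Re z \<le> real N powr 0" using z N by (intro powr_mono) auto
      then show ?thesis unfolding normK using Kbox[of z] z N by (intro mult_mono) auto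
    qed
    also have "1 / norm z \<le> 1 / R" using abs_Im_le_cmod[of z] z R0 by (intro frac_le) auto
    finally have "norm (K z) \<le> 3 / R" by (simp add: add_divide_distrib[symmetric])
    then have "norm (F z * K z) \<le> M * (3 / R)"
      unfolding norm_mult using M[of z] z M0 by (intro mult_mono) auto
    then show ?thesis by (simp only: kK'[OF \<open>z \<noteq> 0\<close>])
  qed
  have hint: "norm (contour_integral p ?f) \<le> M * (3 / R) * b"
    if p: "p = linepath z w" "p \<in> {p1, p4}" and zw: "norm (w - z) = b" for p z w
  proof -
    have "norm (contour_integral p ?f) \<le> M * (3 / R) * norm (w - z)"
    proof (rule has_contour_integral_bound_linepath)
      show "(?f has_contour_integral (contour_integral p ?f)) (linepath z w)"
        using int[of p] p by auto
      fix x assume "x \<in> closed_segment z w"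
      then have "x \<in> path_image p1 \<union> path_image p4" using p by auto
      then have "- b \<le> Re x \<and> Re x \<le> 0 \<and> \<bar>Im x\<bar> = R" unfolding seg using b R0 by auto
      then show "norm (?f x) \<le> M * (3 / R)" using hor[of x] by blast
    qed (use M0 R0 in auto)
    then show ?thesis by (simp only: zw)
  qed
  define A where "A = 2 * M * real N powr (- b)"
  have A0: "A \<ge> 0" using M0 by (simp add: A_def)
  have ver: "norm (F (Complex (-b) t) * k (Complex (-b) t) / Complex (-b) t) \<le> A / (b + \<bar>t\<bar>) + A / R" if t: "\<bar>t\<bar> \<le> R" for t
  proof -
    let ?z = "Complex (-b) t"
    have z0: "?z \<noteq> 0" using b by (auto simp: complex_eq_iff)
    \<comment> \<open>Both summands are at most |z|; this trades |z| for a quantity with an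
      elementary integral.\<close>
    have "(b + \<bar>t\<bar>) \<le> 2 * norm ?z" using abs_Re_le_cmod[of ?z] abs_Im_le_cmod[of ?z] b by simp
    then have "1 / norm ?z \<le> 2 / (b + \<bar>t\<bar>)" using z0 b by (simp add: field_simps)
    then have "norm (K ?z) \<le> real N powr (- b) * (2 / (b + \<bar>t\<bar>) + 2 / R)"
      unfolding normK using Kbox[of ?z] t b by (intro mult_mono) auto
    then have "norm (F ?z * K ?z) \<le> M * (real N powr (- b) * (2 / (b + \<bar>t\<bar>) + 2 / R))"
      unfolding norm_mult using M[of ?z] t b M0 by (intro mult_mono) auto
    also have "\<dots> = A / (b + \<bar>t\<bar>) + A / R" by (simp add: A_def distrib_left mult_ac)
    finally show ?thesis by (simp only: kK'[OF z0])
  qed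
  have I5: "norm (contour_integral p3 ?f) \<le> A * ln (1 + R / b) + A / R * R"
    using contour_integral_vertical_bound[OF int[of p3, unfolded p3_def] b(1) A0, of "A / R"] ver R0
    by (simp add: p3_def)
  have I4: "norm (contour_integral p2 ?f) \<le> A * ln (1 + R / b) + A / R * R"
  proof -
    have "(?f has_contour_integral (- contour_integral p2 ?f)) (linepath (Complex (-b) 0) (Complex (-b) R))"
      using has_contour_integral_reversepath[OF _ int[of p2]] by (simp add: p2_def)
    from contour_integral_vertical_bound[OF this b(1) A0, of "A / R"] ver R0 show ?thesis by simp
  qed
  have I3: "norm (contour_integral p1 ?f) \<le> M * (3 / R) * b" 
    by (rule hint[OF p1_def]) (use b in \<open>auto simp: cmod_def\<close>)
  have I6: "norm (contour_integral p4 ?f) \<le> M * (3 / R) * b" 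
    by (rule hint[OF p4_def]) (use b in \<open>auto simp: cmod_def\<close>)
  have "2 * pi * \<i> * (F 0 - FN 0) = I1 + contour_integral \<beta> ?f - contour_integral \<alpha> ?g"
    by (simp add: I1_def k0 algebra_simps)
  then have "norm (2 * pi * \<i> * (F 0 - FN 0)) \<le> norm I1 + norm (contour_integral \<beta> ?f) + norm (contour_integral \<alpha> ?g)"
    by (simp only: order_trans[OF norm_triangle_ineq4 add_right_mono[OF norm_triangle_ineq]])
  also have "norm (contour_integral \<beta> ?f) \<le> M * (3 / R) * b + (A * ln (1 + R / b) + A / R * R + (A * ln (1 + R / b) + A / R * R + M * (3 / R) * b))"
    unfolding \<beta>int by (intro norm_triangle_mono I3 I4 I5 I6)
  finally have "2 * pi * norm (F 0 - FN 0) \<le> 2 / R ^ 2 * R * (pi/2 - (-pi/2)) +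
     (M * (3 / R) * b + (A * ln (1 + R / b) + A / R * R + (A * ln (1 + R / b) + A / R * R + M * (3 / R) * b)))
     + 4 / R ^ 2 * R * (3*pi/2 - pi/2)"
    using I1 I2 by (simp add: norm_mult)
  also have "\<dots> = 6 * pi / R + 6 * b * (M / R) + 2 * (A * (ln (1 + R / b) + 1))"
    using R0 by (simp add: power2_eq_square field_simps)
  \<comment> \<open>By \<open>b \<le> 1/2\<close>, 6b <= 3 < 2 pi; together with 2 < pi this brings
    all terms under the common factor 2 pi.\<close>
  also have "\<dots> \<le> 6 * pi / R + 2 * pi * (M / R) + pi * (A * (ln (1 + R / b) + 1))"
  proof (intro add_mono mult_right_mono)
    show "6 * b \<le> 2 * pi" "2 \<le> pi" using b pi_gt3 by auto
    show "0 \<le> A * (ln (1 + R / b) + 1)" using A0 R0 b by (intro mult_nonneg_nonneg add_nonneg_nonneg ln_ge_zero) auto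
  qed (use M0 R0 in auto)
  also have "\<dots> = 2 * pi * (3 / R + M / R + M * real N powr (- b) * (ln (1 + R / b) + 1))"
    by (simp add: A_def algebra_simps)
  finally have "norm (F 0 - FN 0) \<le> 3 / R + M / R + M * real N powr (- b) * (ln (1 + R / b) + 1)"
    by (simp only: mult_le_cancel_left_pos mult_pos_pos pi_gt_zero zero_less_numeral)
  then show ?thesis by (simp add: FN_def)
qed

subsection \<open>The bound for the argument\<close>

text \<open>1 - z lies in the disc of radius 1/x about 1, and the right side is the angle of the
  tangents from 0 to that disc.\<close>

lemma Im_Ln_one_minus_bound:
  fixes x :: real
  assumes z: "norm z \<le> 1 / x" and x: "x > 1"
  shows "\<bar>Im (Ln (1 - z))\<bar> \<le> arctan (1 / sqrt (x ^ 2 - 1))"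
proof -
  define r where "r = 1 / x"
  define u v where "u = Re z" and "v = Im z"
  have r: "0 < r" "r < 1" using x by (auto simp: r_def)
  have uv: "u ^ 2 + v ^ 2 \<le> r ^ 2"
    using power_mono[OF z norm_ge_zero, of 2] by (simp add: u_def v_def r_def cmod_power2)
  have "u ^ 2 \<le> r ^ 2" using uv zero_le_power2[of v] by linarith
  then have "\<bar>u\<bar> \<le> r" using r by (simp add: abs_le_square_iff[symmetric])
  then have u1: "1 - u > 0" using r by linarith
  have r2: "1 - r ^ 2 > 0" using r by (simp add: power_less_one_iff)
  have Re: "Re (1 - z) > 0" using u1 by (simp add: u_def)
  have "Im (Ln (1 - z)) = arctan (Im (1 - z) / Re (1 - z))"
    using Arg_eq_Im_Ln[of "1 - z"] arg_conv_arctan[OF Re] Re by force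
  then have "\<bar>Im (Ln (1 - z))\<bar> = \<bar>arctan (- v / (1 - u))\<bar>" by (simp add: u_def v_def)
  also have "\<dots> = arctan (\<bar>v\<bar> / (1 - u))"
  proof -
    have "\<bar>arctan y\<bar> = arctan \<bar>y\<bar>" for y by (cases "y \<ge> 0") (auto simp: abs_if arctan_minus)
    then show ?thesis using u1 by (simp add: abs_divide)
  qed
  also have "\<dots> \<le> arctan (1 / sqrt (x ^ 2 - 1))"
  proof (rule arctan_monotone')
    have "v ^ 2 * (1 - r ^ 2) \<le> (r ^ 2 - u ^ 2) * (1 - r ^ 2)"
      using uv r2 by (intro mult_right_mono) auto
    \<comment> \<open>The square about to be dropped vanishes at the points of tangency, where u =
      r^2.\<close>
    also have "\<dots> = r ^ 2 * (1 - u) ^ 2 - (r ^ 2 - u) ^ 2"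
      by (simp add: power2_eq_square algebra_simps)
    also have "\<dots> \<le> r ^ 2 * (1 - u) ^ 2" by simp
    finally have "v ^ 2 / (1 - u) ^ 2 \<le> r ^ 2 / (1 - r ^ 2)"
      using u1 r2 by (simp add: field_simps)
    also have "r ^ 2 / (1 - r ^ 2) = 1 / (x ^ 2 - 1)" using x r2 by (simp add: r_def field_simps)
    finally have "sqrt (v ^ 2 / (1 - u) ^ 2) \<le> sqrt (1 / (x ^ 2 - 1))" by (rule real_sqrt_le_mono)
    then show "\<bar>v\<bar> / (1 - u) \<le> 1 / sqrt (x ^ 2 - 1)" using u1 by (simp add: real_sqrt_divide)
  qed
  finally show ?thesis .
qed

text \<open>All parameters stay free here; \<delta> is the distance kept from the critical line. In
  the lower bound for \<open>M\<close>, 2/\<delta> pays for the prime powers that are subtracted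
  from log L to obtain \<open>F\<close>, and 4/N is their tail beyond N. Nothing on the right
  depends on chi.\<close>

lemma arg_Dirichlet_L_le:
  fixes q N :: nat
  assumes "GRH" and chi: "dirichlet_character q chi" and np: "chi \<noteq> principal_character q"
    and \<delta>: "0 < \<delta>" "\<delta> < 1/2" and R: "1 \<le> R" "R \<le> real N"
    and M: "3 + 6 / \<delta> * (ln (3 * real q * (R + 4)) + 4) + 2 / \<delta> \<le> M"
  shows "\<bar>arg_from_infinity (Dirichlet_L q chi) 1\<bar> \<le>
    (\<Sum>p | prime p \<and> p \<le> N. arctan (1 / sqrt (real p ^ 2 - 1)))
    + (3 / R + M / R + M * real N powr (- (1/2 - \<delta>)) * (ln (1 + R / (1/2 - \<delta>)) + 1)) + 4 / real N"
proof -
  let ?S = "\<Sum>p | prime p \<and> p \<le> N. arctan (1 / sqrt (real p ^ 2 - 1))"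
  obtain G where G: "G holomorphic_on {s. Re s > 1/2}"
    "\<And>s. Re s > 1/2 \<Longrightarrow> Dirichlet_L q chi s = exp (G s)"
    "\<And>s. Re s > 1 \<Longrightarrow> G s = prime_series chi s + prime_power_series chi s"
    using log_Dirichlet_L[OF \<open>GRH\<close> chi np] by metis
  have q: "q > 0" by (rule dirichlet_character_pos[OF chi])
  have N: "N > 0" using R by auto
  define c where "c = (\<lambda>n. if prime n then chi n else 0)"
  define F where "F = (\<lambda>s. G (1 + s) - prime_power_series chi (1 + s))"
  define err where "err = 3 / R + M / R + M * real N powr (- (1/2 - \<delta>)) * (ln (1 + R / (1/2 - \<delta>)) + 1)"
  have F0: "norm (F 0 - (\<Sum>n=1..N. c n / of_nat n)) \<le> err"
    unfolding err_def
  proof (rule newman_partial_sum_bound[where b' = "1/2"])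
    show "F holomorphic_on {s. Re s > - (1/2)}"
      unfolding F_def
      by (intro holomorphic_intros holomorphic_on_compose_gen[OF _ G(1), unfolded o_def]
            holomorphic_on_compose_gen[OF _ holomorphic_prime_power_series[OF chi], unfolded o_def]) auto
    show "norm (c n) \<le> 1" for n using norm_dirichlet_character_le[OF chi] by (simp add: c_def)
    show "(\<lambda>n. c (Suc n) / of_nat (Suc n) powr (1 + s)) sums F s" if s: "Re s > 0" for s
    proof -
      define f where "f = (\<lambda>n. if prime n then chi n / of_nat n powr (1 + s) else 0)"
      have "summable f"
        unfolding f_def using summable_norm_cancel[OF summable_prime_series[OF chi, of "1 + s"]] s by simp
      then have "f sums prime_series chi (1 + s)" unfolding prime_series_def f_def by (rule summable_sums)
      then have "(\<lambda>n. f (Suc n)) sums (prime_series chi (1 + s) - f 0)" by (simp add: sums_Suc_iff)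
      moreover have "f 0 = 0" by (simp add: f_def)
      moreover have "f (Suc n) = c (Suc n) / of_nat (Suc n) powr (1 + s)" for n by (simp add: f_def c_def)
      moreover have "F s = prime_series chi (1 + s)" using G(3)[of "1 + s"] s by (simp add: F_def)
      ultimately show ?thesis by simp
    qed
    show "norm (F s) \<le> M" if s: "- (1/2 - \<delta>) \<le> Re s" "Re s \<le> 0" "\<bar>Im s\<bar> \<le> R" for s
    proof -
      have "norm (F s) \<le> norm (G (1 + s)) + norm (prime_power_series chi (1 + s))"
        unfolding F_def by (rule norm_triangle_ineq4)
      also have "norm (G (1 + s)) \<le> 3 + 6 / \<delta> * (ln (3 * real q * (\<bar>Im (1 + s)\<bar> + 4)) + 4)"
        by (rule log_Dirichlet_L_bound[OF chi np G \<delta>]) (use s in auto)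
      also have "\<dots> \<le> 3 + 6 / \<delta> * (ln (3 * real q * (R + 4)) + 4)"
        using s q \<delta> by (intro add_left_mono mult_left_mono add_right_mono ln_mono mult_pos_pos add_nonneg_pos) auto
      also have "norm (prime_power_series chi (1 + s)) \<le> 4 / (2 * Re (1 + s) - 1)"
        by (rule norm_prime_power_series_le[OF chi]) (use s \<delta> in auto)
      also have "\<dots> \<le> 4 / (2 * \<delta>)" using s \<delta> by (intro divide_left_mono mult_pos_pos) auto
      finally show ?thesis using M by simp
    qed
  qed (use \<delta> R in auto)
  \<comment> \<open>Adding back the higher powers of the primes up to N turns the truncated prime
    sum into the logarithm of a truncated Euler product, whose factors have individually bounded
    arguments.\<close>
  define P where "P = (\<Sum>p | prime p \<and> p \<le> N. - Ln (1 - chi p / of_nat p))"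
  have P: "P = (\<Sum>n=1..N. c n / of_nat n) + (\<Sum>n\<le>N. prime_power_term chi 1 n)"
  proof -
    have "(\<Sum>n=1..N. c n / of_nat n) = (\<Sum>p | prime p \<and> p \<le> N. chi p / of_nat p)"
      by (rule sum.mono_neutral_cong_right) (auto simp: c_def prime_gt_0_nat Suc_le_eq)
    moreover have "(\<Sum>n\<le>N. prime_power_term chi 1 n) = (\<Sum>p | prime p \<and> p \<le> N. - Ln (1 - chi p / of_nat p) - chi p / of_nat p)"
      by (rule sum.mono_neutral_cong_right) (auto simp: prime_power_term_def)
    ultimately show ?thesis by (simp add: P_def sum.distrib[symmetric])
  qed
  have "norm (G 1 - P) \<le> err + 4 / real N"
  proof -
    have "G 1 - P = (F 0 - (\<Sum>n=1..N. c n / of_nat n)) + (prime_power_series chi 1 - (\<Sum>n\<le>N. prime_power_term chi 1 n))"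
      by (simp add: P F_def)
    also have "norm \<dots> \<le> err + 4 / real N"
      by (intro norm_triangle_mono F0 prime_power_series_tail[OF chi N])
    finally show ?thesis .
  qed
  then have "\<bar>Im (G 1) - Im P\<bar> \<le> err + 4 / real N"
    using abs_Im_le_cmod[of "G 1 - P"] by simp
  moreover have "\<bar>Im P\<bar> \<le> ?S"
  proof -
    have "\<bar>Im P\<bar> \<le> (\<Sum>p | prime p \<and> p \<le> N. \<bar>Im (- Ln (1 - chi p / of_nat p))\<bar>)"
      unfolding P_def Im_sum by (rule sum_abs)
    also have "\<dots> \<le> ?S"
    proof (rule sum_mono)
      fix p assume "p \<in> {p. prime p \<and> p \<le> N}"
      then have p: "real p > 1" by (auto dest: prime_gt_1_nat)
      have "norm (chi p / of_nat p) \<le> 1 / real p"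
        using norm_dirichlet_character_le[OF chi, of p] by (simp add: norm_divide divide_right_mono)
      from Im_Ln_one_minus_bound[OF this p]
      show "\<bar>Im (- Ln (1 - chi p / of_nat p))\<bar> \<le> arctan (1 / sqrt (real p ^ 2 - 1))" by simp
    qed
    finally show ?thesis .
  qed
  ultimately have "\<bar>Im (G 1)\<bar> \<le> ?S + err + 4 / real N"
    by linarith
  moreover have "arg_from_infinity (Dirichlet_L q chi) 1 = Im (G 1)"
    by (rule arg_from_infinity_eq[OF chi np G])
  ultimately show ?thesis by (simp only: err_def)
qed

text \<open>The allowance e is split evenly: one half for replacing ln(2 + \<epsilon>) by ln 2, the
  other for the analytic error and the remainder in the limit defining \<open>C2\<close>. The
  threshold for q is the same for all chi because the bound used is.\<close>

lemma arg_Dirichlet_L_eventually_le: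
  assumes "GRH" and e: "e > 0"
  shows "eventually (\<lambda>q. \<forall>chi. dirichlet_character q chi \<longrightarrow> chi \<noteq> principal_character q \<longrightarrow>
     \<bar>arg_from_infinity (Dirichlet_L q chi) 1\<bar> \<le> ln (ln (ln (real q))) + C2 + ln 2 + e) sequentially"
proof -
  define \<epsilon> where "\<epsilon> = min 1 e"
  have \<epsilon>: "0 < \<epsilon>" "\<epsilon> \<le> 1" "\<epsilon> \<le> e" using e by (auto simp: \<epsilon>_def)
  \<comment> \<open>Chosen to make (2 + \<epsilon>)(1/2 - \<delta>) = 1 + \<epsilon>/4, so that
    N^(-b) beats the size ln q of \<open>M\<close> by the factor (ln q)^(-\<epsilon>/4).\<close>
  define \<delta> where "\<delta> = \<epsilon> / (4 * (2 + \<epsilon>))"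
  have \<delta>: "0 < \<delta>" "\<delta> \<le> 1/4" using \<epsilon> by (auto simp: \<delta>_def divide_le_eq)
  define b where "b = 1/2 - \<delta>"
  have b: "b \<ge> 1/4" "(2 + \<epsilon>) * b = 1 + \<epsilon> / 4"
    using \<delta> \<epsilon> by (auto simp: b_def \<delta>_def field_simps)
  \<comment> \<open>For t = ln q >= 3 one has 2t + 4 <= 6t, so the requirement on \<open>M\<close>
    is met by 3t + 36t/\<delta> + 2t/\<delta> = C t.\<close>
  define C where "C = 3 + 38 / \<delta>"
  have C: "C > 0" using \<delta> by (simp add: C_def add_pos_pos)
  define u where "u = (\<lambda>q::nat. ln (real q))"
  define N where "N = (\<lambda>q. nat \<lfloor>u q powr (2 + \<epsilon>)\<rfloor>)"
  define r where "r = (\<lambda>n. (\<Sum>p | prime p \<and> p \<le> n. arctan (1 / sqrt (real p ^ 2 - 1))) - ln (ln (real n)) - C2)"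
  have u_top: "filterlim u at_top sequentially" unfolding u_def by real_asymp
  have X_top: "filterlim (\<lambda>t::real. t powr (2 + \<epsilon>)) at_top at_top" using \<epsilon> by real_asymp
  have N_top: "filterlim N sequentially sequentially"
    unfolding N_def
    by (intro filterlim_compose[OF filterlim_nat_sequentially] filterlim_compose[OF filterlim_floor_sequentially]
          filterlim_compose[OF X_top u_top])
  have "r \<longlonglongrightarrow> 0" unfolding r_def using tendsto_diff[OF C2_tendsto tendsto_const[of C2]] by simp
  then have r0: "(\<lambda>q. r (N q)) \<longlonglongrightarrow> 0" using N_top by (rule filterlim_compose)
  \<comment> \<open>The error at t = ln q with R = t^2, M = C t and N at least half of
    t^(2+\<epsilon>). The halving explains 2^b and the 8, and b >= 1/4 explains 4 t^2.\<close>
  define err where "err = (\<lambda>t::real. 3 / t ^ 2 + C / t + C * 2 powr b * (t powr (- (\<epsilon> / 4)) * (ln (1 + 4 * t ^ 2) + 1)) + 8 * t powr (- (2 + \<epsilon>)))"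
  have "(err \<longlongrightarrow> 0 + 0 + C * 2 powr b * 0 + 8 * 0) at_top"
    unfolding err_def
  proof (intro tendsto_add tendsto_mult tendsto_const)
    show "((\<lambda>t::real. 3 / t ^ 2) \<longlongrightarrow> 0) at_top" by real_asymp
    show "((\<lambda>t::real. C / t) \<longlongrightarrow> 0) at_top" by real_asymp
    show "((\<lambda>t::real. t powr (- (\<epsilon> / 4)) * (ln (1 + 4 * t ^ 2) + 1)) \<longlongrightarrow> 0) at_top" using \<epsilon> by real_asymp
    show "((\<lambda>t::real. t powr (- (2 + \<epsilon>))) \<longlongrightarrow> 0) at_top" using \<epsilon> by real_asymp
  qed
  then have "(err \<longlongrightarrow> 0) at_top" by simp
  from filterlim_compose[OF this u_top] have "(\<lambda>q. err (u q)) \<longlonglongrightarrow> 0" .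
  from tendsto_add[OF this r0] have "(\<lambda>q. err (u q) + r (N q)) \<longlonglongrightarrow> 0" by simp
  then have ev1: "eventually (\<lambda>q. err (u q) + r (N q) < e / 2) sequentially"
    by (rule order_tendstoD) (use e in simp)
  have "eventually (\<lambda>t::real. ln (3 * (t ^ 2 + 4)) \<le> t) at_top" by real_asymp
  then have ev2: "eventually (\<lambda>q. ln (3 * (u q ^ 2 + 4)) \<le> u q) sequentially"
    using u_top by (rule eventually_compose_filterlim)
  have ev3: "eventually (\<lambda>q. u q \<ge> 3) sequentially" using u_top by (simp add: filterlim_at_top)
  \<comment> \<open>The added 1 absorbs the floor in \<open>N\<close>, so that R = t^2 does not
    exceed N.\<close>
  have "eventually (\<lambda>t::real. t ^ 2 + 1 \<le> t powr (2 + \<epsilon>)) at_top" using \<epsilon> by real_asymp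
  then have ev4: "eventually (\<lambda>q. u q ^ 2 + 1 \<le> u q powr (2 + \<epsilon>)) sequentially"
    using u_top by (rule eventually_compose_filterlim)
  show ?thesis
    using ev1 ev2 ev3 ev4
  proof eventually_elim
    case (elim q)
    define t where "t = u q"
    define X where "X = t powr (2 + \<epsilon>)"
    have t: "t \<ge> 3" using elim by (simp add: t_def)
    have q0: "real q > 0" using t by (cases "q = 0") (auto simp: t_def u_def)
    have t29: "t ^ 2 \<ge> 9" using power_mono[of 3 t 2] t by simp
    have tX: "t ^ 2 + 1 \<le> X" using elim(4) by (simp add: t_def X_def)
    have X9: "X \<ge> 9" using tX t29 by simp
    have t3X: "t ^ 2 \<le> real (N q)"
      using tX X9 unfolding N_def t_def[symmetric] X_def[symmetric] by linarith
    have NX: "real (N q) \<le> X" "X / 2 \<le> real (N q)"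
      using X9 unfolding N_def t_def[symmetric] X_def[symmetric] by linarith+
    have Npos: "real (N q) > 0" using NX X9 by linarith
    show ?case
    proof (intro allI impI)
      fix chi assume chi: "dirichlet_character q chi" "chi \<noteq> principal_character q"
      let ?arg = "\<bar>arg_from_infinity (Dirichlet_L q chi) 1\<bar>"
      have lnq: "ln (3 * real q * (t ^ 2 + 4)) = t + ln (3 * (t ^ 2 + 4))"
      proof -
        have "ln (real q * (3 * (t ^ 2 + 4))) = ln (real q) + ln (3 * (t ^ 2 + 4))"
          using q0 by (intro ln_mult_pos) (auto simp: add_nonneg_pos)
        then show ?thesis by (simp add: t_def u_def mult_ac)
      qed
      have "3 + 6 / \<delta> * (ln (3 * real q * (t ^ 2 + 4)) + 4) + 2 / \<delta> \<le> 3 + 6 / \<delta> * (2 * t + 4) + 2 / \<delta>"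
        unfolding lnq using elim(2) \<delta> by (intro add_mono mult_left_mono) (auto simp: t_def)
      also have "\<dots> \<le> 3 * t + 6 / \<delta> * (6 * t) + 2 / \<delta> * t"
        using t \<delta> by (intro add_mono mult_left_mono) (auto simp: divide_right_mono)
      also have "\<dots> = C * t" by (simp add: C_def algebra_simps)
      finally have M: "3 + 6 / \<delta> * (ln (3 * real q * (t ^ 2 + 4)) + 4) + 2 / \<delta> \<le> C * t" .
      have "?arg \<le>
        (\<Sum>p | prime p \<and> p \<le> N q. arctan (1 / sqrt (real p ^ 2 - 1)))
        + (3 / t ^ 2 + C * t / t ^ 2 + C * t * real (N q) powr (- b) * (ln (1 + t ^ 2 / b) + 1)) + 4 / real (N q)"
        unfolding b_def using arg_Dirichlet_L_le[OF \<open>GRH\<close> chi _ _ _ t3X M] \<delta> t29 by simp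
      also have "(\<Sum>p | prime p \<and> p \<le> N q. arctan (1 / sqrt (real p ^ 2 - 1))) = r (N q) + ln (ln (real (N q))) + C2"
        by (simp add: r_def)
      also have "ln (ln (real (N q))) \<le> ln (ln (ln (real q))) + ln 2 + e / 2"
      proof -
        have "1 < X / 2" using X9 by simp
        then have N1: "real (N q) > 1" using NX by linarith
        have "ln (real (N q)) \<le> ln X" using NX N1 by simp
        then have "ln (ln (real (N q))) \<le> ln (ln X)" using N1 by (metis ln_mono ln_gt_zero)
        also have "ln X = (2 + \<epsilon>) * ln t" using t by (simp add: X_def ln_powr)
        also have "ln ((2 + \<epsilon>) * ln t) = ln (2 + \<epsilon>) + ln (ln t)"
          using t \<epsilon> by (intro ln_mult_pos) auto
        also have "ln (2 + \<epsilon>) = ln 2 + ln (1 + \<epsilon> / 2)"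
        proof -
          have "2 + \<epsilon> = 2 * (1 + \<epsilon> / 2)" by simp
          then show ?thesis using \<epsilon> by (metis add_pos_pos ln_mult_pos zero_less_numeral zero_less_one half_gt_zero)
        qed
        also have "ln (1 + \<epsilon> / 2) \<le> e / 2" using ln_add_one_self_le_self[of "\<epsilon> / 2"] \<epsilon> by simp
        finally show ?thesis by (simp add: t_def u_def)
      qed
      also have "C * t / t ^ 2 = C / t" using t by (simp add: power2_eq_square)
      also have "C * t * real (N q) powr (- b) * (ln (1 + t ^ 2 / b) + 1) \<le> C * 2 powr b * (t powr (- (\<epsilon> / 4)) * (ln (1 + 4 * t ^ 2) + 1))"
      proof -
        have "real (N q) powr (- b) \<le> (X / 2) powr (- b)" using NX X9 b by (intro powr_mono2') auto
        also have "\<dots> = 2 powr b * X powr (- b)" using powr_divide[of X 2 "-b"] powr_minus_divide[of 2 b] X9 by simp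
        also have "X powr (- b) = t powr (- 1 - \<epsilon> / 4)"
        proof -
          have "(2 + \<epsilon>) * (- b) = - 1 - \<epsilon> / 4" using b by simp
          then show ?thesis unfolding X_def powr_powr by simp
        qed
        also have "t powr (- 1 - \<epsilon> / 4) = t powr (- (\<epsilon> / 4)) / t" using t powr_diff[of t "- (\<epsilon> / 4)" 1] by (simp add: minus_diff_commute)
        finally have 1: "t * real (N q) powr (- b) \<le> 2 powr b * t powr (- (\<epsilon> / 4))"
          using t by (simp add: field_simps)
        have 2: "ln (1 + t ^ 2 / b) + 1 \<le> ln (1 + 4 * t ^ 2) + 1"
        proof -
          have "t ^ 2 / b \<le> t ^ 2 / (1/4)" using b by (intro frac_le) auto
          then show ?thesis using b by (intro add_right_mono ln_mono) (auto simp: add_pos_nonneg)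
        qed
        have "C * (t * real (N q) powr (- b)) * (ln (1 + t ^ 2 / b) + 1) \<le> C * (2 powr b * t powr (- (\<epsilon> / 4))) * (ln (1 + 4 * t ^ 2) + 1)"
          using C t b by (intro mult_mono mult_left_mono 1 2 mult_nonneg_nonneg) auto
        then show ?thesis by (simp add: mult_ac)
      qed
      also have "4 / real (N q) \<le> 8 * t powr (- (2 + \<epsilon>))"
      proof -
        have "4 / real (N q) \<le> 4 / (X / 2)" using NX X9 by (intro frac_le) auto
        also have "\<dots> = 8 * (1 / X)" by simp
        also have "1 / X = t powr (- (2 + \<epsilon>))" by (simp only: X_def powr_minus_divide)
        finally show ?thesis .
      qed
      finally have "?arg \<le> r (N q) + (ln (ln (ln (real q))) + ln 2 + e / 2) + C2 + err t"
        by (simp add: err_def)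
      then show "?arg \<le> ln (ln (ln (real q))) + C2 + ln 2 + e"
        using elim(1) by (simp add: t_def)
    qed
  qed
qed

theorem corollary2p6:
  assumes GRH
  shows "\<exists>E :: nat \<Rightarrow> real. E \<longlonglongrightarrow> 0 \<and>
    (\<forall>q chi. prime q \<longrightarrow> dirichlet_character q chi \<longrightarrow> chi \<noteq> principal_character q \<longrightarrow>
      \<bar>arg_from_infinity (Dirichlet_L q chi) 1\<bar> \<le> ln (ln (ln (real q))) + C2 + ln 2 + E q)"
proof -
  let ?a = "\<lambda>q chi. \<bar>arg_from_infinity (Dirichlet_L q chi) 1\<bar>"
  define B where "B = (\<lambda>q::nat. ln (ln (ln (real q))) + C2 + ln 2)"
  define A where "A = (\<lambda>q. (\<lambda>chi. ?a q chi - B q) `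
      {chi. dirichlet_character q chi \<and> chi \<noteq> principal_character q})"
  \<comment> \<open>The maximum over the finitely many characters provides the uniformity. Inserting
    0 covers moduli for which \<open>A q\<close> is empty and makes \<open>E\<close> nonnegative, so
    that only an upper bound is needed for its limit.\<close>
  define E where "E = (\<lambda>q. Max (insert 0 (A q)))"
  have fin: "finite (A q)" for q
    unfolding A_def by (intro finite_imageI finite_subset[OF _ finite_dirichlet_characters[of q]]) auto
  have "E \<longlonglongrightarrow> 0"
  proof (rule LIMSEQ_I)
    fix e :: real assume e: "e > 0"
    then have "eventually (\<lambda>q. \<forall>chi. dirichlet_character q chi \<longrightarrow> chi \<noteq> principal_character q \<longrightarrow>
     ?a q chi \<le> ln (ln (ln (real q))) + C2 + ln 2 + e / 2) sequentially"
      by (intro arg_Dirichlet_L_eventually_le \<open>GRH\<close>) simp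
    then obtain Q where Q: "\<And>q chi. q \<ge> Q \<Longrightarrow> dirichlet_character q chi \<Longrightarrow> chi \<noteq> principal_character q \<Longrightarrow>
     ?a q chi \<le> B q + e / 2"
      unfolding eventually_sequentially B_def by blast
    have "norm (E q - 0) < e" if "q \<ge> Q" for q
    proof -
      have "0 \<le> E q" unfolding E_def using fin by simp
      moreover have "E q \<le> e / 2"
      proof -
        have "x \<le> e / 2" if xA: "x \<in> A q" for x
        proof -
          obtain chi where "dirichlet_character q chi" "chi \<noteq> principal_character q"
            and x: "x = ?a q chi - B q"
            using xA by (auto simp: A_def)
          then show ?thesis using Q[OF \<open>q \<ge> Q\<close>, of chi] by linarith
        qed
        then show ?thesis unfolding E_def using fin[of q] e by (intro Max.boundedI) auto
      qed
      ultimately show ?thesis using e by simp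
    qed
    then show "\<exists>Q. \<forall>q\<ge>Q. norm (E q - 0) < e" by blast
  qed
  moreover have "?a q chi \<le> B q + E q"
    if "dirichlet_character q chi" "chi \<noteq> principal_character q" for q chi
  proof -
    have "?a q chi - B q \<in> insert 0 (A q)" using that by (auto simp: A_def)
    then have "?a q chi - B q \<le> E q"
      unfolding E_def using fin by (intro Max_ge) auto
    then show ?thesis by simp
  qed
  ultimately show ?thesis unfolding B_def by blast
qed

end
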